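(* Let $n\ge1$, $p>1$, let $U\subset\mathbb{R}^n$ be a smooth bounded domain, and let $v_0\in H_0^1(U)$. Assume that $I(v_0)>0$, $J(v_0)=d$, and that $v$ is a global (weak) solution to the problem $$v_t-\Delta v_t-\Delta v=v|v|^{p-1}\log|v| \ \text{ in } U\times\mathbb{R}^+,\qquad v=0 \ \text{ on } \partial U\times\mathbb{R}^+,\qquad v(\cdot,0)=v_0 \ \text{ in } U.$$ Then there exist constants $C>0$ and $\mu>0$ such that $$\|v(\cdot,t)\|_{H_0^1(U)}\le Ce^{-\mu t},\qquad 0\le t<\infty.$$
   Context: Notation: $\|g\|_q=(\int_U|g|^q\,dx)^{1/q}$ for $1\le q<\infty$, $\|\cdot\|=\|\cdot\|_2$, $(h,g)_2=\int_U hg\,dx$ (for vector fields, $(\nabla h,\nabla g)_2=\int_U\nabla h\cdot\nabla g\,dx$), and $\|v\|_{H_0^1(U)}^2=\|v\|^2+\|\nabla v\|^2$. The expressions $|s|^{p+1}\log|s|$ and $s|s|^{p-1}\log|s|$ are taken to be $0$ at $s=0$. Functionals on $H_0^1(U)$: $$J(v)=\tfrac12\|\nabla v\|^2-\tfrac1{1+p}\int_U|v|^{1+p}\log|v|\,dx+\tfrac1{(1+p)^2}\|v\|_{1+p}^{1+p},\qquad I(v)=\|\nabla v\|^2-\int_U|v|^{1+p}\log|v|\,dx.$$ Nehari manifold: $\mathcal N=\{v\in H_0^1(U): I(v)=0,\ \|\nabla v\|^2\neq0\}$. Depth of the well: $d=\inf_{v\in\mathcal N}J(v)$. Weak solution on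 $(0,T)$: a function $v\in L^\infty((0,T);H_0^1(U))$ with $v_t\in L^2((0,T);L^2(U))$ and $v(x,0)=v_0(x)$, satisfying, for all $w\in H_0^1(U)$ and $t\in(0,T)$, $$(v_t,w)_2+(\nabla v_t,\nabla w)_2+(\nabla v,\nabla w)_2=(v|v|^{p-1}\log|v|,w)_2.$$ A global (weak) solution is a weak solution that exists for all $t>0$, i.e. whose maximal existence time is $T=\infty$. *)

theory Defs
  imports "HOL-Analysis.Analysis"
begin

section \<open>Smooth functions and smooth bounded domains\<close>

text \<open>\<open>Ck_on k S f\<close> is meant for open \<open>S\<close>: all partial derivatives up to order \<open>k\<close> exist
  and are continuous on \<open>S\<close>.\<close>

fun Ck_on :: "nat \<Rightarrow> 'a::euclidean_space set \<Rightarrow> ('a \<Rightarrow> real) \<Rightarrow> bool" where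
  "Ck_on 0 S f \<longleftrightarrow> continuous_on S f"
| "Ck_on (Suc k) S f \<longleftrightarrow> f differentiable_on S \<and>
     (\<forall>b\<in>Basis. Ck_on k S (\<lambda>x. frechet_derivative f (at x) b))"

definition smooth_on :: "'a::euclidean_space set \<Rightarrow> ('a \<Rightarrow> real) \<Rightarrow> bool" where
  "smooth_on S f \<longleftrightarrow> (\<forall>k. Ck_on k S f)"

text \<open>Smoothness of the boundary, by local defining functions: near each boundary point, \<open>U\<close> is
  the side \<open>\<rho> < 0\<close> of the zero set of a smooth function without critical points.\<close>

definition smooth_boundary :: "'a::euclidean_space set \<Rightarrow> bool" where
  "smooth_boundary U \<longleftrightarrow>
     (\<forall>x\<in>frontier U. \<exists>W \<rho>. open W \<and> x \<in> W \<and> smooth_on W \<rho> \<and>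
        (\<forall>y\<in>W. frechet_derivative \<rho> (at y) \<noteq> (\<lambda>h. 0)) \<and>
        U \<inter> W = {y\<in>W. \<rho> y < 0})"

definition smooth_bounded_domain :: "'a::euclidean_space set \<Rightarrow> bool" where
  "smooth_bounded_domain U \<longleftrightarrow>
     open U \<and> connected U \<and> U \<noteq> {} \<and> bounded U \<and> smooth_boundary U"

text \<open>The space of smooth functions with compact support contained in \<open>U\<close>.\<close>

definition test_functions :: "'a::euclidean_space set \<Rightarrow> ('a \<Rightarrow> real) set" where
  "test_functions U =
     {\<phi>. smooth_on UNIV \<phi> \<and> compact (closure {x. \<phi> x \<noteq> 0}) \<and> closure {x. \<phi> x \<noteq> 0} \<subseteq> U}"

section \<open>Lebesgue and Sobolev spaces\<close>

text \<open>Elements of the function spaces are represented by functions, and two functions that agree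
  almost everywhere in \<open>U\<close> represent the same element; values outside \<open>U\<close> play no role.
  The target type is generic, so that the same definitions serve scalar functions and vector
  fields.\<close>

definition L2 :: "'a::euclidean_space set \<Rightarrow> ('a \<Rightarrow> 'b::real_normed_vector) set" where
  "L2 U = {g. g \<in> borel_measurable (lebesgue_on U) \<and>
              integrable (lebesgue_on U) (\<lambda>x. (norm (g x))\<^sup>2)}"

definition Lnorm :: "'a::euclidean_space set \<Rightarrow> real \<Rightarrow> ('a \<Rightarrow> 'b::real_normed_vector) \<Rightarrow> real" where
  "Lnorm U q g = (LINT x|lebesgue_on U. norm (g x) powr q) powr (1 / q)"

definition L2_inner ::
  "'a::euclidean_space set \<Rightarrow> ('a \<Rightarrow> 'b::real_inner) \<Rightarrow> ('a \<Rightarrow> 'b) \<Rightarrow> real" where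
  "L2_inner U h g = (LINT x|lebesgue_on U. h x \<bullet> g x)"

definition has_weak_gradient ::
  "'a::euclidean_space set \<Rightarrow> ('a \<Rightarrow> real) \<Rightarrow> ('a \<Rightarrow> 'a) \<Rightarrow> bool" where
  "has_weak_gradient U u G \<longleftrightarrow> G \<in> L2 U \<and>
     (\<forall>\<phi>\<in>test_functions U. \<forall>b\<in>Basis.
        (LINT x|lebesgue_on U. u x * frechet_derivative \<phi> (at x) b) =
        - (LINT x|lebesgue_on U. (G x \<bullet> b) * \<phi> x))"

definition H1 :: "'a::euclidean_space set \<Rightarrow> ('a \<Rightarrow> real) set" where
  "H1 U = {u. u \<in> L2 U \<and> (\<exists>G. has_weak_gradient U u G)}"

text \<open>For \<open>u\<close> in \<open>H1 U\<close> the weak gradient is unique up to null sets of \<open>U\<close>, so the choice is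
  irrelevant for everything below.\<close>

definition wgrad :: "'a::euclidean_space set \<Rightarrow> ('a \<Rightarrow> real) \<Rightarrow> 'a \<Rightarrow> 'a" where
  "wgrad U u = (SOME G. has_weak_gradient U u G)"

definition H1_norm :: "'a::euclidean_space set \<Rightarrow> ('a \<Rightarrow> real) \<Rightarrow> real" where
  "H1_norm U u = sqrt ((Lnorm U 2 u)\<^sup>2 + (Lnorm U 2 (wgrad U u))\<^sup>2)"

text \<open>The closure of the test functions in \<open>H1 U\<close>; its norm is that of \<open>H1 U\<close>.\<close>

definition H01 :: "'a::euclidean_space set \<Rightarrow> ('a \<Rightarrow> real) set" where
  "H01 U = {u\<in>H1 U. \<exists>\<phi>. (\<forall>k::nat. \<phi> k \<in> test_functions U) \<and>
                       (\<lambda>k. H1_norm U (\<lambda>x. \<phi> k x - u x)) \<longlonglongrightarrow> 0}"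

section \<open>The functionals, the Nehari manifold and the depth of the well\<close>

text \<open>The conventions for the logarithmic terms at \<open>s = 0\<close> hold because \<open>0 powr a = 0\<close>.

  If \<open>\<bar>v\<bar> powr (1 + p) * ln \<bar>v\<bar>\<close> is not integrable, its integral below is 0 by convention, whereas
  mathematically the integral is \<open>+\<infinity>\<close> (the integrand is bounded below and \<open>U\<close> is bounded). Such
  \<open>v\<close> do not enter \<open>nehari\<close>: for them \<open>nehari_I p U v\<close> is \<open>(Lnorm U 2 (wgrad U v))\<^sup>2\<close>, which
  \<open>nehari\<close> requires to be nonzero. For the remaining \<open>v\<close> also \<open>\<bar>v\<bar> powr (1 + p)\<close> is integrable.\<close>

definition energy_J :: "real \<Rightarrow> 'a::euclidean_space set \<Rightarrow> ('a \<Rightarrow> real) \<Rightarrow> real" where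
  "energy_J p U v = 1 / 2 * (Lnorm U 2 (wgrad U v))\<^sup>2
     - 1 / (1 + p) * (LINT x|lebesgue_on U. \<bar>v x\<bar> powr (1 + p) * ln \<bar>v x\<bar>)
     + 1 / (1 + p)\<^sup>2 * (Lnorm U (1 + p) v) powr (1 + p)"

definition nehari_I :: "real \<Rightarrow> 'a::euclidean_space set \<Rightarrow> ('a \<Rightarrow> real) \<Rightarrow> real" where
  "nehari_I p U v = (Lnorm U 2 (wgrad U v))\<^sup>2
     - (LINT x|lebesgue_on U. \<bar>v x\<bar> powr (1 + p) * ln \<bar>v x\<bar>)"

definition nehari :: "real \<Rightarrow> 'a::euclidean_space set \<Rightarrow> ('a \<Rightarrow> real) set" where
  "nehari p U = {v\<in>H01 U. nehari_I p U v = 0 \<and> (Lnorm U 2 (wgrad U v))\<^sup>2 \<noteq> 0}"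

definition well_depth :: "real \<Rightarrow> 'a::euclidean_space set \<Rightarrow> real" where
  "well_depth p U = (INF v\<in>nehari p U. energy_J p U v)"

section \<open>Functions of time with values in a function space\<close>

text \<open>Here \<open>X\<close> is a space of functions on \<open>U\<close> and \<open>N\<close> its norm. Bochner (strong) measurability:
  almost everywhere the norm limit of simple \<open>X\<close>-valued functions.\<close>

definition bochner_measurable ::
  "real measure \<Rightarrow> 'b::minus set \<Rightarrow> ('b \<Rightarrow> real) \<Rightarrow> (real \<Rightarrow> 'b) \<Rightarrow> bool" where
  "bochner_measurable M X N v \<longleftrightarrow>
     (\<exists>s. (\<forall>k::nat. simple_function M (s k) \<and> s k ` space M \<subseteq> X) \<and>
          (AE t in M. (\<lambda>k. N (s k t - v t)) \<longlonglongrightarrow> 0))"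

definition bochner_Linf ::
  "real \<Rightarrow> 'b::minus set \<Rightarrow> ('b \<Rightarrow> real) \<Rightarrow> (real \<Rightarrow> 'b) set" where
  "bochner_Linf T X N = {v. bochner_measurable (lebesgue_on {0<..<T}) X N v \<and>
     (AE t in lebesgue_on {0<..<T}. v t \<in> X) \<and>
     (\<exists>K. AE t in lebesgue_on {0<..<T}. N (v t) \<le> K)}"

definition bochner_L2 ::
  "real \<Rightarrow> 'b::minus set \<Rightarrow> ('b \<Rightarrow> real) \<Rightarrow> (real \<Rightarrow> 'b) set" where
  "bochner_L2 T X N = {v. bochner_measurable (lebesgue_on {0<..<T}) X N v \<and>
     (AE t in lebesgue_on {0<..<T}. v t \<in> X) \<and>
     integrable (lebesgue_on {0<..<T}) (\<lambda>t. (N (v t))\<^sup>2)}"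

text \<open>\<open>v'\<close> is the weak derivative of \<open>v\<close> on \<open>(0,T)\<close>: the Bochner integrals in \<open>L\<^sup>2(U)\<close> satisfy
  \<open>\<integral> \<phi>' v dt = - \<integral> \<phi> v' dt\<close> for all scalar test functions \<open>\<phi>\<close>, the equality of the two elements
  of \<open>L\<^sup>2(U)\<close> being expressed by taking the inner product with an arbitrary \<open>w\<close>.\<close>

definition has_weak_time_derivative ::
  "'a::euclidean_space set \<Rightarrow> real \<Rightarrow> (real \<Rightarrow> 'a \<Rightarrow> real) \<Rightarrow> (real \<Rightarrow> 'a \<Rightarrow> real) \<Rightarrow> bool" where
  "has_weak_time_derivative U T v v' \<longleftrightarrow>
     (\<forall>\<phi>\<in>test_functions {0<..<T}. \<forall>w\<in>L2 U.
        (LINT t|lebesgue_on {0<..<T}. deriv \<phi> t * L2_inner U (v t) w) =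
        - (LINT t|lebesgue_on {0<..<T}. \<phi> t * L2_inner U (v' t) w))"

section \<open>Weak solutions\<close>

definition log_source :: "real \<Rightarrow> real \<Rightarrow> real" where
  "log_source p s = s * \<bar>s\<bar> powr (p - 1) * ln \<bar>s\<bar>"

text \<open>Since \<open>v\<close> and its time derivative \<open>v'\<close> are square integrable in time with values in
  \<open>L\<^sup>2(U)\<close>, \<open>v\<close> has a unique representative that is continuous into \<open>L\<^sup>2(U)\<close>, and being bounded
  in \<open>H01 U\<close> this representative takes all its values in \<open>H01 U\<close>. As usual \<open>v\<close> denotes this
  representative, which gives a meaning to \<open>v 0 = v0\<close> and to \<open>v t\<close> for every single \<open>t\<close>.

  In contrast, \<open>v'\<close> is only determined for almost every \<open>t\<close>, so the variational identity is
  required for almost every \<open>t\<close>. For its terms to make sense, \<open>v' t\<close> has to possess a weak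
  gradient in \<open>L\<^sup>2(U)\<close> and the source term paired with \<open>w\<close> has to be integrable.\<close>

definition weak_solution ::
  "real \<Rightarrow> 'a::euclidean_space set \<Rightarrow> real \<Rightarrow> ('a \<Rightarrow> real) \<Rightarrow> (real \<Rightarrow> 'a \<Rightarrow> real) \<Rightarrow> bool" where
  "weak_solution p U T v0 v \<longleftrightarrow>
     v \<in> bochner_Linf T (H01 U) (H1_norm U) \<and>
     (\<forall>t\<in>{0..<T}. v t \<in> H01 U) \<and>
     (\<forall>t\<in>{0..<T}. ((\<lambda>s. Lnorm U 2 (v s - v t)) \<longlongrightarrow> 0) (at t within {0..<T})) \<and>
     (AE x in lebesgue_on U. v 0 x = v0 x) \<and>
     (\<exists>v'. v' \<in> bochner_L2 T (L2 U) (Lnorm U 2) \<and>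
        has_weak_time_derivative U T v v' \<and>
        (AE t in lebesgue_on {0<..<T}.
           v' t \<in> H1 U \<and>
           (\<forall>w\<in>H01 U.
              integrable (lebesgue_on U) (\<lambda>x. log_source p (v t x) * w x) \<and>
              L2_inner U (v' t) w + L2_inner U (wgrad U (v' t)) (wgrad U w)
                + L2_inner U (wgrad U (v t)) (wgrad U w)
              = L2_inner U (\<lambda>x. log_source p (v t x)) w)))"

text \<open>No bound uniform in \<open>T\<close> is imposed.\<close>

definition global_weak_solution ::
  "real \<Rightarrow> 'a::euclidean_space set \<Rightarrow> ('a \<Rightarrow> real) \<Rightarrow> (real \<Rightarrow> 'a \<Rightarrow> real) \<Rightarrow> bool" where
  "global_weak_solution p U v0 v \<longleftrightarrow> (\<forall>T>0. weak_solution p U T v0 v)"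

end

theory Submission
  imports Defs "HOL-Real_Asymp.Real_Asymp"
begin

text \<open>The assumptions force \<open>J v0 = d > 0\<close>, and a positive depth already contains the Sobolev-type
  information that the argument needs. A function with small gradient and \<open>I < 0\<close> could be scaled
  down to a point of the Nehari manifold with energy below \<open>d\<close>; hence \<open>I \<ge> 0\<close> for small gradients,
  which bounds the integral of \<open>\<bar>u\<bar> powr (1 + p) * ln \<bar>u\<bar>\<close>. By homogeneity the source term is a locally
  Lipschitz map from \<open>H01\<close> to its dual, no restriction on \<open>p\<close> from above being used.

  Consequently \<open>v\<close> is locally Lipschitz in time with values in \<open>H01\<close>, the energy is nonincreasing, and
  it drops below \<open>d\<close> immediately because \<open>I v0 > 0\<close>. Then \<open>I (v t)\<close> cannot become negative: it would
  have to vanish first, either on the Nehari manifold, where \<open>J \<ge> d\<close>, or at the zero function, around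
  which \<open>I \<ge> 0\<close>. For energies at most \<open>d1 < d\<close> the scaling onto the Nehari manifold moves points with
  \<open>I \<ge> 0\<close> by a factor bounded away from 1, so that \<open>I u \<ge> \<kappa> * (gnorm U u)\<^sup>2\<close>. Since the squared \<open>H1\<close> norm
  of \<open>v t\<close> has derivative \<open>- 2 * I (v t)\<close>, it decays exponentially.\<close>

section \<open>Smooth functions and test functions\<close>

text \<open>Two obstacles shape the proof. For large \<open>p\<close> it is not known beforehand
  that the logarithmic integral of an element of \<open>H01\<close> is finite, yet scaling onto the
  Nehari manifold presupposes this (\<open>energy_finite\<close>). Test functions are bounded, so
  the scaling applies to them; Fatou's lemma carries the resulting bound to all elements of
  \<open>H01\<close> with small gradient, and homogeneity carries it to the rest.

  The second obstacle is the time derivative. It is a weak derivative with values in L2, and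
  \<open>v' t\<close> is only known to lie in \<open>H1\<close>, not in \<open>H01\<close>, so it
  cannot be inserted into the equation. For a test function \<open>w\<close>, integration by parts
  turns the H1 product with \<open>w\<close> into an L2 product with \<open>w - laplacian w\<close>;
  hence the weak derivative in L2 suffices to integrate the equation in time. Density then admits as
  \<open>w\<close> the increment of \<open>v\<close>, which does lie in \<open>H01\<close>. All
  identities are therefore kept as estimates of increments over \<open>{s..t}\<close> with errors of
  higher order in \<open>t - s\<close>, and summing them over fine partitions replaces
  differentiation.\<close>

lemma Ck_on_cong:
  fixes f g :: "'a::euclidean_space \<Rightarrow> real"
  assumes "open S" "\<And>x. x \<in> S \<Longrightarrow> f x = g x" "Ck_on k S f"
  shows "Ck_on k S g"
  using assms
proof (induction k arbitrary: f g)
  case 0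
  then show ?case by (metis Ck_on.simps(1) continuous_on_cong)
next
  case (Suc k)
  have df: "f differentiable at x" if "x \<in> S" for x
    using Suc.prems that by (auto simp: differentiable_on_eq_differentiable_at)
  have hd: "(g has_derivative frechet_derivative f (at x)) (at x)" if "x \<in> S" for x
    using has_derivative_transform_within_open[OF iffD1[OF frechet_derivative_works df[OF that]] Suc.prems(1) that Suc.prems(2)] .
  have "g differentiable_on S"
    using hd Suc.prems(1) by (auto simp: differentiable_on_eq_differentiable_at differentiable_def)
  moreover have "Ck_on k S (\<lambda>x. frechet_derivative g (at x) b)" if "b \<in> Basis" for b
    by (rule Suc.IH[of "\<lambda>x. frechet_derivative f (at x) b"])
       (use Suc.prems frechet_derivative_at[OF hd] that in simp_all)
  ultimately show ?case by simp
qed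

text \<open>An explicit candidate \<open>D\<close> for the derivative spares the later inductions
  any computation with \<open>frechet_derivative\<close>; on an open set the two agree at every
  point.\<close>

lemma Ck_on_SucI:
  fixes f :: "'a::euclidean_space \<Rightarrow> real"
  assumes "open S" "\<And>x. x \<in> S \<Longrightarrow> (f has_derivative D x) (at x)"
    "\<And>b. b \<in> Basis \<Longrightarrow> Ck_on k S (\<lambda>x. D x b)"
  shows "Ck_on (Suc k) S f"
proof -
  have "f differentiable_on S"
    using assms by (auto simp: differentiable_on_eq_differentiable_at differentiable_def)
  moreover have "Ck_on k S (\<lambda>x. frechet_derivative f (at x) b)" if "b \<in> Basis" for b
    by (rule Ck_on_cong[of S "\<lambda>x. D x b"])
       (use assms(1,3) that frechet_derivative_at[OF assms(2)] in simp_all)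
  ultimately show ?thesis by simp
qed

lemma Ck_on_SucD:
  fixes f :: "'a::euclidean_space \<Rightarrow> real"
  assumes "open S" "Ck_on (Suc k) S f"
  shows "\<And>x. x \<in> S \<Longrightarrow> (f has_derivative frechet_derivative f (at x)) (at x)"
    "\<And>b. b \<in> Basis \<Longrightarrow> Ck_on k S (\<lambda>x. frechet_derivative f (at x) b)"
  using assms frechet_derivative_works by (auto simp: differentiable_on_eq_differentiable_at)

lemma Ck_on_Suc_imp: "Ck_on (Suc k) S f \<Longrightarrow> Ck_on k S f"
proof (induction k arbitrary: f)
  case 0
  then show ?case by (auto intro: differentiable_imp_continuous_on)
next
  case (Suc k)
  then show ?case by (metis Ck_on.simps(2))
qed

lemma Ck_on_const: "open S \<Longrightarrow> Ck_on k S (\<lambda>x::'a::euclidean_space. c)"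
proof (induction k arbitrary: c)
  case (Suc k)
  show ?case by (rule Ck_on_SucI[where D="\<lambda>_ _. 0"]) (use Suc in auto)
qed auto

lemma Ck_on_inner: "open S \<Longrightarrow> Ck_on k S (\<lambda>x::'a::euclidean_space. x \<bullet> a)"
proof (cases k)
  case (Suc k)
  assume "open S"
  show ?thesis unfolding Suc
    by (rule Ck_on_SucI[where D="\<lambda>_ h. h \<bullet> a"])
       (use \<open>open S\<close> Ck_on_const in \<open>auto intro!: derivative_eq_intros\<close>)
qed (auto intro!: continuous_intros)

lemma Ck_on_add:
  fixes f g :: "'a::euclidean_space \<Rightarrow> real"
  assumes "open S" "Ck_on k S f" "Ck_on k S g"
  shows "Ck_on k S (\<lambda>x. f x + g x)"
  using assms
proof (induction k arbitrary: f g)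
  case (Suc k)
  note F = Ck_on_SucD[OF Suc.prems(1,2)] and G = Ck_on_SucD[OF Suc.prems(1,3)]
  show ?case
    by (rule Ck_on_SucI[where D="\<lambda>x h. frechet_derivative f (at x) h + frechet_derivative g (at x) h"])
       (use Suc.prems(1) Suc.IH F G in \<open>auto intro!: has_derivative_add\<close>)
qed (auto intro: continuous_intros)

lemma Ck_on_mult:
  fixes f g :: "'a::euclidean_space \<Rightarrow> real"
  assumes "open S" "Ck_on k S f" "Ck_on k S g"
  shows "Ck_on k S (\<lambda>x. f x * g x)"
  using assms
proof (induction k arbitrary: f g)
  case (Suc k)
  note F = Ck_on_SucD[OF Suc.prems(1,2)] and G = Ck_on_SucD[OF Suc.prems(1,3)]
  show ?case
    by (rule Ck_on_SucI[where D="\<lambda>x h. f x * frechet_derivative g (at x) h + frechet_derivative f (at x) h * g x"])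
       (use Suc.prems(1) Suc.IH F G Ck_on_Suc_imp[OF Suc.prems(2)] Ck_on_Suc_imp[OF Suc.prems(3)]
        in \<open>auto intro!: has_derivative_mult Ck_on_add\<close>)
qed (auto intro: continuous_intros)

text \<open>The functions \<open>exp (- c / t)\<close>, continued by 0 to \<open>t \<le> 0\<close>, and all their derivatives have
  this form.\<close>

definition bump_fun :: "real \<Rightarrow> real poly \<Rightarrow> real \<Rightarrow> real" where
  "bump_fun c P t = (if t > 0 then poly P (1 / t) * exp (- c / t) else 0)"

text \<open>With \<open>y = 1 / t\<close>, dividing by \<open>t\<close> multiplies the polynomial by
  \<open>y\<close>, so the claim is that \<open>exp (- c * y)\<close> beats every polynomial as
  \<open>y\<close> tends to infinity.\<close>

lemma bump_fun_flat:
  assumes "c > 0"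
  shows "((\<lambda>t. bump_fun c P t / t) \<longlongrightarrow> 0) (at 0)"
proof -
  have *: "((\<lambda>y. poly Q y * exp (- c * y)) \<longlongrightarrow> 0) at_top" for Q :: "real poly"
  proof (induction Q)
    case (pCons a Q)
    have "((\<lambda>y. poly R y * exp (- c * y)) \<longlongrightarrow> 0) at_top" for R
    proof -
      have "((\<lambda>y. coeff R i * (y ^ i * exp (- c * y))) \<longlongrightarrow> 0) at_top" for i
      proof -
        have "((\<lambda>y. y ^ i * exp (- c * y)) \<longlongrightarrow> 0) at_top"
        proof -
          have "((\<lambda>y. (c * y) ^ i / exp (c * y)) \<longlongrightarrow> 0) at_top"
            by (rule filterlim_compose[OF tendsto_power_div_exp_0])
               (use assms in \<open>simp add: filterlim_tendsto_pos_mult_at_top[OF tendsto_const _ filterlim_ident]\<close>)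
          then have "((\<lambda>y. 1 / c ^ i * ((c * y) ^ i / exp (c * y))) \<longlongrightarrow> 0) at_top"
            by (rule tendsto_mult_right_zero)
          then show ?thesis
            using assms by (simp add: power_mult_distrib exp_minus field_simps)
        qed
        then show ?thesis by (rule tendsto_mult_right_zero)
      qed
      then have "((\<lambda>y. \<Sum>i\<le>degree R. coeff R i * (y ^ i * exp (- c * y))) \<longlongrightarrow> (\<Sum>i\<le>degree R. 0)) at_top"
        by (intro tendsto_sum) auto
      then show ?thesis by (simp add: poly_altdef sum_distrib_right mult.assoc)
    qed
    then show ?case .
  qed auto
  have "((\<lambda>t. poly ([:0, 1:] * P) (1 / t) * exp (- c * (1 / t))) \<longlongrightarrow> 0) (at_right 0)"
    by (rule filterlim_compose[OF *])
       (use filterlim_inverse_at_top_right in \<open>simp add: inverse_eq_divide\<close>)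
  then have "((\<lambda>t. bump_fun c P t / t) \<longlongrightarrow> 0) (at_right 0)"
  proof (rule Lim_transform_eventually)
    show "\<forall>\<^sub>F t in at_right 0. poly ([:0, 1:] * P) (1 / t) * exp (- c * (1 / t)) = bump_fun c P t / t"
      by (auto simp: eventually_at_filter bump_fun_def)
  qed
  moreover have "((\<lambda>t. bump_fun c P t / t) \<longlongrightarrow> 0) (at_left 0)"
    by (rule Lim_transform_eventually[of "\<lambda>_. 0"])
       (auto simp: eventually_at_filter bump_fun_def)
  ultimately show ?thesis by (simp add: filterlim_split_at)
qed

text \<open>In the variable \<open>y = 1 / t\<close> the derivative with respect to \<open>t\<close>
  is \<open>- y^2\<close> times that with respect to \<open>y\<close>; applied to
  \<open>P y * exp (- c * y)\<close> this gives \<open>y^2 * (c * P - P')\<close> times the same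
  exponential.\<close>

definition bump_deriv :: "real \<Rightarrow> real poly \<Rightarrow> real poly" where
  "bump_deriv c P = [:0, 0, 1:] * (smult c P - pderiv P)"

lemma bump_fun_deriv:
  assumes "c > 0"
  shows "(bump_fun c P has_real_derivative bump_fun c (bump_deriv c P) t) (at t)"
proof -
  consider "t > 0" | "t < 0" | "t = 0" by linarith
  then show ?thesis
  proof cases
    case 1
    have "((\<lambda>t. poly P (1 / t) * exp (- c / t)) has_real_derivative bump_fun c (bump_deriv c P) t) (at t)"
      using 1 by (auto intro!: derivative_eq_intros DERIV_chain'[OF _ poly_DERIV]
          simp: bump_fun_def bump_deriv_def field_simps power2_eq_square)
    then show ?thesis
      by (rule has_field_derivative_transform_within_open[of _ _ _ "{0<..}"]) (use 1 in \<open>auto simp: bump_fun_def\<close>)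
  next
    case 2
    have "((\<lambda>t. 0) has_real_derivative bump_fun c (bump_deriv c P) t) (at t)"
      using 2 by (auto simp: bump_fun_def)
    then show ?thesis
      by (rule has_field_derivative_transform_within_open[of _ _ _ "{..<0}"]) (use 2 in \<open>auto simp: bump_fun_def\<close>)
  next
    case 3
    then show ?thesis using bump_fun_flat[OF assms, of P]
      by (simp add: has_field_derivative_iff bump_fun_def)
  qed
qed

lemma Ck_on_bump:
  fixes q :: "'a::euclidean_space \<Rightarrow> real"
  assumes "open S" "\<And>k. Ck_on k S q" "c > 0"
  shows "Ck_on k S (\<lambda>x. bump_fun c P (q x))"
proof (induction k arbitrary: P)
  case 0
  have "continuous_on UNIV (bump_fun c P)"
    using bump_fun_deriv[OF assms(3)] by (meson DERIV_continuous_on has_field_derivative_at_within)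
  with assms(2)[of 0] show ?case
    by (auto intro: continuous_on_compose2)
next
  case (Suc k)
  note Q = Ck_on_SucD[OF assms(1) assms(2)]
  show ?case
  proof (rule Ck_on_SucI[where D="\<lambda>x h. bump_fun c (bump_deriv c P) (q x) * frechet_derivative q (at x) h"])
    fix x assume "x \<in> S"
    have "(bump_fun c P has_derivative (*) (bump_fun c (bump_deriv c P) (q x))) (at (q x))"
      using bump_fun_deriv[OF assms(3)] by (simp add: has_field_derivative_def)
    from has_derivative_compose[OF Q(1)[OF \<open>x \<in> S\<close>] this]
    show "((\<lambda>x. bump_fun c P (q x)) has_derivative
            (\<lambda>h. bump_fun c (bump_deriv c P) (q x) * frechet_derivative q (at x) h)) (at x)" .
  qed (use assms Q Suc in \<open>auto intro!: Ck_on_mult\<close>)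
qed

lemma bump_fun_1: "bump_fun c 1 t = (if t > 0 then exp (- c / t) else 0)"
  by (simp add: bump_fun_def)

lemma bump_fun_1_bounds: "c > 0 \<Longrightarrow> 0 \<le> bump_fun c 1 t \<and> bump_fun c 1 t \<le> 1"
  by (simp add: bump_fun_def)

text \<open>As \<open>c\<close> tends to 0 the bump becomes the indicator of the positive half-line.
  All smooth approximations of indicators, in space and in time, come from this limit.\<close>

lemma bump_fun_1_tendsto: "t > 0 \<Longrightarrow> (\<lambda>k. bump_fun (1 / real (Suc k)) 1 t) \<longlonglongrightarrow> 1"
proof -
  assume t: "t > 0"
  have "(\<lambda>k. exp (- (1 / real (Suc k)) / t)) \<longlonglongrightarrow> exp (- 0 / t)"
    using t by (intro tendsto_intros LIMSEQ_Suc[OF lim_1_over_n]) auto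
  with t show ?thesis by (simp add: bump_fun_1)
qed

lemma smooth_onD: "smooth_on S f \<Longrightarrow> Ck_on k S f"
  by (simp add: smooth_on_def)

lemma smooth_on_mult:
  "open S \<Longrightarrow> smooth_on S f \<Longrightarrow> smooth_on S g \<Longrightarrow> smooth_on S (\<lambda>x::'a::euclidean_space. f x * g x)"
  by (simp add: smooth_on_def Ck_on_mult)

lemma smooth_on_add:
  "open S \<Longrightarrow> smooth_on S f \<Longrightarrow> smooth_on S g \<Longrightarrow> smooth_on S (\<lambda>x::'a::euclidean_space. f x + g x)"
  by (simp add: smooth_on_def Ck_on_add)

lemma smooth_on_const: "open S \<Longrightarrow> smooth_on S (\<lambda>x::'a::euclidean_space. c)"
  by (simp add: smooth_on_def Ck_on_const)

lemma smooth_on_inner: "open S \<Longrightarrow> smooth_on S (\<lambda>x::'a::euclidean_space. x \<bullet> a)"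
  by (simp add: smooth_on_def Ck_on_inner)

section \<open>Test functions: algebra, derivatives and integrals\<close>

lemma test_functionsI:
  assumes "smooth_on UNIV \<phi>" "compact K" "K \<subseteq> U" "\<And>x. x \<notin> K \<Longrightarrow> \<phi> x = 0"
  shows "\<phi> \<in> test_functions U"
proof -
  have "closure {x. \<phi> x \<noteq> 0} \<subseteq> K"
    by (rule closure_minimal) (use assms compact_imp_closed in auto)
  moreover have "compact (closure {x. \<phi> x \<noteq> 0})"
    using compact_closure calculation assms(2) bounded_subset compact_imp_bounded closure_subset
    by (metis (no_types, lifting) subset_trans)
  ultimately show ?thesis using assms unfolding test_functions_def by auto
qed

lemma test_functionsE:
  assumes "\<phi> \<in> test_functions U"
  obtains K where "compact K" "K \<subseteq> U" "\<And>x. x \<notin> K \<Longrightarrow> \<phi> x = 0"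
proof
  show "compact (closure {x. \<phi> x \<noteq> 0})" "closure {x. \<phi> x \<noteq> 0} \<subseteq> U"
    using assms by (auto simp: test_functions_def)
  show "\<phi> x = 0" if "x \<notin> closure {x. \<phi> x \<noteq> 0}" for x
    using that closure_subset[of "{x. \<phi> x \<noteq> 0}"] by auto
qed

lemma test_smooth: "\<phi> \<in> test_functions U \<Longrightarrow> smooth_on UNIV \<phi>"
  by (simp add: test_functions_def)

lemma test_zero: "x \<notin> U \<Longrightarrow> \<phi> \<in> test_functions U \<Longrightarrow> \<phi> x = 0"
  by (metis subsetD test_functionsE)

lemma test_mult_smooth:
  assumes "\<phi> \<in> test_functions U" "smooth_on UNIV f"
  shows "(\<lambda>x. f x * \<phi> x) \<in> test_functions U"
proof -
  obtain K where "compact K" "K \<subseteq> U" "\<And>x. x \<notin> K \<Longrightarrow> \<phi> x = 0"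
    using test_functionsE[OF assms(1)] by blast
  with assms test_smooth show ?thesis
    by (intro test_functionsI[of _ K] smooth_on_mult) auto
qed

lemma test_cmult: "\<phi> \<in> test_functions U \<Longrightarrow> (\<lambda>x. c * \<phi> x) \<in> test_functions U"
  by (intro test_mult_smooth smooth_on_const) auto

lemma test_add:
  assumes "\<phi> \<in> test_functions U" "\<psi> \<in> test_functions U"
  shows "(\<lambda>x. \<phi> x + \<psi> x) \<in> test_functions U"
proof -
  obtain K where "compact K" "K \<subseteq> U" "\<And>x. x \<notin> K \<Longrightarrow> \<phi> x = 0"
    using test_functionsE[OF assms(1)] by blast
  moreover obtain L where "compact L" "L \<subseteq> U" "\<And>x. x \<notin> L \<Longrightarrow> \<psi> x = 0"
    using test_functionsE[OF assms(2)] by blast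
  ultimately show ?thesis using assms test_smooth
    by (intro test_functionsI[of _ "K \<union> L"] smooth_on_add) auto
qed

lemma test_zero_fun: "(\<lambda>x. 0) \<in> test_functions U"
  by (intro test_functionsI[of _ "{}"] smooth_on_const) auto

lemma test_has_derivative:
  assumes "\<phi> \<in> test_functions U"
  shows "(\<phi> has_derivative frechet_derivative \<phi> (at x)) (at x)"
  using Ck_on_SucD(1)[OF open_UNIV smooth_onD[OF test_smooth[OF assms], of "Suc 0"]] by auto

lemma test_deriv:
  assumes "\<phi> \<in> test_functions U" "b \<in> Basis"
  shows "(\<lambda>x. frechet_derivative \<phi> (at x) b) \<in> test_functions U"
proof -
  obtain K where K: "compact K" "K \<subseteq> U" "\<And>x. x \<notin> K \<Longrightarrow> \<phi> x = 0"
    using test_functionsE[OF assms(1)] by blast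
  show ?thesis
  proof (rule test_functionsI[of _ K])
    show "smooth_on UNIV (\<lambda>x. frechet_derivative \<phi> (at x) b)"
      using Ck_on_SucD(2)[OF _ smooth_onD[OF test_smooth[OF assms(1)]]] assms(2)
      by (auto simp: smooth_on_def)
    fix x assume "x \<notin> K"
    have "((\<lambda>x. 0) has_derivative frechet_derivative \<phi> (at x)) (at x)"
      by (rule has_derivative_transform_within_open[OF test_has_derivative[OF assms(1)], of "- K"])
         (use \<open>x \<notin> K\<close> K compact_imp_closed in auto)
    then show "frechet_derivative \<phi> (at x) b = 0"
      using has_derivative_unique has_derivative_const by metis
  qed (use K in auto)
qed

lemma test_continuous: "\<phi> \<in> test_functions U \<Longrightarrow> continuous_on S \<phi>"
  using smooth_onD[OF test_smooth, of \<phi> U 0] continuous_on_subset by auto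

lemma test_measurable: "\<phi> \<in> test_functions U \<Longrightarrow> \<phi> \<in> borel_measurable borel"
  using test_continuous borel_measurable_continuous_onI by metis

lemma test_measurable_on:
  "\<phi> \<in> test_functions U \<Longrightarrow> \<phi> \<in> borel_measurable (lebesgue_on S)"
  by (intro measurable_restrict_space1 measurable_completion) (simp add: test_measurable)

lemma test_bounded:
  assumes "\<phi> \<in> test_functions U"
  obtains C where "C > 0" "\<And>x. \<bar>\<phi> x\<bar> \<le> C"
proof -
  obtain K where K: "compact K" "K \<subseteq> U" "\<And>x. x \<notin> K \<Longrightarrow> \<phi> x = 0"
    using test_functionsE[OF assms] by blast
  have "bounded (\<phi> ` K)"
    by (intro compact_imp_bounded compact_continuous_image test_continuous[OF assms] K(1))
  then obtain C where "C > 0" "\<And>x. x \<in> K \<Longrightarrow> \<bar>\<phi> x\<bar> \<le> C"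
    by (auto simp: bounded_pos)
  then have "\<bar>\<phi> x\<bar> \<le> C" for x using K(3)[of x] by (cases "x \<in> K") auto
  with \<open>C > 0\<close> show ?thesis by (rule that)
qed

lemma test_integral_lborel:
  assumes "\<phi> \<in> test_functions U" "open U"
  shows "integrable lborel \<phi>" "(LINT x|lebesgue_on U. \<phi> x) = integral\<^sup>L lborel \<phi>"
proof -
  obtain K where K: "compact K" "K \<subseteq> U" "\<And>x. x \<notin> K \<Longrightarrow> \<phi> x = 0"
    using test_functionsE[OF assms(1)] by blast
  have "(\<lambda>x. indicator K x *\<^sub>R \<phi> x) = \<phi>"
    by (rule ext) (use K(3) in \<open>auto simp: indicator_def\<close>)
  with borel_integrable_compact[OF K(1) test_continuous[OF assms(1)]]
  show "integrable lborel \<phi>" by simp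
  have "(\<lambda>x. if x \<in> U then \<phi> x else 0) = \<phi>"
    using assms test_zero by fastforce
  with Lebesgue_Measure.integral_restrict_UNIV[of U \<phi>] assms(2) test_measurable[OF assms(1)]
  show "(LINT x|lebesgue_on U. \<phi> x) = integral\<^sup>L lborel \<phi>"
    by (simp add: integral_completion)
qed

text \<open>The integral of a difference quotient vanishes by translation invariance.\<close>

lemma test_integral_deriv:
  assumes \<phi>: "\<phi> \<in> test_functions U" and "open U" "b \<in> Basis"
  shows "(LINT x|lebesgue_on U. frechet_derivative \<phi> (at x) b) = 0"
proof -
  define D where "D x = frechet_derivative \<phi> (at x) b" for x
  define s where "s n x = (\<phi> (x + (1 / real (Suc n)) *\<^sub>R b) - \<phi> x) * real (Suc n)" for n x
  have Dt: "D \<in> test_functions U" unfolding D_def by (rule test_deriv) fact+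
  obtain K where K: "compact K" "K \<subseteq> U" "\<And>x. x \<notin> K \<Longrightarrow> \<phi> x = 0"
    using test_functionsE[OF \<phi>] by blast
  obtain C where C: "C > 0" "\<And>x. \<bar>D x\<bar> \<le> C" using test_bounded[OF Dt] by blast
  \<comment> \<open>The increments have length at most 1, so every difference quotient vanishes
    outside this neighbourhood of the support and a multiple of its indicator dominates them
    all.\<close>
  define K' where "K' = {x + y | x y. x \<in> K \<and> y \<in> cball 0 1}"
  have "compact K'" unfolding K'_def by (rule compact_sums) (use K in auto)
  have K'I: "x \<in> K'" if "x + t *\<^sub>R b \<in> K" "0 \<le> t" "t \<le> 1" for x t
    unfolding K'_def mem_Collect_eq
    by (rule exI[of _ "x + t *\<^sub>R b"], rule exI[of _ "- t *\<^sub>R b"]) (use that assms(3) in auto)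
  have der: "((\<lambda>t. \<phi> (x + t *\<^sub>R b)) has_real_derivative D (x + t *\<^sub>R b)) (at t)" for x t
  proof -
    have "((\<lambda>t. \<phi> (x + t *\<^sub>R b)) has_derivative (\<lambda>h. frechet_derivative \<phi> (at (x + t *\<^sub>R b)) (h *\<^sub>R b))) (at t)"
      by (rule has_derivative_compose[OF _ test_has_derivative[OF \<phi>]]) (auto intro!: derivative_eq_intros)
    then show ?thesis
      using linear_cmul[OF has_derivative_linear[OF test_has_derivative[OF \<phi>]]]
      by (simp add: has_field_derivative_def D_def mult.commute[of _ "D _"] fun_eq_iff
          mult_commute_abs)
  qed
  have bound: "\<bar>s n x\<bar> \<le> C * indicator K' x" for n x
  proof -
    define h where "h = 1 / real (Suc n)"
    have h: "0 < h" "h \<le> 1" by (auto simp: h_def)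
    obtain z where z: "\<phi> (x + h *\<^sub>R b) - \<phi> (x + 0 *\<^sub>R b) = (h - 0) * D (x + z *\<^sub>R b)"
      using MVT2[OF h(1), of "\<lambda>t. \<phi> (x + t *\<^sub>R b)" "\<lambda>t. D (x + t *\<^sub>R b)"] der by blast
    then have "s n x = D (x + z *\<^sub>R b)"
      using h by (simp add: s_def h_def)
    moreover have "s n x = 0" if "x \<notin> K'"
      using K'I[of x 0] K'I[of x h] that h K(3) by (force simp: s_def h_def)
    ultimately show ?thesis using C by (auto simp: indicator_def)
  qed
  have lim: "(\<lambda>n. s n x) \<longlonglongrightarrow> D x" for x
  proof -
    have "((\<lambda>t. (\<phi> (x + t *\<^sub>R b) - \<phi> x) / t) \<longlongrightarrow> D x) (at 0)"
      using der[of x 0] by (simp add: has_field_derivative_iff)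
    moreover have "filterlim (\<lambda>n. 1 / real (Suc n)) (at 0) sequentially"
      using LIMSEQ_Suc[OF lim_1_over_n[where 'a=real]] by (simp add: filterlim_at)
    ultimately have "(\<lambda>n. (\<phi> (x + (1 / real (Suc n)) *\<^sub>R b) - \<phi> x) / (1 / real (Suc n))) \<longlonglongrightarrow> D x"
      by (rule filterlim_compose)
    then show ?thesis by (simp add: s_def)
  qed
  have int0: "integral\<^sup>L lborel (s n) = 0" for n
  proof -
    define c where "c = (1 / real (Suc n)) *\<^sub>R b"
    note I = test_integral_lborel(1)[OF \<phi> \<open>open U\<close>]
    note meas = test_measurable[OF \<phi>]
    have "integral\<^sup>L lborel \<phi> = integral\<^sup>L (distr lborel borel ((+) c)) \<phi>"
      by (simp add: lborel_distr_plus)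
    also have "\<dots> = (\<integral>x. \<phi> (c + x) \<partial>lborel)"
      by (rule integral_distr) (use meas in auto)
    finally have e: "(\<integral>x. \<phi> (c + x) \<partial>lborel) = integral\<^sup>L lborel \<phi>" ..
    have "integrable (distr lborel borel ((+) c)) \<phi>"
      using I by (simp add: lborel_distr_plus)
    then have "integrable lborel (\<lambda>x. \<phi> (c + x))"
      by (subst (asm) integrable_distr_eq) (use meas in auto)
    with e I show ?thesis
      unfolding s_def c_def[symmetric] by (simp add: add.commute)
  qed
  have "(\<lambda>n. integral\<^sup>L lborel (s n)) \<longlonglongrightarrow> integral\<^sup>L lborel D"
  proof (rule integral_dominated_convergence)
    show "integrable lborel (\<lambda>x. C * indicator K' x)"
      using borel_integrable_compact[OF \<open>compact K'\<close>, of "\<lambda>_. C"] by (simp add: mult.commute)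
    show "s n \<in> borel_measurable lborel" for n
      unfolding s_def using test_measurable[OF \<phi>] by measurable
  qed (use bound lim test_measurable[OF Dt] in auto)
  then have "integral\<^sup>L lborel D = 0" by (simp add: int0 LIMSEQ_const_iff)
  then show ?thesis
    using test_integral_lborel(2)[OF Dt \<open>open U\<close>] by (simp add: D_def)
qed

section \<open>Smooth approximation of indicators and the fundamental lemma\<close>

text \<open>The squared distance makes the argument of the bump a polynomial in \<open>x\<close>,
  hence smooth also at the centre.\<close>

lemma ball_bump_test:
  assumes "cball c r \<subseteq> U" "r > 0" "\<delta> > 0"
  shows "(\<lambda>x::'a::euclidean_space. bump_fun \<delta> 1 (r\<^sup>2 - (x - c) \<bullet> (x - c))) \<in> test_functions U"
proof (rule test_functionsI[of _ "cball c r"])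
  have "Ck_on (Suc k) UNIV (\<lambda>x. r\<^sup>2 - (x - c) \<bullet> (x - c))" for k
  proof (rule Ck_on_SucI[where D="\<lambda>x h. - (2 * ((x - c) \<bullet> h))"])
    show "((\<lambda>x. r\<^sup>2 - (x - c) \<bullet> (x - c)) has_derivative (\<lambda>h. - (2 * ((x - c) \<bullet> h)))) (at x)" for x
      by (auto intro!: derivative_eq_intros simp: inner_commute)
    fix b :: 'a
    have "Ck_on k UNIV (\<lambda>x. (- 2) * (x \<bullet> b) + 2 * (c \<bullet> b))"
      by (intro Ck_on_add Ck_on_mult Ck_on_const Ck_on_inner) auto
    then show "Ck_on k UNIV (\<lambda>x. - (2 * ((x - c) \<bullet> b)))"
      by (simp add: inner_diff_left algebra_simps)
  qed auto
  then have "Ck_on k UNIV (\<lambda>x. r\<^sup>2 - (x - c) \<bullet> (x - c))" for k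
    by (rule Ck_on_Suc_imp)
  then show "smooth_on UNIV (\<lambda>x. bump_fun \<delta> 1 (r\<^sup>2 - (x - c) \<bullet> (x - c)))"
    unfolding smooth_on_def using assms(3) by (intro allI Ck_on_bump open_UNIV)
  show "bump_fun \<delta> 1 (r\<^sup>2 - (x - c) \<bullet> (x - c)) = 0" if "x \<notin> cball c r" for x
  proof -
    have "r\<^sup>2 \<le> (norm (x - c))\<^sup>2"
      using that assms by (intro power_mono) (auto simp: dist_norm norm_minus_commute)
    then show ?thesis by (simp add: bump_fun_1 power2_norm_eq_inner)
  qed
qed (use assms in auto)

text \<open>A smooth substitute for the maximum of finitely many cutoffs with values in
  \<open>{0..1}\<close>. With \<open>q\<close> the function for \<open>m\<close>, the next one is
  \<open>q + f - q * f\<close>, where \<open>f\<close> is the new cutoff.\<close>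

lemma test_one_minus_prod:
  assumes "\<And>i. \<phi> i \<in> test_functions U"
  shows "(\<lambda>x. 1 - (\<Prod>i<m::nat. 1 - \<phi> i x)) \<in> test_functions (U :: 'a::euclidean_space set)"
proof (induction m)
  case (Suc m)
  have "(\<lambda>x. (1 - (\<Prod>i<m. 1 - \<phi> i x)) + (\<phi> m x + (- 1) * ((1 - (\<Prod>i<m. 1 - \<phi> i x)) * \<phi> m x))) \<in> test_functions U"
    by (intro test_add test_cmult test_mult_smooth Suc assms test_smooth[OF Suc])
  then show ?case by (simp add: algebra_simps)
qed (simp add: test_zero_fun)

text \<open>Lindelof's theorem covers \<open>V\<close> by countably many balls whose closures lie in
  \<open>V\<close>. The \<open>k\<close>-th function combines the first \<open>k\<close> balls and
  sharpens each bump with parameter \<open>1 / (k + 1)\<close>; a single ball containing a point of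
  \<open>V\<close> already drives the product there to 0.\<close>

lemma open_indicator_approx:
  fixes V :: "'a::euclidean_space set"
  assumes "open V"
  obtains \<phi> where "\<And>k::nat. \<phi> k \<in> test_functions V" "\<And>k x. 0 \<le> \<phi> k x \<and> \<phi> k x \<le> 1"
    "\<And>x. (\<lambda>k. \<phi> k x) \<longlonglongrightarrow> indicator V x"
proof (cases "V = {}")
  case True
  then show ?thesis by (intro that[of "\<lambda>_ _. 0"]) (auto simp: test_zero_fun)
next
  case False
  define F where "F = (\<lambda>(c, r). ball c r) ` {(c, r). r > 0 \<and> cball c r \<subseteq> V}"
  obtain F' where F': "F' \<subseteq> F" "countable F'" "\<Union>F' = \<Union>F"
  proof -
    have "\<And>S. S \<in> F \<Longrightarrow> open S" by (auto simp: F_def)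
    then show thesis using Lindelof[of F] that by blast
  qed
  have UF: "\<Union>F = V"
  proof
    show "V \<subseteq> \<Union>F"
    proof
      fix x assume "x \<in> V"
      then obtain e where "e > 0" "cball x e \<subseteq> V" using assms open_contains_cball by blast
      then have "ball x e \<in> F" 
        unfolding F_def by (intro image_eqI[of _ _ "(x, e)"]) auto
      then show "x \<in> \<Union>F" by (rule UnionI) (use \<open>e > 0\<close> in simp)
    qed
  qed (auto simp: F_def)
  with F' False have "F' \<noteq> {}" by auto
  with F' have rng: "range (from_nat_into F') = F'" by (simp add: range_from_nat_into)
  have "\<exists>c r. from_nat_into F' i = ball c r \<and> r > 0 \<and> cball c r \<subseteq> V" for i
  proof -
    have "from_nat_into F' i \<in> F" using F'(1) rng by blast
    then show ?thesis unfolding F_def by auto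
  qed
  then obtain c r where cr: "\<And>i. from_nat_into F' i = ball (c i) (r i)" "\<And>i. r i > 0" "\<And>i. cball (c i) (r i) \<subseteq> V"
    by metis
  have V: "V = (\<Union>i. ball (c i) (r i))"
    using UF F'(3) rng cr(1) by (metis (no_types, lifting) SUP_cong)
  define \<psi> where "\<psi> k i x = bump_fun (1 / real (Suc k)) 1 ((r i)\<^sup>2 - (x - c i) \<bullet> (x - c i))" for k i x
  have \<psi>t: "\<psi> k i \<in> test_functions V" for k i
    unfolding \<psi>_def by (rule ball_bump_test) (use cr in auto)
  have \<psi>b: "0 \<le> \<psi> k i x" "\<psi> k i x \<le> 1" for k i x
    unfolding \<psi>_def using bump_fun_1_bounds[of "1 / real (Suc k)"] by auto
  define \<phi> where "\<phi> k x = 1 - (\<Prod>i<k. 1 - \<psi> k i x)" for k x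
  have prod01: "0 \<le> (\<Prod>i<k. 1 - \<psi> k i x)" "(\<Prod>i<k. 1 - \<psi> k i x) \<le> 1" for k x
    using \<psi>b by (auto intro!: prod_nonneg prod_le_1)
  show ?thesis
  proof (rule that[of \<phi>])
    show "\<phi> k \<in> test_functions V" for k
      unfolding \<phi>_def by (rule test_one_minus_prod) (rule \<psi>t)
    show "0 \<le> \<phi> k x \<and> \<phi> k x \<le> 1" for k x
      using prod01 by (simp add: \<phi>_def)
    fix x
    show "(\<lambda>k. \<phi> k x) \<longlonglongrightarrow> indicator V x"
    proof (cases "x \<in> V")
      case True
      then obtain j where j: "x \<in> ball (c j) (r j)" using V by auto
      then have "(norm (x - c j))\<^sup>2 < (r j)\<^sup>2"
        by (intro power_strict_mono) (auto simp: dist_norm norm_minus_commute)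
      then have "(\<lambda>k. \<psi> k j x) \<longlonglongrightarrow> 1"
        unfolding \<psi>_def by (intro bump_fun_1_tendsto) (simp add: power2_norm_eq_inner)
      then have l: "(\<lambda>k. 1 - \<psi> k j x) \<longlonglongrightarrow> 0"
        by (auto intro!: tendsto_eq_intros)
      have "(\<lambda>k. \<Prod>i<k. 1 - \<psi> k i x) \<longlonglongrightarrow> 0"
      proof (rule tendsto_sandwich[OF _ _ tendsto_const l])
        show "\<forall>\<^sub>F k in sequentially. (\<Prod>i<k. 1 - \<psi> k i x) \<le> 1 - \<psi> k j x"
          using eventually_gt_at_top[of j]
        proof eventually_elim
          case (elim k)
          have "(\<Prod>i<k. 1 - \<psi> k i x) = (1 - \<psi> k j x) * (\<Prod>i\<in>{..<k} - {j}. 1 - \<psi> k i x)"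
            using elim by (intro prod.remove) auto
          also have "\<dots> \<le> (1 - \<psi> k j x) * 1"
            using \<psi>b by (intro mult_left_mono prod_le_1) auto
          finally show ?case by simp
        qed
      qed (use prod01 in auto)
      then show ?thesis using True unfolding \<phi>_def by (auto intro!: tendsto_eq_intros)
    next
      case False
      then have "\<phi> k x = 0" for k
        unfolding \<phi>_def using test_zero[OF False \<psi>t] by simp
      then show ?thesis using False by simp
    qed
  qed
qed

lemma test_functions_mono: "V \<subseteq> U \<Longrightarrow> test_functions V \<subseteq> test_functions U"
  by (auto simp: test_functions_def)

text \<open>Dominated convergence gives vanishing integrals of \<open>g\<close> over open sets;
  these form a generator stable under intersection, so Dynkin's argument reaches all Borel sets. A
  density with zero integral over every set vanishes almost everywhere.\<close>

lemma fundamental_lemma_of_calculus_of_variations: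
  fixes U :: "'a::euclidean_space set" and g :: "'a \<Rightarrow> real"
  assumes "open U" and g: "integrable (lebesgue_on U) g"
    and 0: "\<And>\<phi>. \<phi> \<in> test_functions U \<Longrightarrow> (LINT x|lebesgue_on U. g x * \<phi> x) = 0"
  shows "AE x in lebesgue_on U. g x = 0"
proof -
  let ?M = "lebesgue_on U"
  have setI: "A \<in> sets borel \<Longrightarrow> A \<inter> U \<in> sets ?M" for A
    using assms(1) by (subst sets_restrict_space_iff) auto
  have Iint: "integrable ?M (\<lambda>x. indicator A x * g x)" if "A \<in> sets borel" for A
  proof -
    have "integrable ?M (\<lambda>x. indicator (A \<inter> U) x *\<^sub>R g x)"
      by (rule integrable_mult_indicator[OF setI[OF that] g])
    then show ?thesis
      by (subst (asm) Bochner_Integration.integrable_cong[where g="\<lambda>x. indicator A x * g x"]) (auto simp: indicator_def)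
  qed
  have opn: "(LINT x|?M. indicator V x * g x) = 0" if "open V" for V
  proof -
    have "open (V \<inter> U)" using that assms(1) by auto
    then obtain \<phi> where \<phi>: "\<And>k::nat. \<phi> k \<in> test_functions (V \<inter> U)" "\<And>k x. 0 \<le> \<phi> k x \<and> \<phi> k x \<le> 1"
      "\<And>x. (\<lambda>k. \<phi> k x) \<longlonglongrightarrow> indicator (V \<inter> U) x"
      using open_indicator_approx by blast
    have "(\<lambda>k. LINT x|?M. g x * \<phi> k x) \<longlonglongrightarrow> (LINT x|?M. g x * indicator (V \<inter> U) x)"
    proof (rule integral_dominated_convergence)
      show "integrable ?M (\<lambda>x. \<bar>g x\<bar>)" using g by simp
      show "(\<lambda>x. g x * indicator (V \<inter> U) x) \<in> borel_measurable ?M"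
        using g setI[of V] that by (intro borel_measurable_times borel_measurable_indicator) auto
      show "(\<lambda>x. g x * \<phi> k x) \<in> borel_measurable ?M" for k
        using g test_measurable_on[OF \<phi>(1)] by (intro borel_measurable_times) auto
      show "AE x in ?M. (\<lambda>k. g x * \<phi> k x) \<longlonglongrightarrow> g x * indicator (V \<inter> U) x"
        by (intro AE_I2 tendsto_intros \<phi>)
      show "AE x in ?M. norm (g x * \<phi> k x) \<le> \<bar>g x\<bar>" for k
        by (intro AE_I2) (use \<phi>(2) in \<open>auto simp: abs_mult intro!: mult_left_le\<close>)
    qed
    moreover have "(LINT x|?M. g x * \<phi> k x) = 0" for k
      by (rule 0) (use \<phi>(1) test_functions_mono[of "V \<inter> U" U] in auto)
    ultimately have "(LINT x|?M. g x * indicator (V \<inter> U) x) = 0"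
      by (simp add: LIMSEQ_const_iff)
    also have "(LINT x|?M. g x * indicator (V \<inter> U) x) = (LINT x|?M. indicator V x * g x)"
      by (intro Bochner_Integration.integral_cong) (auto simp: indicator_def)
    finally show ?thesis .
  qed
  have bor: "(LINT x|?M. indicator A x * g x) = 0" if "A \<in> sets borel" for A
  proof -
    have "Int_stable {S :: 'a set. open S}" by (auto simp: Int_stable_def)
    moreover have "{S :: 'a set. open S} \<subseteq> Pow UNIV" by auto
    moreover have "A \<in> sigma_sets UNIV {S. open S}" using that by (simp add: borel_def)
    ultimately show ?thesis
    proof (induction rule: sigma_sets_induct_disjoint)
      case (basic A)
      then show ?case using opn by auto
    next
      case (compl A)
      then have A: "A \<in> sets borel" by (simp add: borel_def)
      have "(LINT x|?M. indicator (UNIV - A) x * g x) = (LINT x|?M. indicator UNIV x * g x - indicator A x * g x)"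
        by (intro Bochner_Integration.integral_cong) (auto simp: indicator_def)
      also have "\<dots> = 0"
        by (subst Bochner_Integration.integral_diff) (use compl opn[of UNIV] Iint[OF A] Iint[of UNIV] in auto)
      finally show ?case .
    next
      case (union A)
      then have A: "A i \<in> sets borel" for i by (auto simp: borel_def)
      have AU: "(\<Union>i. A i) \<in> sets borel" using A by auto
      have "(\<lambda>n. LINT x|?M. (\<Sum>i<n. indicator (A i) x * g x)) \<longlonglongrightarrow> (LINT x|?M. indicator (\<Union>i. A i) x * g x)"
      proof (rule integral_dominated_convergence)
        show "integrable ?M (\<lambda>x. \<bar>g x\<bar>)" using g by simp
        show "(\<lambda>x. indicator (\<Union>i. A i) x * g x) \<in> borel_measurable ?M"
          using Iint[OF AU] by auto
        show "(\<lambda>x. \<Sum>i<n. indicator (A i) x * g x) \<in> borel_measurable ?M" for n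
          using Iint[OF A] by (intro borel_measurable_sum) auto
        have e: "(\<Sum>i<n. indicator (A i) x * g x) = indicator (\<Union>i<n. A i) x * g x" for x n
          using union(1) by (simp add: indicator_UN_disjoint disjoint_family_on_def sum_distrib_right)
        show "AE x in ?M. (\<lambda>n. \<Sum>i<n. indicator (A i) x * g x) \<longlonglongrightarrow> indicator (\<Union>i. A i) x * g x"
          unfolding e by (intro AE_I2 tendsto_intros LIMSEQ_indicator_UN)
        show "AE x in ?M. norm (\<Sum>i<n. indicator (A i) x * g x) \<le> \<bar>g x\<bar>" for n
          unfolding e by (intro AE_I2) (auto simp: indicator_def)
      qed
      moreover have "(LINT x|?M. (\<Sum>i<n. indicator (A i) x * g x)) = 0" for n
        using union Iint[OF A] by (subst Bochner_Integration.integral_sum) auto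
      ultimately show ?case by (simp add: LIMSEQ_const_iff)
    qed auto
  qed
  show ?thesis
  proof (rule density_unique_real[OF g])
    fix A assume "A \<in> sets ?M"
    then have "A \<in> sets lebesgue" "A \<subseteq> U"
      using assms(1) sets_restrict_space_iff[of U lebesgue A] by auto
    \<comment> \<open>A Lebesgue set is a Borel set up to a null set, which the integral does not
      see.\<close>
    then obtain S N N' where SN: "A = S \<union> N" "N \<subseteq> N'" "N' \<in> null_sets lborel" "S \<in> sets lborel"
      by (rule_tac sets_completionE)
    have "AE x in lebesgue. x \<notin> N'" using SN(3) by (intro AE_not_in null_sets_completionI)
    then have "AE x in ?M. x \<notin> N'" using assms(1) by (subst AE_restrict_space_iff) auto
    then have "AE x in ?M. indicator A x *\<^sub>R g x = indicator S x * g x"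
      by eventually_elim (use SN in \<open>auto simp: indicator_def\<close>)
    then have "(LINT x|?M. indicator A x *\<^sub>R g x) = (LINT x|?M. indicator S x * g x)"
      using \<open>A \<in> sets ?M\<close> g SN(4) Iint[of S] by (intro integral_cong_AE) auto
    then show "(LINT x:A|?M. g x) = (LINT x:A|?M. 0)"
      using bor[of S] SN(4) by (simp add: set_lebesgue_integral_def)
  qed auto
qed

section \<open>Semi-inner products\<close>

text \<open>The signs of \<open>a\<close> and \<open>c\<close> follow from the hypothesis. The case
  \<open>c = 0\<close> has to be included because the forms below are only semidefinite.\<close>

lemma discriminant_bound:
  fixes a b c :: real
  assumes "\<And>t. 0 \<le> a + 2 * t * b + t\<^sup>2 * c"
  shows "\<bar>b\<bar> \<le> sqrt a * sqrt c"
proof -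
  have a: "0 \<le> a" using assms[of 0] by simp
  have c: "0 \<le> c"
  proof (rule ccontr)
    assume "\<not> 0 \<le> c"
    then have "c < 0" by simp
    \<comment> \<open>Chosen so that \<open>t * c = c - (a + 2 * \<bar>b\<bar>)\<close> with
      \<open>t \<ge> 1\<close>: the quadratic term then outweighs both others.\<close>
    define t where "t = 1 + (a + 2 * \<bar>b\<bar>) / - c"
    have t: "t \<ge> 1" using a divide_nonneg_pos[of "a + 2 * \<bar>b\<bar>" "- c"] \<open>c < 0\<close> unfolding t_def by linarith
    have "t * c = c - (a + 2 * \<bar>b\<bar>)" using \<open>c < 0\<close> by (simp add: t_def field_simps)
    then have "a + 2 * t * b + t\<^sup>2 * c = a + t * (2 * b + c - a - 2 * \<bar>b\<bar>)"
      by (simp add: power2_eq_square mult.assoc distrib_left right_diff_distrib)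
    also have "\<dots> \<le> a + t * (c - a)" using t by (intro add_left_mono mult_left_mono) auto
    also have "\<dots> = a * (1 - t) + t * c" by (simp add: algebra_simps)
    also have "\<dots> < 0" using t a \<open>c < 0\<close> by (intro add_nonpos_neg) (auto simp: mult_le_0_iff mult_less_0_iff)
    finally show False using assms[of t] by simp
  qed
  have "b\<^sup>2 \<le> a * c"
  proof (cases "c = 0")
    case True
    have "b = 0"
    proof (rule ccontr)
      assume "b \<noteq> 0"
      \<comment> \<open>For \<open>c = 0\<close> the expression is linear in \<open>t\<close> and
        takes the value \<open>- 1\<close> here.\<close>
      with assms[of "- (a + 1) / (2 * b)"] True show False by (simp add: field_simps)
    qed
    then show ?thesis using True by simp
  next
    case False
    with c have "0 < c" by simp
    have "a + 2 * (- b / c) * b + (- b / c)\<^sup>2 * c = a - b\<^sup>2 / c"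
      using \<open>0 < c\<close> by (simp add: power2_eq_square field_simps)
    with assms[of "- b / c"] have "b\<^sup>2 / c \<le> a" by simp
    then show ?thesis using \<open>0 < c\<close> by (simp add: field_simps)
  qed
  then have "sqrt (b\<^sup>2) \<le> sqrt (a * c)" by (rule real_sqrt_le_mono)
  then show ?thesis by (simp add: real_sqrt_mult)
qed

text \<open>Elements are functions rather than classes modulo null sets, so \<open>B u u = 0\<close>
  does not force \<open>u = 0\<close>. The locale is used for the L2 product, for the Dirichlet form
  and for their sum.\<close>

locale semi_inner_space =
  fixes V :: "('a \<Rightarrow> real) set" and B :: "('a \<Rightarrow> real) \<Rightarrow> ('a \<Rightarrow> real) \<Rightarrow> real"
  assumes lincomb: "u \<in> V \<Longrightarrow> w \<in> V \<Longrightarrow> (\<lambda>x. u x + c * w x) \<in> V"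
    and sym: "B u w = B w u"
    and add_left: "u \<in> V \<Longrightarrow> w \<in> V \<Longrightarrow> z \<in> V \<Longrightarrow> B (\<lambda>x. u x + c * w x) z = B u z + c * B w z"
    and nonneg: "u \<in> V \<Longrightarrow> 0 \<le> B u u"
begin

definition nrm :: "('a \<Rightarrow> real) \<Rightarrow> real" where "nrm u = sqrt (B u u)"

lemma add_right: "u \<in> V \<Longrightarrow> w \<in> V \<Longrightarrow> z \<in> V \<Longrightarrow> B z (\<lambda>x. u x + c * w x) = B z u + c * B z w"
  using add_left[of u w z c] by (simp add: sym)

lemma diff: "u \<in> V \<Longrightarrow> w \<in> V \<Longrightarrow> (\<lambda>x. u x - w x) \<in> V"
  using lincomb[of u w "- 1"] by simp

lemma scale: "u \<in> V \<Longrightarrow> (\<lambda>x. c * u x) \<in> V"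
  using lincomb[of u u "c - 1"] by (simp add: algebra_simps)

lemma diff_left: "u \<in> V \<Longrightarrow> w \<in> V \<Longrightarrow> z \<in> V \<Longrightarrow> B (\<lambda>x. u x - w x) z = B u z - B w z"
  using add_left[of u w z "- 1"] by simp

lemma diff_right: "u \<in> V \<Longrightarrow> w \<in> V \<Longrightarrow> z \<in> V \<Longrightarrow> B z (\<lambda>x. u x - w x) = B z u - B z w"
  using diff_left[of u w z] by (simp add: sym)

lemma scale_left: "u \<in> V \<Longrightarrow> z \<in> V \<Longrightarrow> B (\<lambda>x. c * u x) z = c * B u z"
  using add_left[of u u z "c - 1"] by (simp add: algebra_simps)

lemma expand:
  assumes "u \<in> V" "w \<in> V"
  shows "B (\<lambda>x. u x + c * w x) (\<lambda>x. u x + c * w x) = B u u + 2 * c * B u w + c\<^sup>2 * B w w"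
  using assms lincomb[OF assms]
  by (simp add: add_left add_right sym[of w u] power2_eq_square algebra_simps)

lemma Cauchy_Schwarz:
  assumes "u \<in> V" "w \<in> V"
  shows "\<bar>B u w\<bar> \<le> nrm u * nrm w"
  unfolding nrm_def
proof (rule discriminant_bound)
  fix t
  show "0 \<le> B u u + 2 * t * B u w + t\<^sup>2 * B w w"
    using nonneg[OF lincomb[OF assms, of t]] expand[OF assms, of t] by simp
qed

lemma nrm_sq: "u \<in> V \<Longrightarrow> (nrm u)\<^sup>2 = B u u"
  by (simp add: nrm_def nonneg)

lemma nrm_nonneg: "u \<in> V \<Longrightarrow> 0 \<le> nrm u"
  by (simp add: nrm_def nonneg)

lemma nrm_triangle:
  assumes "u \<in> V" "w \<in> V"
  shows "nrm (\<lambda>x. u x + w x) \<le> nrm u + nrm w"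
proof -
  have "B (\<lambda>x. u x + w x) (\<lambda>x. u x + w x) \<le> (nrm u + nrm w)\<^sup>2"
    using expand[OF assms, of 1] Cauchy_Schwarz[OF assms] nrm_sq[OF assms(1)] nrm_sq[OF assms(2)]
    by (simp add: power2_sum)
  then show ?thesis
    unfolding nrm_def[of "\<lambda>x. u x + w x"] using nrm_nonneg[OF assms(1)] nrm_nonneg[OF assms(2)]
    by (intro real_le_lsqrt) auto
qed

lemma nrm_diff_bound:
  assumes "u \<in> V" "w \<in> V"
  shows "\<bar>nrm u - nrm w\<bar> \<le> nrm (\<lambda>x. u x - w x)"
proof -
  have "nrm u \<le> nrm w + nrm (\<lambda>x. u x - w x)"
    using nrm_triangle[OF assms(2) diff[OF assms]] by simp
  moreover have "nrm w \<le> nrm u + nrm (\<lambda>x. w x - u x)"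
    using nrm_triangle[OF assms(1) diff[OF assms(2,1)]] by simp
  moreover have "nrm (\<lambda>x. w x - u x) = nrm (\<lambda>x. u x - w x)"
    unfolding nrm_def using assms diff[OF assms] diff[OF assms(2,1)]
    by (simp add: diff_left diff_right)
  ultimately show ?thesis by simp
qed

lemma nrm_scale:
  assumes "u \<in> V"
  shows "nrm (\<lambda>x. c * u x) = \<bar>c\<bar> * nrm u"
proof -
  have "B (\<lambda>x. c * u x) (\<lambda>x. c * u x) = c * B u (\<lambda>x. c * u x)"
    using assms scale[OF assms, of c] by (rule scale_left)
  also have "B u (\<lambda>x. c * u x) = B (\<lambda>x. c * u x) u" by (rule sym)
  also have "\<dots> = c * B u u" using assms assms by (rule scale_left)
  finally have "B (\<lambda>x. c * u x) (\<lambda>x. c * u x) = c\<^sup>2 * B u u" by (simp add: power2_eq_square)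
  then show ?thesis by (simp add: nrm_def real_sqrt_mult)
qed

end

section \<open>The spaces L2 and H1\<close>

definition dirichlet :: "'a::euclidean_space set \<Rightarrow> ('a \<Rightarrow> real) \<Rightarrow> ('a \<Rightarrow> real) \<Rightarrow> real" where
  "dirichlet U u w = L2_inner U (wgrad U u) (wgrad U w)"

definition H1_inner :: "'a::euclidean_space set \<Rightarrow> ('a \<Rightarrow> real) \<Rightarrow> ('a \<Rightarrow> real) \<Rightarrow> real" where
  "H1_inner U u w = L2_inner U u w + dirichlet U u w"

definition gnorm :: "'a::euclidean_space set \<Rightarrow> ('a \<Rightarrow> real) \<Rightarrow> real" where
  "gnorm U u = Lnorm U 2 (wgrad U u)"

definition laplacian :: "('a::euclidean_space \<Rightarrow> real) \<Rightarrow> 'a \<Rightarrow> real" where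
  "laplacian \<phi> x = (\<Sum>b\<in>Basis. frechet_derivative (\<lambda>y. frechet_derivative \<phi> (at y) b) (at x) b)"

lemma L2_inner_commute: "L2_inner U f g = L2_inner U g f"
  by (simp add: L2_inner_def inner_commute)

lemma L2_inner_self_nonneg: "0 \<le> L2_inner U g g"
  by (simp add: L2_inner_def)

lemma Lnorm_2: "Lnorm U 2 g = sqrt (L2_inner U g g)"
proof -
  have "norm (g x) powr 2 = g x \<bullet> g x" for x
    by (simp add: powr_numeral power2_norm_eq_inner)
  then show ?thesis
    using L2_inner_self_nonneg[of U g] by (simp add: Lnorm_def L2_inner_def powr_half_sqrt)
qed

lemma Lnorm_2_sq: "(Lnorm U 2 g)\<^sup>2 = L2_inner U g g"
  by (simp add: Lnorm_2 L2_inner_self_nonneg)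

lemma gnorm_sqrt: "gnorm U u = sqrt (dirichlet U u u)"
  by (simp add: gnorm_def dirichlet_def Lnorm_2)

lemma H1_norm_sqrt: "H1_norm U u = sqrt (H1_inner U u u)"
  by (simp add: H1_norm_def H1_inner_def dirichlet_def Lnorm_2_sq)

lemma gnorm_nonneg: "0 \<le> gnorm U u"
  by (simp add: gnorm_sqrt dirichlet_def L2_inner_self_nonneg)

lemma gnorm_sq: "(gnorm U u)\<^sup>2 = dirichlet U u u"
  by (simp add: gnorm_def dirichlet_def Lnorm_2_sq)

lemma H1_norm_nonneg: "0 \<le> H1_norm U u"
  by (simp add: H1_norm_def)

lemma H1_norm_sq: "(H1_norm U u)\<^sup>2 = (Lnorm U 2 u)\<^sup>2 + (gnorm U u)\<^sup>2"
  by (simp add: H1_norm_def gnorm_def)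

lemma gnorm_le_H1_norm: "gnorm U u \<le> H1_norm U u"
  by (rule power2_le_imp_le) (simp_all add: H1_norm_sq H1_norm_nonneg)

lemma Lnorm_le_H1_norm: "Lnorm U 2 u \<le> H1_norm U u"
  by (rule power2_le_imp_le) (simp_all add: H1_norm_sq H1_norm_nonneg)

lemma L2_measurable: "f \<in> L2 U \<Longrightarrow> f \<in> borel_measurable (lebesgue_on U)"
  by (simp add: L2_def)

lemma L2_inner_integrable:
  fixes f g :: "'a::euclidean_space \<Rightarrow> 'b::euclidean_space"
  assumes "f \<in> L2 U" "g \<in> L2 U"
  shows "integrable (lebesgue_on U) (\<lambda>x. f x \<bullet> g x)"
proof (rule Bochner_Integration.integrable_bound)
  show "integrable (lebesgue_on U) (\<lambda>x. (norm (f x))\<^sup>2 + (norm (g x))\<^sup>2)"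
    using assms by (simp add: L2_def)
  show "(\<lambda>x. f x \<bullet> g x) \<in> borel_measurable (lebesgue_on U)"
    using assms by (intro borel_measurable_inner) (auto simp: L2_def)
  have "\<bar>f x \<bullet> g x\<bar> \<le> (norm (f x))\<^sup>2 + (norm (g x))\<^sup>2" for x
  proof -
    have "\<bar>f x \<bullet> g x\<bar> \<le> norm (f x) * norm (g x)" by (rule Cauchy_Schwarz_ineq2)
    also have "\<dots> \<le> (norm (f x))\<^sup>2 + (norm (g x))\<^sup>2"
      using sum_squares_bound[of "norm (f x)" "norm (g x)"] mult_nonneg_nonneg[OF norm_ge_zero norm_ge_zero, of "f x" "g x"]
      by linarith
    finally show ?thesis .
  qed
  then show "AE x in lebesgue_on U. norm (f x \<bullet> g x) \<le> norm ((norm (f x))\<^sup>2 + (norm (g x))\<^sup>2)"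
    by (intro AE_I2) auto
qed

lemma L2_lincomb:
  fixes f g :: "'a::euclidean_space \<Rightarrow> 'b::euclidean_space"
  assumes "f \<in> L2 U" "g \<in> L2 U"
  shows "(\<lambda>x. f x + c *\<^sub>R g x) \<in> L2 U"
proof -
  have m: "(\<lambda>x. f x + c *\<^sub>R g x) \<in> borel_measurable (lebesgue_on U)"
    using assms by (auto simp: L2_def)
  have "integrable (lebesgue_on U) (\<lambda>x. f x \<bullet> f x + 2 * c * (f x \<bullet> g x) + c\<^sup>2 * (g x \<bullet> g x))"
    using assms by (intro Bochner_Integration.integrable_add integrable_mult_right L2_inner_integrable)
  moreover have "f x \<bullet> f x + 2 * c * (f x \<bullet> g x) + c\<^sup>2 * (g x \<bullet> g x) = (norm (f x + c *\<^sub>R g x))\<^sup>2" for x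
    unfolding power2_norm_eq_inner
    by (simp add: inner_add_left inner_add_right inner_commute[of "g x" "f x"] power2_eq_square algebra_simps)
  ultimately show ?thesis using m by (simp add: L2_def)
qed

lemma L2_inner_lincomb:
  fixes f g h :: "'a::euclidean_space \<Rightarrow> 'b::euclidean_space"
  assumes "f \<in> L2 U" "g \<in> L2 U" "h \<in> L2 U"
  shows "L2_inner U (\<lambda>x. f x + c *\<^sub>R g x) h = L2_inner U f h + c * L2_inner U g h"
  unfolding L2_inner_def using L2_inner_integrable[OF assms(1,3)] L2_inner_integrable[OF assms(2,3)]
  by (simp add: inner_add_left)

lemma L2_inner_cong_AE:
  fixes f g h :: "'a::euclidean_space \<Rightarrow> 'b::euclidean_space"
  assumes "f \<in> L2 U" "g \<in> L2 U" "h \<in> L2 U" "AE x in lebesgue_on U. f x = g x"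
  shows "L2_inner U f h = L2_inner U g h"
  unfolding L2_inner_def
proof (rule integral_cong_AE)
  show "AE x in lebesgue_on U. f x \<bullet> h x = g x \<bullet> h x"
    using assms(4) by eventually_elim simp
qed (use assms L2_inner_integrable in blast)+

interpretation L2_space: semi_inner_space "L2 U" "L2_inner U" for U :: "'a::euclidean_space set"
  by unfold_locales
     (use L2_lincomb[of _ U] L2_inner_lincomb[of _ U] in \<open>force simp: L2_inner_self_nonneg intro: L2_inner_commute\<close>)+

lemma L2_nrm: "L2_space.nrm U u = Lnorm U 2 u"
  by (simp add: L2_space.nrm_def Lnorm_2)

lemma L2_I:
  fixes f :: "'a::euclidean_space \<Rightarrow> real"
  assumes "f \<in> borel_measurable (lebesgue_on U)" "integrable (lebesgue_on U) (\<lambda>x. (f x)\<^sup>2)"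
  shows "f \<in> L2 U"
  using assms by (simp add: L2_def)

section \<open>Weak gradients and H01 on a bounded open set\<close>

text \<open>Boundedness makes the measure of \<open>U\<close> finite, so that L2 functions are
  integrable, and it yields Poincare's inequality. The locale also serves the time interval
  \<open>{0<..<T}\<close>.\<close>

locale bounded_open_set =
  fixes U :: "'a::euclidean_space set"
  assumes open_U: "open U" and bounded_U: "bounded U"
begin

sublocale finite_measure "lebesgue_on U"
  by (rule finite_measure_lebesgue_on) (simp add: lmeasurable_open open_U bounded_U)

lemma bounded_integrable:
  fixes f :: "'a \<Rightarrow> real"
  assumes "f \<in> borel_measurable (lebesgue_on U)" "\<And>x. x \<in> U \<Longrightarrow> \<bar>f x\<bar> \<le> C"
  shows "integrable (lebesgue_on U) f"
  by (rule integrable_const_bound[where B=C]) (use assms in auto)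

lemma bounded_L2:
  fixes f :: "'a \<Rightarrow> real"
  assumes "f \<in> borel_measurable (lebesgue_on U)" "\<And>x. x \<in> U \<Longrightarrow> \<bar>f x\<bar> \<le> C"
  shows "f \<in> L2 U"
proof (rule L2_I)
  have "\<bar>(f x)\<^sup>2\<bar> \<le> C\<^sup>2" if "x \<in> U" for x
    using power_mono[OF assms(2)[OF that], of 2] by simp
  then show "integrable (lebesgue_on U) (\<lambda>x. (f x)\<^sup>2)"
    using assms(1) by (intro bounded_integrable[of _ "C\<^sup>2"]) auto
qed fact

lemma test_L2: "\<phi> \<in> test_functions U \<Longrightarrow> \<phi> \<in> L2 U"
  using test_bounded test_measurable_on bounded_L2 by metis

lemma L2_integrable:
  fixes f :: "'a \<Rightarrow> real"
  assumes "f \<in> L2 U"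
  shows "integrable (lebesgue_on U) f"
proof -
  have "(\<lambda>x. 1 :: real) \<in> L2 U" by (rule bounded_L2[of _ 1]) auto
  from L2_inner_integrable[OF assms this] show ?thesis by simp
qed

text \<open>The fundamental lemma applies to each component of the difference, which is integrable
  since \<open>U\<close> has finite measure.\<close>

lemma weak_gradient_unique:
  assumes "has_weak_gradient U u G" "has_weak_gradient U u K"
  shows "AE x in lebesgue_on U. G x = K x"
proof -
  have L: "G \<in> L2 U" "K \<in> L2 U" using assms by (auto simp: has_weak_gradient_def)
  have c: "(\<lambda>x. G x \<bullet> b) \<in> L2 U" if "G \<in> L2 U" "b \<in> Basis" for G :: "'a \<Rightarrow> 'a" and b
  proof (rule L2_I)
    show m: "(\<lambda>x. G x \<bullet> b) \<in> borel_measurable (lebesgue_on U)"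
      by (rule borel_measurable_inner[OF L2_measurable[OF that(1)] borel_measurable_const])
    show "integrable (lebesgue_on U) (\<lambda>x. (G x \<bullet> b)\<^sup>2)"
    proof (rule Bochner_Integration.integrable_bound)
      show "integrable (lebesgue_on U) (\<lambda>x. (norm (G x))\<^sup>2)" using that by (simp add: L2_def)
      have "(G x \<bullet> b)\<^sup>2 \<le> (norm (G x))\<^sup>2" for x
        using power_mono[OF Basis_le_norm[OF that(2), of "G x"], of 2] by simp
      then show "AE x in lebesgue_on U. norm ((G x \<bullet> b)\<^sup>2) \<le> norm ((norm (G x))\<^sup>2)" by simp
    qed (use m in auto)
  qed
  have "AE x in lebesgue_on U. G x \<bullet> b - K x \<bullet> b = 0" if b: "b \<in> Basis" for b
  proof (rule fundamental_lemma_of_calculus_of_variations[OF open_U])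
    show "integrable (lebesgue_on U) (\<lambda>x. G x \<bullet> b - K x \<bullet> b)"
      using L2_integrable c L b by auto
    fix \<phi> assume \<phi>: "\<phi> \<in> test_functions U"
    have "integrable (lebesgue_on U) (\<lambda>x. (G x \<bullet> b) * \<phi> x)" "integrable (lebesgue_on U) (\<lambda>x. (K x \<bullet> b) * \<phi> x)"
      using L2_inner_integrable[OF c[OF L(1) b] test_L2[OF \<phi>]] L2_inner_integrable[OF c[OF L(2) b] test_L2[OF \<phi>]] by auto
    then have "(LINT x|lebesgue_on U. (G x \<bullet> b - K x \<bullet> b) * \<phi> x)
        = (LINT x|lebesgue_on U. (G x \<bullet> b) * \<phi> x) - (LINT x|lebesgue_on U. (K x \<bullet> b) * \<phi> x)"
      by (simp add: left_diff_distrib)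
    also have "\<dots> = 0"
    proof -
      let ?L = "LINT x|lebesgue_on U. u x * frechet_derivative \<phi> (at x) b"
      have "?L = - (LINT x|lebesgue_on U. (G x \<bullet> b) * \<phi> x)" "?L = - (LINT x|lebesgue_on U. (K x \<bullet> b) * \<phi> x)"
        using assms[unfolded has_weak_gradient_def] \<phi> b by blast+
      then show ?thesis by linarith
    qed
    finally show "(LINT x|lebesgue_on U. (G x \<bullet> b - K x \<bullet> b) * \<phi> x) = 0" .
  qed
  then have "AE x in lebesgue_on U. \<forall>b\<in>Basis. G x \<bullet> b - K x \<bullet> b = 0"
    by (intro AE_finite_allI) auto
  then show ?thesis
    by eventually_elim (auto intro: euclidean_eqI)
qed

lemma wgrad_works: "u \<in> H1 U \<Longrightarrow> has_weak_gradient U u (wgrad U u)"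
  unfolding H1_def wgrad_def using someI_ex[of "has_weak_gradient U u"] by blast

lemma wgrad_L2: "u \<in> H1 U \<Longrightarrow> wgrad U u \<in> L2 U"
  using wgrad_works by (simp add: has_weak_gradient_def)

lemma H1_L2: "u \<in> H1 U \<Longrightarrow> u \<in> L2 U"
  by (simp add: H1_def)

lemma H1_I: "u \<in> L2 U \<Longrightarrow> has_weak_gradient U u G \<Longrightarrow> u \<in> H1 U"
  by (auto simp: H1_def)

lemma wgrad_AE: "has_weak_gradient U u G \<Longrightarrow> AE x in lebesgue_on U. wgrad U u x = G x"
  using weak_gradient_unique someI[of "has_weak_gradient U u"] by (metis wgrad_def)

lemma component_L2:
  fixes G :: "'a \<Rightarrow> 'a"
  assumes "G \<in> L2 U" "\<phi> \<in> L2 U" "b \<in> Basis"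
  shows "integrable (lebesgue_on U) (\<lambda>x. (G x \<bullet> b) * \<phi> x)"
proof -
  have "(\<lambda>x. \<phi> x *\<^sub>R b) \<in> L2 U"
    using assms by (auto simp: L2_def)
  from L2_inner_integrable[OF assms(1) this] show ?thesis by (simp add: mult.commute)
qed

lemma has_weak_gradient_lincomb:
  assumes "has_weak_gradient U u G" "has_weak_gradient U w K" "u \<in> L2 U" "w \<in> L2 U"
  shows "has_weak_gradient U (\<lambda>x. u x + c * w x) (\<lambda>x. G x + c *\<^sub>R K x)"
  unfolding has_weak_gradient_def
proof (intro conjI ballI)
  have L: "G \<in> L2 U" "K \<in> L2 U" using assms by (auto simp: has_weak_gradient_def)
  then show "(\<lambda>x. G x + c *\<^sub>R K x) \<in> L2 U" by (rule L2_lincomb)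
  fix \<phi> and b :: 'a assume \<phi>: "\<phi> \<in> test_functions U" and b: "b \<in> Basis"
  note d = test_L2[OF test_deriv[OF \<phi> b]]
  note I = component_L2[OF L(1) test_L2[OF \<phi>] b] component_L2[OF L(2) test_L2[OF \<phi>] b]
    L2_inner_integrable[OF assms(3) d] L2_inner_integrable[OF assms(4) d]
  have "(LINT x|lebesgue_on U. (u x + c * w x) * frechet_derivative \<phi> (at x) b) =
    (LINT x|lebesgue_on U. u x * frechet_derivative \<phi> (at x) b) + c * (LINT x|lebesgue_on U. w x * frechet_derivative \<phi> (at x) b)"
    using I by (simp add: distrib_right mult.assoc)
  also have "\<dots> = - (LINT x|lebesgue_on U. (G x \<bullet> b) * \<phi> x) - c * (LINT x|lebesgue_on U. (K x \<bullet> b) * \<phi> x)"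
    using assms \<phi> b by (simp add: has_weak_gradient_def)
  also have "\<dots> = - (LINT x|lebesgue_on U. ((G x + c *\<^sub>R K x) \<bullet> b) * \<phi> x)"
    using I by (simp add: distrib_right mult.assoc inner_add_left)
  finally show "(LINT x|lebesgue_on U. (u x + c * w x) * frechet_derivative \<phi> (at x) b) =
    - (LINT x|lebesgue_on U. ((G x + c *\<^sub>R K x) \<bullet> b) * \<phi> x)" .
qed

lemma H1_lincomb: "u \<in> H1 U \<Longrightarrow> w \<in> H1 U \<Longrightarrow> (\<lambda>x. u x + c * w x) \<in> H1 U"
  by (rule H1_I[OF L2_space.lincomb has_weak_gradient_lincomb[OF wgrad_works wgrad_works]]) (auto intro: H1_L2)

text \<open>Replaces the gradient selected by \<open>SOME\<close> by any concrete weak gradient.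
  Bilinearity of \<open>dirichlet\<close> rests on this, since \<open>wgrad\<close> respects sums
  only almost everywhere.\<close>

lemma dirichlet_eq:
  assumes "has_weak_gradient U u G" "u \<in> H1 U" "w \<in> H1 U"
  shows "dirichlet U u w = L2_inner U G (wgrad U w)"
  unfolding dirichlet_def
  by (rule L2_inner_cong_AE[OF _ _ _ wgrad_AE]) (use assms wgrad_L2 in \<open>auto simp: has_weak_gradient_def\<close>)

sublocale H1s: semi_inner_space "H1 U" "dirichlet U"
proof
  show "dirichlet U u w = dirichlet U w u" for u w
    by (simp add: dirichlet_def L2_inner_commute)
  show "0 \<le> dirichlet U u u" for u
    by (simp add: dirichlet_def L2_inner_self_nonneg)
  show "(\<lambda>x. u x + c * w x) \<in> H1 U" if "u \<in> H1 U" "w \<in> H1 U" for u w c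
    using that by (rule H1_lincomb)
  show "dirichlet U (\<lambda>x. u x + c * w x) z = dirichlet U u z + c * dirichlet U w z"
    if "u \<in> H1 U" "w \<in> H1 U" "z \<in> H1 U" for u w z c
  proof -
    have "dirichlet U (\<lambda>x. u x + c * w x) z = L2_inner U (\<lambda>x. wgrad U u x + c *\<^sub>R wgrad U w x) (wgrad U z)"
      using that by (intro dirichlet_eq has_weak_gradient_lincomb wgrad_works H1_lincomb H1_L2)
    then show ?thesis using that by (simp add: L2_inner_lincomb wgrad_L2 dirichlet_def)
  qed
qed

sublocale H1: semi_inner_space "H1 U" "H1_inner U"
proof
  show "H1_inner U u w = H1_inner U w u" for u w
    using L2_inner_commute[of U u w] H1s.sym[of u w] by (simp add: H1_inner_def)
  show "0 \<le> H1_inner U u u" if "u \<in> H1 U" for u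
    using L2_inner_self_nonneg[of U u] H1s.nonneg[OF that] by (simp add: H1_inner_def)
  show "(\<lambda>x. u x + c * w x) \<in> H1 U" if "u \<in> H1 U" "w \<in> H1 U" for u w c
    using that by (rule H1_lincomb)
  show "H1_inner U (\<lambda>x. u x + c * w x) z = H1_inner U u z + c * H1_inner U w z"
    if "u \<in> H1 U" "w \<in> H1 U" "z \<in> H1 U" for u w z c
    using L2_space.add_left[OF that[THEN H1_L2], of c] H1s.add_left[OF that, of c]
    by (simp add: H1_inner_def algebra_simps)
qed

lemma H1s_nrm: "H1s.nrm u = gnorm U u"
  by (simp add: H1s.nrm_def gnorm_sqrt)

lemma H1_nrm: "H1.nrm u = H1_norm U u"
  by (simp add: H1.nrm_def H1_norm_sqrt)

text \<open>Integration by parts: the derivative of the product of two test functions has integral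
  0.\<close>

lemma test_weak_gradient:
  assumes "\<psi> \<in> test_functions U"
  shows "has_weak_gradient U \<psi> (\<lambda>x. \<Sum>b\<in>Basis. frechet_derivative \<psi> (at x) b *\<^sub>R b)"
  unfolding has_weak_gradient_def
proof (intro conjI ballI)
  have c: "(\<lambda>x. frechet_derivative \<psi> (at x) b *\<^sub>R b) \<in> L2 U" if "b \<in> Basis" for b
    using test_L2[OF test_deriv[OF assms that]] by (auto simp: L2_def power_mult_distrib)
  have "finite F \<Longrightarrow> F \<subseteq> Basis \<Longrightarrow> (\<lambda>x. \<Sum>b\<in>F. frechet_derivative \<psi> (at x) b *\<^sub>R b) \<in> L2 U" for F
  proof (induction F rule: finite_induct)
    case empty
    then show ?case by (simp add: L2_def)
  next
    case (insert b F)
    then have "(\<lambda>x. frechet_derivative \<psi> (at x) b *\<^sub>R b + 1 *\<^sub>R (\<Sum>b\<in>F. frechet_derivative \<psi> (at x) b *\<^sub>R b)) \<in> L2 U"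
      by (intro L2_lincomb c) auto
    then show ?case using insert by simp
  qed
  from this[of Basis] show "(\<lambda>x. \<Sum>b\<in>Basis. frechet_derivative \<psi> (at x) b *\<^sub>R b) \<in> L2 U" by simp
  fix \<phi> and b :: 'a assume \<phi>: "\<phi> \<in> test_functions U" and b: "b \<in> Basis"
  let ?D = "\<lambda>x. frechet_derivative \<psi> (at x) b" and ?E = "\<lambda>x. frechet_derivative \<phi> (at x) b"
  have p: "(\<lambda>x. \<psi> x * \<phi> x) \<in> test_functions U"
    by (rule test_mult_smooth[OF \<phi> test_smooth[OF assms]])
  have fd: "frechet_derivative (\<lambda>x. \<psi> x * \<phi> x) (at x) b = \<psi> x * ?E x + ?D x * \<phi> x" for x
    using fun_cong[OF frechet_derivative_at[OF has_derivative_mult[OF test_has_derivative[OF assms] test_has_derivative[OF \<phi>]], of x], of b]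
    by simp
  have I: "integrable (lebesgue_on U) (\<lambda>x. \<psi> x * ?E x)" "integrable (lebesgue_on U) (\<lambda>x. ?D x * \<phi> x)"
    using L2_inner_integrable[OF test_L2[OF assms] test_L2[OF test_deriv[OF \<phi> b]]]
      L2_inner_integrable[OF test_L2[OF test_deriv[OF assms b]] test_L2[OF \<phi>]] by auto
  have "0 = (LINT x|lebesgue_on U. frechet_derivative (\<lambda>x. \<psi> x * \<phi> x) (at x) b)"
    using test_integral_deriv[OF p open_U b] by simp
  also have "\<dots> = (LINT x|lebesgue_on U. \<psi> x * ?E x) + (LINT x|lebesgue_on U. ?D x * \<phi> x)"
    unfolding fd using I by simp
  finally show "(LINT x|lebesgue_on U. \<psi> x * ?E x) =
     - (LINT x|lebesgue_on U. ((\<Sum>b\<in>Basis. frechet_derivative \<psi> (at x) b *\<^sub>R b) \<bullet> b) * \<phi> x)"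
    using b by (simp add: inner_sum_left inner_Basis if_distrib sum.delta cong: if_cong)
qed

lemma test_H1: "\<phi> \<in> test_functions U \<Longrightarrow> \<phi> \<in> H1 U"
  using test_L2 test_weak_gradient H1_I by blast

lemma laplacian_L2:
  assumes "\<phi> \<in> test_functions U"
  shows "laplacian \<phi> \<in> L2 U"
proof -
  have "(\<lambda>x. \<Sum>b\<in>F. frechet_derivative (\<lambda>y. frechet_derivative \<phi> (at y) b) (at x) b) \<in> test_functions U"
    if "finite F" "F \<subseteq> Basis" for F
    using that by (induction F rule: finite_induct) (auto simp: test_zero_fun intro!: test_add test_deriv assms)
  from this[of Basis] show ?thesis
    unfolding laplacian_def[abs_def] by (intro test_L2) auto
qed

text \<open>With both derivatives on the test function, the pairing depends only on \<open>u\<close>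
  as an element of L2. This later removes the gradient of the time derivative.\<close>

lemma dirichlet_test:
  assumes "\<phi> \<in> test_functions U" "u \<in> H1 U"
  shows "dirichlet U u \<phi> = - L2_inner U u (laplacian \<phi>)"
proof -
  let ?D = "\<lambda>b x. frechet_derivative \<phi> (at x) b"
  let ?DD = "\<lambda>b x. frechet_derivative (\<lambda>y. frechet_derivative \<phi> (at y) b) (at x) b"
  have I1: "integrable (lebesgue_on U) (\<lambda>x. (wgrad U u x \<bullet> b) * ?D b x)" if "b \<in> Basis" for b
    using component_L2[OF wgrad_L2[OF assms(2)] test_L2[OF test_deriv[OF assms(1) that]] that] .
  have I2: "integrable (lebesgue_on U) (\<lambda>x. u x * ?DD b x)" if "b \<in> Basis" for b
    using L2_inner_integrable[OF H1_L2[OF assms(2)] test_L2[OF test_deriv[OF test_deriv[OF assms(1) that] that]]] by simp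
  have "dirichlet U u \<phi> = dirichlet U \<phi> u" by (rule H1s.sym)
  also have "\<dots> = L2_inner U (\<lambda>x. \<Sum>b\<in>Basis. ?D b x *\<^sub>R b) (wgrad U u)"
    by (intro dirichlet_eq test_weak_gradient test_H1 assms)
  also have "\<dots> = (LINT x|lebesgue_on U. (\<Sum>b\<in>Basis. (wgrad U u x \<bullet> b) * ?D b x))"
  proof -
    have "(\<Sum>b\<in>Basis. ?D b x *\<^sub>R b) \<bullet> wgrad U u x = (\<Sum>b\<in>Basis. (wgrad U u x \<bullet> b) * ?D b x)" for x
      unfolding inner_sum_left inner_scaleR_left by (intro sum.cong) (auto simp: inner_commute)
    then show ?thesis by (simp add: L2_inner_def)
  qed
  also have "\<dots> = (\<Sum>b\<in>Basis. (LINT x|lebesgue_on U. (wgrad U u x \<bullet> b) * ?D b x))"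
    using I1 by (intro Bochner_Integration.integral_sum) auto
  also have "\<dots> = (\<Sum>b\<in>Basis. - (LINT x|lebesgue_on U. u x * ?DD b x))"
  proof (rule sum.cong[OF refl])
    fix b :: 'a assume b: "b \<in> Basis"
    from wgrad_works[OF assms(2)] test_deriv[OF assms(1) b] b
    have "(LINT x|lebesgue_on U. u x * ?DD b x) = - (LINT x|lebesgue_on U. (wgrad U u x \<bullet> b) * ?D b x)"
      unfolding has_weak_gradient_def by blast
    then show "(LINT x|lebesgue_on U. (wgrad U u x \<bullet> b) * ?D b x) = - (LINT x|lebesgue_on U. u x * ?DD b x)"
      by simp
  qed
  also have "\<dots> = - (LINT x|lebesgue_on U. (\<Sum>b\<in>Basis. u x * ?DD b x))"
    using I2 by (subst Bochner_Integration.integral_sum) (auto simp: sum_negf)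
  finally show ?thesis
    by (simp add: L2_inner_def laplacian_def sum_distrib_left)
qed

lemma H01_H1: "u \<in> H01 U \<Longrightarrow> u \<in> H1 U"
  by (simp add: H01_def)

lemma H01_L2: "u \<in> H01 U \<Longrightarrow> u \<in> L2 U"
  by (simp add: H01_H1 H1_L2)

lemma H01_I:
  assumes "u \<in> H1 U" "\<And>k::nat. \<phi> k \<in> test_functions U" "(\<lambda>k. H1_norm U (\<lambda>x. \<phi> k x - u x)) \<longlonglongrightarrow> 0"
  shows "u \<in> H01 U"
  using assms by (auto simp: H01_def)

lemma test_H01: "\<phi> \<in> test_functions U \<Longrightarrow> \<phi> \<in> H01 U"
proof (rule H01_I[where \<phi>="\<lambda>_. \<phi>"])
  assume "\<phi> \<in> test_functions U"
  then have "H1_norm U (\<lambda>x. 0 * \<phi> x) = 0"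
    using H1.nrm_scale[OF test_H1, of \<phi> 0] by (simp add: H1_nrm)
  then show "(\<lambda>k::nat. H1_norm U (\<lambda>x. \<phi> x - \<phi> x)) \<longlonglongrightarrow> 0" by simp
qed (auto intro: test_H1)

lemma H01_dense:
  assumes "u \<in> H01 U"
  obtains \<phi> where "\<And>k::nat. \<phi> k \<in> test_functions U" "(\<lambda>k. H1_norm U (\<lambda>x. \<phi> k x - u x)) \<longlonglongrightarrow> 0"
  using assms by (auto simp: H01_def)

lemma H01_lincomb:
  assumes "u \<in> H01 U" "w \<in> H01 U"
  shows "(\<lambda>x. u x + c * w x) \<in> H01 U"
proof -
  obtain \<phi> where \<phi>: "\<And>k::nat. \<phi> k \<in> test_functions U" "(\<lambda>k. H1_norm U (\<lambda>x. \<phi> k x - u x)) \<longlonglongrightarrow> 0"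
    using H01_dense[OF assms(1)] by blast
  obtain \<psi> where \<psi>: "\<And>k::nat. \<psi> k \<in> test_functions U" "(\<lambda>k. H1_norm U (\<lambda>x. \<psi> k x - w x)) \<longlonglongrightarrow> 0"
    using H01_dense[OF assms(2)] by blast
  note H = H01_H1[OF assms(1)] H01_H1[OF assms(2)]
  show ?thesis
  proof (rule H01_I[where \<phi>="\<lambda>k x. \<phi> k x + c * \<psi> k x"])
    show "(\<lambda>x. u x + c * w x) \<in> H1 U" using H by (rule H1_lincomb)
    show "(\<lambda>x. \<phi> k x + c * \<psi> k x) \<in> test_functions U" for k
      by (intro test_add test_cmult \<phi> \<psi>)
    show "(\<lambda>k. H1_norm U (\<lambda>x. \<phi> k x + c * \<psi> k x - (u x + c * w x))) \<longlonglongrightarrow> 0"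
    proof (rule tendsto_sandwich[OF _ _ tendsto_const])
      show "(\<lambda>k. H1_norm U (\<lambda>x. \<phi> k x - u x) + \<bar>c\<bar> * H1_norm U (\<lambda>x. \<psi> k x - w x)) \<longlonglongrightarrow> 0"
        using tendsto_add[OF \<phi>(2) tendsto_mult[OF tendsto_const[of "\<bar>c\<bar>"] \<psi>(2)]] by simp
      have "H1_norm U (\<lambda>x. \<phi> k x + c * \<psi> k x - (u x + c * w x))
        \<le> H1_norm U (\<lambda>x. \<phi> k x - u x) + \<bar>c\<bar> * H1_norm U (\<lambda>x. \<psi> k x - w x)" for k
      proof -
        have d: "(\<lambda>x. \<phi> k x - u x) \<in> H1 U" "(\<lambda>x. \<psi> k x - w x) \<in> H1 U"
          by (intro H1.diff H test_H1 \<phi> \<psi>)+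
        have "H1.nrm (\<lambda>x. (\<phi> k x - u x) + c * (\<psi> k x - w x)) \<le> H1.nrm (\<lambda>x. \<phi> k x - u x) + H1.nrm (\<lambda>x. c * (\<psi> k x - w x))"
          by (intro H1.nrm_triangle H1.scale d)
        then show ?thesis
          using H1.nrm_scale[OF d(2), of c] by (simp add: H1_nrm algebra_simps)
      qed
      then show "\<forall>\<^sub>F k in sequentially. H1_norm U (\<lambda>x. \<phi> k x + c * \<psi> k x - (u x + c * w x))
        \<le> H1_norm U (\<lambda>x. \<phi> k x - u x) + \<bar>c\<bar> * H1_norm U (\<lambda>x. \<psi> k x - w x)" by simp
    qed (simp add: H1_norm_nonneg)
  qed
qed

lemma H01_diff: "u \<in> H01 U \<Longrightarrow> w \<in> H01 U \<Longrightarrow> (\<lambda>x. u x - w x) \<in> H01 U"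
  using H01_lincomb[of u w "- 1"] by simp

lemma H01_scale: "u \<in> H01 U \<Longrightarrow> (\<lambda>x. c * u x) \<in> H01 U"
  using H01_lincomb[of u u "c - 1"] by (simp add: algebra_simps)

lemma H01_dense_norms:
  assumes "u \<in> H01 U" and \<phi>: "\<And>k::nat. \<phi> k \<in> test_functions U"
    and lim: "(\<lambda>k. H1_norm U (\<lambda>x. \<phi> k x - u x)) \<longlonglongrightarrow> 0"
  shows "(\<lambda>k. gnorm U (\<lambda>x. \<phi> k x - u x)) \<longlonglongrightarrow> 0" "(\<lambda>k. Lnorm U 2 (\<lambda>x. \<phi> k x - u x)) \<longlonglongrightarrow> 0"
    "(\<lambda>k. gnorm U (\<phi> k)) \<longlonglongrightarrow> gnorm U u" "(\<lambda>k. Lnorm U 2 (\<phi> k)) \<longlonglongrightarrow> Lnorm U 2 u"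
    "(\<lambda>k. H1_norm U (\<phi> k)) \<longlonglongrightarrow> H1_norm U u"
proof -
  note u = H01_H1[OF assms(1)]
  show g: "(\<lambda>k. gnorm U (\<lambda>x. \<phi> k x - u x)) \<longlonglongrightarrow> 0"
    by (rule tendsto_sandwich[OF _ _ tendsto_const lim])
       (auto simp: gnorm_nonneg gnorm_le_H1_norm)
  show l: "(\<lambda>k. Lnorm U 2 (\<lambda>x. \<phi> k x - u x)) \<longlonglongrightarrow> 0"
    by (rule tendsto_sandwich[OF _ _ tendsto_const lim])
       (auto simp: Lnorm_2 L2_inner_self_nonneg Lnorm_le_H1_norm[unfolded Lnorm_2])
  have *: "(\<lambda>k. N (\<phi> k)) \<longlonglongrightarrow> N u"
    if "\<And>k. \<bar>N (\<phi> k) - N u\<bar> \<le> N (\<lambda>x. \<phi> k x - u x)" "(\<lambda>k. N (\<lambda>x. \<phi> k x - u x)) \<longlonglongrightarrow> 0" for N :: "_ \<Rightarrow> real"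
    by (rule Lim_transform_bound[OF always_eventually, THEN LIM_zero_cancel, OF _ that(2)])
       (auto intro: order_trans[OF that(1) abs_ge_self])
  show "(\<lambda>k. gnorm U (\<phi> k)) \<longlonglongrightarrow> gnorm U u"
    by (rule *[OF _ g]) (use H1s.nrm_diff_bound[OF test_H1[OF \<phi>] u] in \<open>simp add: H1s_nrm\<close>)
  show "(\<lambda>k. Lnorm U 2 (\<phi> k)) \<longlonglongrightarrow> Lnorm U 2 u"
    by (rule *[OF _ l]) (use L2_space.nrm_diff_bound[OF test_L2[OF \<phi>] H1_L2[OF u]] in \<open>simp add: L2_nrm\<close>)
  show "(\<lambda>k. H1_norm U (\<phi> k)) \<longlonglongrightarrow> H1_norm U u"
    by (rule *[OF _ lim]) (use H1.nrm_diff_bound[OF test_H1[OF \<phi>] u] in \<open>simp add: H1_nrm\<close>)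
qed

section \<open>Poincare's inequality\<close>

text \<open>The derivative of \<open>(x \<bullet> b) * (\<phi> x)\<^sup>2\<close> in direction
  \<open>b\<close> has integral 0. Its first term is \<open>(\<phi> x)\<^sup>2\<close>, the other
  contains one derivative of \<open>\<phi>\<close> and a factor bounded by \<open>R\<close>.\<close>

lemma Poincare_test:
  obtains C where "C > 0" "\<And>\<phi>. \<phi> \<in> test_functions U \<Longrightarrow> Lnorm U 2 \<phi> \<le> C * gnorm U \<phi>"
proof -
  obtain R where R: "R > 0" "\<And>x. x \<in> U \<Longrightarrow> norm x \<le> R"
    using bounded_U by (auto simp: bounded_pos)
  obtain b :: 'a where b: "b \<in> Basis" using nonempty_Basis by blast
  have "Lnorm U 2 \<phi> \<le> 2 * R * gnorm U \<phi>" if \<phi>: "\<phi> \<in> test_functions U" for \<phi>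
  proof -
    let ?G = "\<lambda>x. \<Sum>b\<in>Basis. frechet_derivative \<phi> (at x) b *\<^sub>R b"
    let ?D = "\<lambda>x. frechet_derivative \<phi> (at x) b"
    have xp: "(\<lambda>x. (x \<bullet> b) * \<phi> x) \<in> test_functions U"
      by (rule test_mult_smooth[OF \<phi>]) (simp add: smooth_on_inner)
    have t: "(\<lambda>x. (x \<bullet> b) * \<phi> x * \<phi> x) \<in> test_functions U"
      by (rule test_mult_smooth[OF \<phi>]) (rule test_smooth[OF xp])
    have fd: "frechet_derivative (\<lambda>x. (x \<bullet> b) * \<phi> x * \<phi> x) (at x) b = (\<phi> x)\<^sup>2 + 2 * ((x \<bullet> b) * \<phi> x * ?D x)" for x
    proof -
      have "((\<lambda>x. (x \<bullet> b) * \<phi> x * \<phi> x) has_derivative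
          (\<lambda>h. (x \<bullet> b) * \<phi> x * frechet_derivative \<phi> (at x) h
            + ((x \<bullet> b) * frechet_derivative \<phi> (at x) h + (h \<bullet> b) * \<phi> x) * \<phi> x)) (at x)"
        by (intro has_derivative_mult test_has_derivative[OF \<phi>] has_derivative_inner_left has_derivative_ident)
      from fun_cong[OF frechet_derivative_at[OF this], of b] b show ?thesis
        by (simp add: power2_eq_square algebra_simps)
    qed
    have I1: "integrable (lebesgue_on U) (\<lambda>x. (\<phi> x)\<^sup>2)" using test_L2[OF \<phi>] by (simp add: L2_def)
    have I2: "integrable (lebesgue_on U) (\<lambda>x. (x \<bullet> b) * \<phi> x * ?D x)"
      using L2_inner_integrable[OF test_L2[OF xp] test_L2[OF test_deriv[OF \<phi> b]]] by simp
    have GL: "?G \<in> L2 U" using test_weak_gradient[OF \<phi>] by (simp add: has_weak_gradient_def)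
    have I3: "integrable (lebesgue_on U) (\<lambda>x. ?G x \<bullet> ?G x)" by (rule L2_inner_integrable[OF GL GL])
    have D: "\<bar>?D x\<bar> \<le> norm (?G x)" for x
    proof -
      have "?G x \<bullet> b = ?D x"
        using b by (simp add: inner_sum_left inner_Basis if_distrib sum.delta cong: if_cong)
      then show ?thesis using Basis_le_norm[OF b, of "?G x"] by simp
    qed
    have "L2_inner U ?G ?G = dirichlet U \<phi> \<phi>"
    proof -
      have "dirichlet U \<phi> \<phi> = L2_inner U ?G (wgrad U \<phi>)"
        by (intro dirichlet_eq test_weak_gradient test_H1 \<phi>)
      also have "\<dots> = L2_inner U (wgrad U \<phi>) ?G" by (rule L2_inner_commute)
      also have "\<dots> = L2_inner U ?G ?G"
        by (rule L2_inner_cong_AE[OF wgrad_L2[OF test_H1[OF \<phi>]] GL GL wgrad_AE[OF test_weak_gradient[OF \<phi>]]])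
      finally show ?thesis ..
    qed
    then have G: "(LINT x|lebesgue_on U. ?G x \<bullet> ?G x) = (gnorm U \<phi>)\<^sup>2"
      by (simp add: gnorm_sq L2_inner_def)
    have "0 = (LINT x|lebesgue_on U. (\<phi> x)\<^sup>2 + 2 * ((x \<bullet> b) * \<phi> x * ?D x))"
      using test_integral_deriv[OF t open_U b] unfolding fd by simp
    also have "\<dots> \<ge> (LINT x|lebesgue_on U. (\<phi> x)\<^sup>2 / 2 - 2 * R\<^sup>2 * (?G x \<bullet> ?G x))"
    proof (rule integral_mono)
      fix x assume "x \<in> space (lebesgue_on U)"
      then have "\<bar>x \<bullet> b\<bar> \<le> R" using R(2)[of x] Basis_le_norm[OF b, of x] by auto
      then have "\<bar>(x \<bullet> b) * \<phi> x * ?D x\<bar> \<le> R * \<bar>\<phi> x\<bar> * norm (?G x)"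
        unfolding abs_mult using D[of x] by (intro mult_mono) auto
      \<comment> \<open>Young's inequality with weights such that half of
        \<open>(\<phi> x)\<^sup>2\<close> survives the absorption; this gives the constant
        \<open>2 * R\<close>.\<close>
      moreover have "2 * (\<bar>\<phi> x\<bar> / 2) * (R * norm (?G x)) \<le> (\<bar>\<phi> x\<bar> / 2)\<^sup>2 + (R * norm (?G x))\<^sup>2"
        by (rule sum_squares_bound)
      ultimately have "2 * \<bar>(x \<bullet> b) * \<phi> x * ?D x\<bar> \<le> (\<phi> x)\<^sup>2 / 2 + 2 * R\<^sup>2 * (norm (?G x))\<^sup>2"
        by (simp add: power_mult_distrib power_divide mult.commute mult.left_commute)
      then show "(\<phi> x)\<^sup>2 / 2 - 2 * R\<^sup>2 * (?G x \<bullet> ?G x) \<le> (\<phi> x)\<^sup>2 + 2 * ((x \<bullet> b) * \<phi> x * ?D x)"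
        unfolding power2_norm_eq_inner by linarith
    qed (use I1 I2 I3 in auto)
    also have "(LINT x|lebesgue_on U. (\<phi> x)\<^sup>2 / 2 - 2 * R\<^sup>2 * (?G x \<bullet> ?G x)) = (Lnorm U 2 \<phi>)\<^sup>2 / 2 - 2 * R\<^sup>2 * (gnorm U \<phi>)\<^sup>2"
    proof -
      have "(LINT x|lebesgue_on U. (\<phi> x)\<^sup>2) = (Lnorm U 2 \<phi>)\<^sup>2"
        unfolding Lnorm_2_sq L2_inner_def by (simp add: power2_eq_square)
      then show ?thesis using I1 I3 by (simp add: G)
    qed
    finally have "(Lnorm U 2 \<phi>)\<^sup>2 \<le> (2 * R * gnorm U \<phi>)\<^sup>2"
      by (simp add: power_mult_distrib)
    then show ?thesis
      by (rule power2_le_imp_le) (use R(1) gnorm_nonneg[of U \<phi>] in simp)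
  qed
  with R(1) show ?thesis by (intro that[of "2 * R"]) auto
qed

lemma Poincare:
  obtains C where "C > 0" "\<And>u. u \<in> H01 U \<Longrightarrow> Lnorm U 2 u \<le> C * gnorm U u"
proof -
  obtain C where C: "C > 0" "\<And>\<phi>. \<phi> \<in> test_functions U \<Longrightarrow> Lnorm U 2 \<phi> \<le> C * gnorm U \<phi>"
    using Poincare_test by blast
  have "Lnorm U 2 u \<le> C * gnorm U u" if u: "u \<in> H01 U" for u
  proof -
    obtain \<phi> where \<phi>: "\<And>k::nat. \<phi> k \<in> test_functions U" "(\<lambda>k. H1_norm U (\<lambda>x. \<phi> k x - u x)) \<longlonglongrightarrow> 0"
      using H01_dense[OF u] by blast
    note l = H01_dense_norms[OF u \<phi>]
    show ?thesis
      by (rule LIMSEQ_le[OF l(4) tendsto_mult[OF tendsto_const[of C] l(3)]]) (use C(2) \<phi>(1) in auto)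
  qed
  with C(1) show ?thesis by (rule that)
qed

end

section \<open>The logarithmic nonlinearity\<close>

text \<open>A nondecreasing majorant, up to the factor \<open>log_const p\<close> below, of the derivative of the source
  term as a function of \<open>\<bar>s\<bar>\<close>. Being bounded below by 1 and of regular growth under dilation, it is
  easier to handle than \<open>\<bar>s\<bar> powr (p - 1) * \<bar>ln \<bar>s\<bar>\<bar>\<close> itself.\<close>

definition growth :: "real \<Rightarrow> real \<Rightarrow> real" where
  "growth p s = (1 + s) powr (p - 1) * (1 + ln (1 + s))"

text \<open>The primitive of \<open>log_source p\<close> that vanishes at 0; \<open>energy_J\<close>
  is half the squared gradient norm minus its integral.\<close>

definition log_potential :: "real \<Rightarrow> real \<Rightarrow> real" where
  "log_potential p s = \<bar>s\<bar> powr (1 + p) * ln \<bar>s\<bar> / (1 + p) - \<bar>s\<bar> powr (1 + p) / (1 + p)\<^sup>2"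

lemma growth_mono:
  assumes "p > 1" "0 \<le> s" "s \<le> t"
  shows "growth p s \<le> growth p t"
  unfolding growth_def using assms by (intro mult_mono powr_mono2 add_mono) auto

lemma growth_ge_1:
  assumes "p > 1" "0 \<le> s"
  shows "1 \<le> growth p s"
  using growth_mono[OF assms(1) _ assms(2)] by (simp add: growth_def)

text \<open>The ones added inside \<open>growth\<close> make both factors submultiplicative:
  \<open>1 + K * s \<le> K * (1 + s)\<close>, and a sum of logarithms is dominated by the product
  \<open>(1 + ln K) * (1 + ln (1 + s))\<close>.\<close>

lemma growth_scale:
  assumes "p > 1" "K \<ge> 1" "0 \<le> s"
  shows "growth p (K * s) \<le> K powr (p - 1) * (1 + ln K) * growth p s"
proof -
  have le: "1 + K * s \<le> K * (1 + s)" using assms by (simp add: algebra_simps)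
  have pos: "0 < 1 + K * s" using assms by (simp add: add_pos_nonneg)
  have "(1 + K * s) powr (p - 1) \<le> (K * (1 + s)) powr (p - 1)"
    using le pos assms by (intro powr_mono2) auto
  also have "\<dots> = K powr (p - 1) * (1 + s) powr (p - 1)"
    using assms by (simp add: powr_mult)
  finally have 1: "(1 + K * s) powr (p - 1) \<le> K powr (p - 1) * (1 + s) powr (p - 1)" .
  have "ln (1 + K * s) \<le> ln (K * (1 + s))" using le pos by simp
  also have "\<dots> = ln K + ln (1 + s)" using assms by (simp add: ln_mult)
  finally have "ln (1 + K * s) \<le> ln K + ln (1 + s)" .
  moreover have "0 \<le> ln K * ln (1 + s)"
    using assms by (intro mult_nonneg_nonneg ln_ge_zero) auto
  ultimately have "1 + ln (1 + K * s) \<le> 1 + ln K + ln (1 + s) + ln K * ln (1 + s)"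
    by linarith
  also have "\<dots> = (1 + ln K) * (1 + ln (1 + s))" by (simp add: algebra_simps)
  finally have 2: "1 + ln (1 + K * s) \<le> (1 + ln K) * (1 + ln (1 + s))" .
  have "growth p (K * s) \<le> (K powr (p - 1) * (1 + s) powr (p - 1)) * ((1 + ln K) * (1 + ln (1 + s)))"
    unfolding growth_def using 1 2 assms by (intro mult_mono) auto
  then show ?thesis by (simp add: growth_def mult_ac)
qed

lemma power_le_growth:
  assumes "p > 1"
  shows "\<bar>s\<bar> powr (p - 1) \<le> growth p \<bar>s\<bar>"
proof -
  have "\<bar>s\<bar> powr (p - 1) * 1 \<le> (1 + \<bar>s\<bar>) powr (p - 1) * (1 + ln (1 + \<bar>s\<bar>))"
    using assms by (intro mult_mono powr_mono2) auto
  then show ?thesis by (simp add: growth_def)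
qed

lemma powr_plus_one: "\<bar>s\<bar> powr (1 + p) = \<bar>s\<bar> powr (p - 1) * s\<^sup>2" for s :: real
proof (cases "s = 0")
  case False
  have "\<bar>s\<bar> powr (1 + p) = \<bar>s\<bar> powr (p - 1) * \<bar>s\<bar> powr 2"
    using powr_add[of "\<bar>s\<bar>" "p - 1" 2] by (simp add: add.commute)
  then show ?thesis using False by (simp add: powr_numeral)
qed auto

lemma log_source_mult: "log_source p s * s = \<bar>s\<bar> powr (1 + p) * ln \<bar>s\<bar>"
  by (simp add: log_source_def powr_plus_one power2_eq_square)

text \<open>Only small arguments need care, where the logarithm is unbounded:
  \<open>ln y \<le> y - 1\<close> at \<open>y = x powr (- (p - 1))\<close> bounds the product by
  \<open>1 / (p - 1)\<close>. Here \<open>p > 1\<close> is essential.\<close>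

lemma power_log_le_growth:
  assumes "p > 1"
  shows "\<bar>s\<bar> powr (p - 1) * \<bar>ln \<bar>s\<bar>\<bar> \<le> (1 + 1 / (p - 1)) * growth p \<bar>s\<bar>"
proof -
  define x where "x = \<bar>s\<bar>"
  have x0: "x \<ge> 0" by (simp add: x_def)
  have g: "1 \<le> growth p x" using growth_ge_1[OF assms x0] .
  consider "x = 0" | "0 < x" "x \<le> 1" | "1 < x" using x0 by linarith
  then have "x powr (p - 1) * \<bar>ln x\<bar> \<le> (1 + 1 / (p - 1)) * growth p x"
  proof cases
    case 2
    have "ln (x powr (- (p - 1))) \<le> x powr (- (p - 1)) - 1"
      using 2 by (intro ln_le_minus_one) auto
    then have "(p - 1) * \<bar>ln x\<bar> \<le> x powr (- (p - 1))"
      using 2 by (simp add: ln_powr algebra_simps)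
    then have "x powr (p - 1) * ((p - 1) * \<bar>ln x\<bar>) \<le> x powr (p - 1) * x powr (- (p - 1))"
      by (intro mult_left_mono) auto
    also have "\<dots> = 1" using 2 by (simp flip: powr_add)
    finally have "x powr (p - 1) * \<bar>ln x\<bar> \<le> 1 / (p - 1)" using assms by (simp add: field_simps)
    also have "\<dots> \<le> (1 + 1 / (p - 1)) * 1" by simp
    also have "\<dots> \<le> (1 + 1 / (p - 1)) * growth p x" using g assms by (intro mult_left_mono) auto
    finally show ?thesis .
  next
    case 3
    have "x powr (p - 1) * \<bar>ln x\<bar> \<le> (1 + x) powr (p - 1) * (1 + ln (1 + x))"
      using 3 assms by (intro mult_mono powr_mono2) (auto intro: order_trans[of _ "ln (1 + x)"])
    also have "\<dots> \<le> (1 + 1 / (p - 1)) * growth p x"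
      using g assms mult_right_mono[of 1 "1 + 1 / (p - 1)" "growth p x"] by (simp add: growth_def)
    finally show ?thesis .
  qed (use g assms in auto)
  then show ?thesis by (simp add: x_def)
qed

lemma power_log_tendsto_0:
  assumes "q > 0"
  shows "((\<lambda>h::real. \<bar>h\<bar> powr q * ln \<bar>h\<bar>) \<longlongrightarrow> 0) (at 0)"
proof -
  have "((\<lambda>t::real. t powr q * ln t) \<longlongrightarrow> 0) (at_right 0)" using assms by real_asymp
  moreover have "filterlim (\<lambda>h::real. \<bar>h\<bar>) (at_right 0) (at 0)"
    unfolding filterlim_at by (auto intro!: tendsto_rabs_zero simp: eventually_at_filter)
  ultimately show ?thesis by (rule filterlim_compose)
qed

text \<open>At 0 the difference quotient
  \<open>\<bar>h\<bar> powr (p - 1) * ln \<bar>h\<bar>\<close> tends to 0, and the right-hand side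
  is 0 because \<open>0 powr (p - 1) = 0\<close>. The mean value theorem may thus be used across
  0.\<close>

lemma log_source_deriv:
  assumes "p > 1"
  shows "(log_source p has_real_derivative \<bar>s\<bar> powr (p - 1) * (p * ln \<bar>s\<bar> + 1)) (at s)"
proof -
  have pos: "((\<lambda>s. s powr p * ln s) has_real_derivative s powr (p - 1) * (p * ln s + 1)) (at s)" if "s > 0" for s
  proof -
    have "((\<lambda>s. s powr p * ln s) has_real_derivative (p * s powr (p - 1)) * ln s + s powr p * (1 / s)) (at s)"
      using that by (auto intro!: derivative_eq_intros)
    moreover have "s powr p * (1 / s) = s powr (p - 1)"
      using that by (simp add: powr_diff)
    ultimately show ?thesis by (simp add: algebra_simps)
  qed
  have e: "log_source p s = s powr p * ln s" if "s > 0" for s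
    using that powr_mult_base[of s "p - 1"] by (simp add: log_source_def)
  consider "s > 0" | "s < 0" | "s = 0" by linarith
  then show ?thesis
  proof cases
    case 1
    show ?thesis
      by (rule has_field_derivative_transform_within_open[of "\<lambda>s. s powr p * ln s" _ _ "{0<..}"])
         (use pos[of s] 1 e in auto)
  next
    case 2
    have "((\<lambda>s. - ((- s) powr p * ln (- s))) has_real_derivative \<bar>s\<bar> powr (p - 1) * (p * ln \<bar>s\<bar> + 1)) (at s)"
      using DERIV_minus[OF DERIV_chain2[OF pos[of "- s"] DERIV_minus[OF DERIV_ident]]] 2 by simp
    then show ?thesis
    proof (rule has_field_derivative_transform_within_open[of _ _ _ "{..<0}"])
      show "- ((- t) powr p * ln (- t)) = log_source p t" if "t \<in> {..<0}" for t
        using that e[of "- t"] by (simp add: log_source_def)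
    qed (use 2 in auto)
  next
    case 3
    have "((\<lambda>h. \<bar>h\<bar> powr (p - 1) * ln \<bar>h\<bar>) \<longlongrightarrow> 0) (at (0::real))"
      using assms by (intro power_log_tendsto_0) auto
    moreover have "\<forall>\<^sub>F h in at 0. \<bar>h\<bar> powr (p - 1) * ln \<bar>h\<bar> = (log_source p (0 + h) - log_source p 0) / h"
      by (auto simp: eventually_at_filter log_source_def)
    ultimately have "((\<lambda>h. (log_source p (0 + h) - log_source p 0) / h) \<longlongrightarrow> 0) (at 0)"
      by (rule Lim_transform_eventually)
    then show ?thesis using 3 by (simp add: has_field_derivative_iff)
  qed
qed

lemma log_potential_deriv:
  assumes "p > 1"
  shows "(log_potential p has_real_derivative log_source p s) (at s)"
proof -
  have p: "1 + p \<noteq> 0" using assms by simp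
  have pos: "((\<lambda>s. s powr (1 + p) * ln s / (1 + p) - s powr (1 + p) / (1 + p)\<^sup>2) has_real_derivative s powr p * ln s) (at s)"
    if "s > 0" for s
  proof -
    have "((\<lambda>s. s powr (1 + p) * ln s / (1 + p) - s powr (1 + p) / (1 + p)\<^sup>2) has_real_derivative
        (((1 + p) * s powr p) * ln s + s powr (1 + p) * (1 / s)) / (1 + p) - ((1 + p) * s powr p) / (1 + p)\<^sup>2) (at s)"
    proof -
      have d: "((\<lambda>s. s powr (1 + p)) has_real_derivative (1 + p) * s powr p) (at s)"
        using that by (auto intro!: derivative_eq_intros)
      have "((\<lambda>s. s powr (1 + p) * ln s) has_real_derivative ((1 + p) * s powr p) * ln s + s powr (1 + p) * (1 / s)) (at s)"
        using DERIV_mult[OF d DERIV_ln_divide[OF that]] by (simp add: algebra_simps)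
      from DERIV_diff[OF DERIV_cdivide[OF this, of "1 + p"] DERIV_cdivide[OF d, of "(1 + p)\<^sup>2"]] show ?thesis .
    qed
    moreover have "s powr (1 + p) * (1 / s) = s powr p"
      using that by (simp add: powr_add)
    moreover have "(((1 + p) * s powr p) * ln s + s powr p) / (1 + p) - ((1 + p) * s powr p) / (1 + p)\<^sup>2 = s powr p * ln s"
      using p by (simp add: divide_simps power2_eq_square)
    ultimately show ?thesis by simp
  qed
  have e: "log_source p s = s powr p * ln s" if "s > 0" for s
    using that powr_mult_base[of s "p - 1"] by (simp add: log_source_def)
  consider "s > 0" | "s < 0" | "s = 0" by linarith
  then show ?thesis
  proof cases
    case 1
    show ?thesis
      by (rule has_field_derivative_transform_within_open[of "\<lambda>s. s powr (1 + p) * ln s / (1 + p) - s powr (1 + p) / (1 + p)\<^sup>2" _ _ "{0<..}"])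
         (use pos[of s] 1 e in \<open>auto simp: log_potential_def\<close>)
  next
    case 2
    have "((\<lambda>s. (- s) powr (1 + p) * ln (- s) / (1 + p) - (- s) powr (1 + p) / (1 + p)\<^sup>2) has_real_derivative log_source p s) (at s)"
      using DERIV_chain2[OF pos[of "- s"] DERIV_minus[OF DERIV_ident]] 2
        minus_equation_iff[of "s * (- s) powr (p - 1) * ln (- s)"] e[of "- s"]
      by (simp add: log_source_def)
    then show ?thesis
      by (rule has_field_derivative_transform_within_open[of _ _ _ "{..<0}"])
         (use 2 in \<open>auto simp: log_potential_def\<close>)
  next
    case 3
    have "((\<lambda>h. h * \<bar>h\<bar> powr (p - 1) * ln \<bar>h\<bar> / (1 + p) - h * \<bar>h\<bar> powr (p - 1) / (1 + p)\<^sup>2) \<longlongrightarrow>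
        0 * 0 / (1 + p) - 0 * \<bar>0\<bar> powr (p - 1) / (1 + p)\<^sup>2) (at (0::real))"
      unfolding mult.assoc using assms
      by (intro tendsto_diff tendsto_divide tendsto_mult power_log_tendsto_0 tendsto_const tendsto_ident_at
          tendsto_powr' tendsto_rabs) auto
    moreover have "\<forall>\<^sub>F h in at 0. h * \<bar>h\<bar> powr (p - 1) * ln \<bar>h\<bar> / (1 + p) - h * \<bar>h\<bar> powr (p - 1) / (1 + p)\<^sup>2
       = (log_potential p (0 + h) - log_potential p 0) / h"
    proof -
      have "log_potential p h = h * (h * \<bar>h\<bar> powr (p - 1) * ln \<bar>h\<bar> / (1 + p) - h * \<bar>h\<bar> powr (p - 1) / (1 + p)\<^sup>2)" for h
        unfolding log_potential_def powr_plus_one power2_eq_square[of h] by (simp add: right_diff_distrib mult_ac)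
      moreover have "log_potential p 0 = 0" by (simp add: log_potential_def)
      ultimately show ?thesis by (simp add: eventually_at_filter)
    qed
    ultimately have "((\<lambda>h. (log_potential p (0 + h) - log_potential p 0) / h) \<longlongrightarrow> 0) (at 0)"
      by (simp add: Lim_transform_eventually)
    then show ?thesis using 3 by (simp add: has_field_derivative_iff log_source_def)
  qed
qed

text \<open>The derivative of the source is \<open>p\<close> times the product estimated in
  \<open>power_log_le_growth\<close>, plus a pure power; each contributes one summand.\<close>

definition log_const :: "real \<Rightarrow> real" where
  "log_const p = p * (1 + 1 / (p - 1)) + 1"

lemma log_const_ge_1: "p > 1 \<Longrightarrow> 1 \<le> log_const p"
  by (simp add: log_const_def)

lemma growth_between:
  assumes "p > 1" "\<bar>x\<bar> \<le> max \<bar>a\<bar> \<bar>b\<bar>"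
  shows "growth p \<bar>x\<bar> \<le> growth p \<bar>a\<bar> + growth p \<bar>b\<bar>"
proof -
  have "growth p \<bar>x\<bar> \<le> growth p (max \<bar>a\<bar> \<bar>b\<bar>)" using assms by (intro growth_mono) auto
  also have "\<dots> \<le> growth p \<bar>a\<bar> + growth p \<bar>b\<bar>"
    using growth_ge_1[OF assms(1), of "\<bar>a\<bar>"] growth_ge_1[OF assms(1), of "\<bar>b\<bar>"] by (auto simp: max_def)
  finally show ?thesis .
qed

lemma log_source_Lipschitz:
  assumes "p > 1"
  shows "\<bar>log_source p a - log_source p b\<bar> \<le> log_const p * (growth p \<bar>a\<bar> + growth p \<bar>b\<bar>) * \<bar>a - b\<bar>"
proof -
  have main: "\<bar>log_source p b - log_source p a\<bar> \<le> log_const p * (growth p \<bar>a\<bar> + growth p \<bar>b\<bar>) * \<bar>b - a\<bar>"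
    if ab: "a < b" for a b
  proof -
    obtain z where z: "a < z" "z < b"
      "log_source p b - log_source p a = (b - a) * (\<bar>z\<bar> powr (p - 1) * (p * ln \<bar>z\<bar> + 1))"
      using MVT2[OF ab, of "log_source p" "\<lambda>z. \<bar>z\<bar> powr (p - 1) * (p * ln \<bar>z\<bar> + 1)"] log_source_deriv[OF assms]
      by blast
    have "\<bar>\<bar>z\<bar> powr (p - 1) * (p * ln \<bar>z\<bar> + 1)\<bar> \<le> p * (\<bar>z\<bar> powr (p - 1) * \<bar>ln \<bar>z\<bar>\<bar>) + \<bar>z\<bar> powr (p - 1)"
    proof -
      have "\<bar>p * ln \<bar>z\<bar> + 1\<bar> \<le> p * \<bar>ln \<bar>z\<bar>\<bar> + 1"
        using assms abs_triangle_ineq[of "p * ln \<bar>z\<bar>" 1] by (simp add: abs_mult)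
      from mult_left_mono[OF this, of "\<bar>z\<bar> powr (p - 1)"] show ?thesis
        unfolding abs_mult[of "\<bar>z\<bar> powr (p - 1)"] by (simp add: distrib_left mult_ac)
    qed
    also have "\<dots> \<le> p * ((1 + 1 / (p - 1)) * growth p \<bar>z\<bar>) + growth p \<bar>z\<bar>"
      using assms by (intro add_mono mult_left_mono power_log_le_growth power_le_growth) auto
    also have "\<dots> = log_const p * growth p \<bar>z\<bar>" by (simp add: log_const_def algebra_simps)
    also have "\<dots> \<le> log_const p * (growth p \<bar>a\<bar> + growth p \<bar>b\<bar>)"
      using z log_const_ge_1[OF assms] by (intro mult_left_mono growth_between assms) auto
    finally show ?thesis unfolding z(3) abs_mult using that
      by (simp add: mult.commute mult_left_mono)
  qed
  consider "a < b" | "b < a" | "a = b" by linarith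
  then show ?thesis using main[of a b] main[of b a] by cases (auto simp: abs_minus_commute add.commute)
qed

lemma log_source_0: "log_source p 0 = 0"
  by (simp add: log_source_def)

lemma log_source_bound:
  assumes "p > 1"
  shows "\<bar>log_source p s\<bar> \<le> 2 * log_const p * growth p \<bar>s\<bar> * \<bar>s\<bar>"
proof -
  have "\<bar>log_source p s\<bar> \<le> log_const p * (growth p \<bar>s\<bar> + growth p 0) * \<bar>s\<bar>"
    using log_source_Lipschitz[OF assms, of s 0] by (simp add: log_source_0)
  also have "\<dots> \<le> log_const p * (2 * growth p \<bar>s\<bar>) * \<bar>s\<bar>"
    using log_const_ge_1[OF assms] growth_mono[OF assms, of 0 "\<bar>s\<bar>"]
    by (intro mult_right_mono mult_left_mono) auto
  finally show ?thesis by simp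
qed

text \<open>The mean value theorem for the potential, followed by the Lipschitz estimate of the
  source at the intermediate point. The factor 2 arises because \<open>growth\<close> at that point
  is estimated by the values at both ends.\<close>

lemma log_potential_Taylor:
  assumes "p > 1"
  shows "\<bar>log_potential p b - log_potential p a - log_source p a * (b - a)\<bar>
      \<le> 2 * log_const p * (growth p \<bar>a\<bar> + growth p \<bar>b\<bar>) * (b - a)\<^sup>2"
proof -
  have "\<exists>z. \<bar>z\<bar> \<le> max \<bar>a\<bar> \<bar>b\<bar> \<and> \<bar>z - a\<bar> \<le> \<bar>b - a\<bar> \<and> log_potential p b - log_potential p a = (b - a) * log_source p z"
  proof -
    consider "a < b" | "b < a" | "a = b" by linarith
    then show ?thesis
    proof cases
      case 1
      from MVT2[OF 1, of "log_potential p" "log_source p"] log_potential_deriv[OF assms] obtain z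
        where "a < z" "z < b" "log_potential p b - log_potential p a = (b - a) * log_source p z" by blast
      then show ?thesis by (intro exI[of _ z]) auto
    next
      case 2
      from MVT2[OF 2, of "log_potential p" "log_source p"] log_potential_deriv[OF assms] obtain z
        where "b < z" "z < a" "log_potential p a - log_potential p b = (a - b) * log_source p z" by blast
      then show ?thesis by (intro exI[of _ z]) (auto simp: algebra_simps)
    qed (intro exI[of _ a], auto)
  qed
  then obtain z where z: "\<bar>z\<bar> \<le> max \<bar>a\<bar> \<bar>b\<bar>" "\<bar>z - a\<bar> \<le> \<bar>b - a\<bar>"
    "log_potential p b - log_potential p a = (b - a) * log_source p z" by blast
  have "\<bar>log_potential p b - log_potential p a - log_source p a * (b - a)\<bar> = \<bar>b - a\<bar> * \<bar>log_source p z - log_source p a\<bar>"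
    unfolding z(3) by (simp add: abs_mult[symmetric] algebra_simps)
  also have "\<dots> \<le> \<bar>b - a\<bar> * (log_const p * (growth p \<bar>z\<bar> + growth p \<bar>a\<bar>) * \<bar>z - a\<bar>)"
    by (intro mult_left_mono log_source_Lipschitz assms) auto
  also have "\<dots> \<le> \<bar>b - a\<bar> * (log_const p * (2 * (growth p \<bar>a\<bar> + growth p \<bar>b\<bar>)) * \<bar>b - a\<bar>)"
    using z growth_between[OF assms z(1)] growth_ge_1[OF assms, of "\<bar>a\<bar>"] growth_ge_1[OF assms, of "\<bar>b\<bar>"]
      growth_ge_1[OF assms, of "\<bar>z\<bar>"] log_const_ge_1[OF assms]
    by (intro mult_left_mono mult_mono) auto
  also have "\<dots> = 2 * log_const p * (growth p \<bar>a\<bar> + growth p \<bar>b\<bar>) * \<bar>b - a\<bar>\<^sup>2"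
    unfolding power2_eq_square by (simp only: mult_ac)
  finally show ?thesis by simp
qed

text \<open>On \<open>{0<..1}\<close> one has \<open>- ln x \<le> 1 / x\<close> and
  \<open>x powr (1 + p) \<le> x\<close>. The bound makes shifted logarithmic integrands nonnegative,
  as needed for splitting them.\<close>

lemma log_energy_lower:
  fixes s p :: real
  assumes "p > 1"
  shows "- 1 \<le> \<bar>s\<bar> powr (1 + p) * ln \<bar>s\<bar>"
proof -
  define x where "x = \<bar>s\<bar>"
  have "x \<ge> 0" by (simp add: x_def)
  then consider "x = 0" | "0 < x" "x \<le> 1" | "1 < x" by linarith
  then have "- 1 \<le> x powr (1 + p) * ln x"
  proof cases
    case 2
    have "ln (1 / x) \<le> 1 / x - 1" using 2 by (intro ln_le_minus_one) auto
    then have "- ln x \<le> 1 / x" using 2 by (simp add: ln_div)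
    moreover have "x powr (1 + p) \<le> x powr 1" using 2 assms by (intro powr_mono') auto
    ultimately have "x powr (1 + p) * (- ln x) \<le> x * (1 / x)"
      using 2 by (intro mult_mono) auto
    then show ?thesis using 2 by simp
  next
    case 3
    then have "0 \<le> x powr (1 + p) * ln x" by (intro mult_nonneg_nonneg) auto
    then show ?thesis by simp
  qed auto
  then show ?thesis by (simp add: x_def)
qed

text \<open>Converts a bound of the logarithmic integral into one of the integral of
  \<open>growth\<close>. Beyond \<open>exp 1\<close> the logarithm is at least 1, so
  \<open>1 + ln (1 + x) \<le> 3 * ln x\<close>; below, the left side is bounded and the shift by 2
  keeps the bracket at least 1.\<close>

lemma growth_le_log_energy:
  assumes "p > 1"
  obtains A where "A > 0" "\<And>s. growth p \<bar>s\<bar> * s\<^sup>2 \<le> A * (\<bar>s\<bar> powr (1 + p) * ln \<bar>s\<bar> + 2)"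
proof
  let ?A = "3 * 2 powr (p - 1) + growth p (exp 1) * (exp 1)\<^sup>2"
  have g: "1 \<le> growth p (exp 1)" by (rule growth_ge_1[OF assms]) simp
  show "?A > 0" using g by (intro add_pos_nonneg) auto
  fix s :: real
  define x where "x = \<bar>s\<bar>"
  have x0: "x \<ge> 0" by (simp add: x_def)
  let ?E = "x powr (1 + p) * ln x + 2"
  have E: "1 \<le> ?E" using log_energy_lower[OF assms, of s] by (simp add: x_def)
  have "growth p x * x\<^sup>2 \<le> ?A * ?E"
  proof (cases "x \<le> exp 1")
    case True
    have "growth p x * x\<^sup>2 \<le> (growth p (exp 1) * (exp 1)\<^sup>2) * 1"
      unfolding mult_1_right
      using True x0 g by (intro mult_mono growth_mono[OF assms] power_mono) auto
    also have "\<dots> \<le> ?A * ?E"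
      using E g by (intro mult_mono) auto
    finally show ?thesis .
  next
    case False
    then have x1: "exp 1 < x" by simp
    have "(1::real) \<le> exp 1" by simp
    with x1 have "1 < x" by linarith
    have l: "1 \<le> ln x" using x1 \<open>1 < x\<close> by (subst ln_ge_iff) auto
    have "ln (1 + x) \<le> ln (2 * x)" using \<open>1 < x\<close> by simp
    also have "\<dots> = ln 2 + ln x" using \<open>1 < x\<close> by (simp add: ln_mult)
    finally have "1 + ln (1 + x) \<le> 3 * ln x" using l ln_le_minus_one[of 2] by simp
    moreover have "(1 + x) powr (p - 1) \<le> (2 * x) powr (p - 1)"
      using \<open>1 < x\<close> assms by (intro powr_mono2) auto
    ultimately have "growth p x \<le> (2 * x) powr (p - 1) * (3 * ln x)"
      unfolding growth_def using \<open>1 < x\<close> by (intro mult_mono) auto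
    then have "growth p x * x\<^sup>2 \<le> (2 * x) powr (p - 1) * (3 * ln x) * x\<^sup>2"
      by (intro mult_right_mono) auto
    also have "\<dots> = 3 * 2 powr (p - 1) * (x powr (1 + p) * ln x)"
      using \<open>1 < x\<close> powr_plus_one[of x p] by (simp add: powr_mult)
    also have "\<dots> \<le> ?A * ?E" using E g l by (intro mult_mono) auto
    finally show ?thesis .
  qed
  then show "growth p \<bar>s\<bar> * s\<^sup>2 \<le> ?A * (\<bar>s\<bar> powr (1 + p) * ln \<bar>s\<bar> + 2)"
    by (simp add: x_def)
qed

text \<open>Above the level \<open>K\<close> the logarithm is at least \<open>ln K\<close>. A large
  \<open>K\<close> makes the coefficient of the logarithmic integrand as small as desired, at the
  price of a large multiple of the square.\<close>

lemma power_le_split: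
  fixes s p K :: real
  assumes "p > 1" "K > 1"
  shows "\<bar>s\<bar> powr (1 + p) \<le> K powr (p - 1) * s\<^sup>2 + (\<bar>s\<bar> powr (1 + p) * ln \<bar>s\<bar> + 1) / ln K"
proof -
  have lK: "ln K > 0" using assms by simp
  have E: "0 \<le> (\<bar>s\<bar> powr (1 + p) * ln \<bar>s\<bar> + 1) / ln K" using log_energy_lower[OF assms(1), of s] lK by simp
  show ?thesis
  proof (cases "\<bar>s\<bar> \<le> K")
    case True
    have "\<bar>s\<bar> powr (1 + p) \<le> K powr (p - 1) * s\<^sup>2"
      unfolding powr_plus_one using True assms by (intro mult_right_mono powr_mono2) auto
    then show ?thesis using E by simp
  next
    case False
    then have "ln K \<le> ln \<bar>s\<bar>" using assms by simp
    then have "\<bar>s\<bar> powr (1 + p) * ln K \<le> \<bar>s\<bar> powr (1 + p) * ln \<bar>s\<bar> + 1"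
      by (intro add_increasing2 mult_left_mono) auto
    then have "\<bar>s\<bar> powr (1 + p) \<le> (\<bar>s\<bar> powr (1 + p) * ln \<bar>s\<bar> + 1) / ln K"
      using lK by (simp add: field_simps)
    then show ?thesis by (simp add: add_increasing)
  qed
qed

lemma growth_measurable [measurable]: "growth p \<in> borel_measurable borel"
  unfolding growth_def[abs_def] by measurable

lemma log_source_measurable [measurable]: "log_source p \<in> borel_measurable borel"
  unfolding log_source_def[abs_def] by measurable

lemma log_potential_measurable [measurable]: "log_potential p \<in> borel_measurable borel"
  unfolding log_potential_def[abs_def] by measurable

lemma dominated_integrable:
  fixes f h :: "'a \<Rightarrow> real"
  assumes "integrable M h" "f \<in> borel_measurable M" "AE x in M. \<bar>f x\<bar> \<le> h x"
  shows "integrable M f" "\<bar>integral\<^sup>L M f\<bar> \<le> integral\<^sup>L M h"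
proof -
  show f: "integrable M f"
    by (rule Bochner_Integration.integrable_bound[OF assms(1,2)])
       (use assms(3) in \<open>auto elim!: eventually_mono\<close>)
  have "\<bar>integral\<^sup>L M f\<bar> \<le> (LINT x|M. \<bar>f x\<bar>)"
    by (rule integral_abs_bound)
  also have "\<dots> \<le> integral\<^sup>L M h"
    by (rule integral_mono_AE) (use f assms in auto)
  finally show "\<bar>integral\<^sup>L M f\<bar> \<le> integral\<^sup>L M h" .
qed

section \<open>The functionals\<close>

definition log_energy :: "real \<Rightarrow> 'a::euclidean_space set \<Rightarrow> ('a \<Rightarrow> real) \<Rightarrow> real" where
  "log_energy p U w = (LINT x|lebesgue_on U. \<bar>w x\<bar> powr (1 + p) * ln \<bar>w x\<bar>)"

definition power_energy :: "real \<Rightarrow> 'a::euclidean_space set \<Rightarrow> ('a \<Rightarrow> real) \<Rightarrow> real" where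
  "power_energy p U w = (LINT x|lebesgue_on U. \<bar>w x\<bar> powr (1 + p))"

text \<open>A guard against the default value 0 of the integral of a nonintegrable function: the
  scaling laws below are used only where both integrals exist.\<close>

definition energy_finite :: "real \<Rightarrow> 'a::euclidean_space set \<Rightarrow> ('a \<Rightarrow> real) \<Rightarrow> bool" where
  "energy_finite p U w \<longleftrightarrow>
     integrable (lebesgue_on U) (\<lambda>x. \<bar>w x\<bar> powr (1 + p) * ln \<bar>w x\<bar>) \<and>
     integrable (lebesgue_on U) (\<lambda>x. \<bar>w x\<bar> powr (1 + p))"

lemma power_energy_nonneg: "0 \<le> power_energy p U w"
  by (simp add: power_energy_def)

lemma nehari_I_eq: "nehari_I p U w = (gnorm U w)\<^sup>2 - log_energy p U w"
  by (simp add: nehari_I_def gnorm_def log_energy_def)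

lemma energy_J_eq:
  assumes "p > 1"
  shows "energy_J p U w = (gnorm U w)\<^sup>2 / 2 - log_energy p U w / (1 + p) + power_energy p U w / (1 + p)\<^sup>2"
proof -
  have "(Lnorm U (1 + p) w) powr (1 + p) = power_energy p U w"
    using assms power_energy_nonneg[of p U w] by (simp add: Lnorm_def powr_powr power_energy_def)
  then show ?thesis by (simp add: energy_J_def gnorm_def log_energy_def)
qed

text \<open>Eliminates the logarithmic integral. Where \<open>I \<ge> 0\<close> all three terms are
  nonnegative, and on the Nehari manifold only gradient and power energy remain.\<close>

lemma energy_J_via_I:
  assumes "p > 1"
  shows "energy_J p U w = nehari_I p U w / (1 + p) + (p - 1) / (2 * (1 + p)) * (gnorm U w)\<^sup>2 + power_energy p U w / (1 + p)\<^sup>2"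
proof -
  have "(gnorm U w)\<^sup>2 / 2 = (gnorm U w)\<^sup>2 / (1 + p) + (p - 1) / (2 * (1 + p)) * (gnorm U w)\<^sup>2"
  proof -
    have "1 / 2 = 1 / (1 + p) + (p - 1) / (2 * (1 + p))" using assms by (simp add: divide_simps) (simp add: algebra_simps)
    from arg_cong[OF this, of "\<lambda>z. (gnorm U w)\<^sup>2 * z"] show ?thesis
      by (simp add: distrib_left mult.commute)
  qed
  then show ?thesis by (simp add: energy_J_eq[OF assms] nehari_I_eq diff_divide_distrib)
qed

lemma energy_J_nonneg:
  assumes "p > 1" "nehari_I p U w \<ge> 0"
  shows "0 \<le> energy_J p U w"
  unfolding energy_J_via_I[OF assms(1)] using assms power_energy_nonneg[of p U w]
  by (intro add_nonneg_nonneg mult_nonneg_nonneg divide_nonneg_nonneg) auto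

lemma powr_log_scale:
  fixes t w p :: real
  assumes "t > 0"
  shows "\<bar>t * w\<bar> powr (1 + p) = t powr (1 + p) * \<bar>w\<bar> powr (1 + p)"
    "\<bar>t * w\<bar> powr (1 + p) * ln \<bar>t * w\<bar> = t powr (1 + p) * (\<bar>w\<bar> powr (1 + p) * ln \<bar>w\<bar> + ln t * \<bar>w\<bar> powr (1 + p))"
proof -
  show e: "\<bar>t * w\<bar> powr (1 + p) = t powr (1 + p) * \<bar>w\<bar> powr (1 + p)"
    using assms by (simp add: abs_mult powr_mult)
  show "\<bar>t * w\<bar> powr (1 + p) * ln \<bar>t * w\<bar> = t powr (1 + p) * (\<bar>w\<bar> powr (1 + p) * ln \<bar>w\<bar> + ln t * \<bar>w\<bar> powr (1 + p))"
    unfolding e using assms by (cases "w = 0") (auto simp: abs_mult ln_mult algebra_simps)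
qed

lemma energy_finite_scale:
  assumes "t > 0" "energy_finite p U w"
  shows "energy_finite p U (\<lambda>x. t * w x)"
    "power_energy p U (\<lambda>x. t * w x) = t powr (1 + p) * power_energy p U w"
    "log_energy p U (\<lambda>x. t * w x) = t powr (1 + p) * (log_energy p U w + ln t * power_energy p U w)"
  using assms unfolding energy_finite_def power_energy_def log_energy_def powr_log_scale(2)[OF assms(1)]
  unfolding powr_log_scale(1)[OF assms(1)] by auto

context bounded_open_set
begin

lemma gnorm_scale: "u \<in> H01 U \<Longrightarrow> gnorm U (\<lambda>x. c * u x) = \<bar>c\<bar> * gnorm U u"
  using H1s.nrm_scale[OF H01_H1] by (simp add: H1s_nrm)

lemma gnorm_AE_0:
  assumes "u \<in> H1 U" "AE x in lebesgue_on U. u x = 0"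
  shows "gnorm U u = 0"
proof -
  have "has_weak_gradient U u (\<lambda>x. 0)"
    unfolding has_weak_gradient_def
  proof (intro conjI ballI)
    fix \<phi> and b :: 'a
    have "(LINT x|lebesgue_on U. u x * frechet_derivative \<phi> (at x) b) = 0"
      by (rule integral_eq_zero_AE) (use assms(2) in \<open>auto elim!: eventually_mono\<close>)
    then show "(LINT x|lebesgue_on U. u x * frechet_derivative \<phi> (at x) b) = - (LINT x|lebesgue_on U. (0 \<bullet> b) * \<phi> x)"
      by simp
  qed (simp add: L2_def)
  from dirichlet_eq[OF this assms(1) assms(1)] show ?thesis
    by (simp add: gnorm_sqrt L2_inner_def)
qed

text \<open>By Poincare's inequality the gradient seminorm is definite on \<open>H01\<close> up to
  null sets; this settles the cases in which one cannot divide by it.\<close>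

lemma gnorm_0_AE:
  assumes "u \<in> H01 U" "gnorm U u = 0"
  shows "AE x in lebesgue_on U. u x = 0"
proof -
  obtain C where "C > 0" "Lnorm U 2 u \<le> C * gnorm U u" using Poincare assms(1) by metis
  with assms(2) have "(Lnorm U 2 u)\<^sup>2 = 0" by (simp add: Lnorm_2 L2_inner_self_nonneg order_antisym)
  then have "(LINT x|lebesgue_on U. u x * u x) = 0"
    by (simp add: Lnorm_2_sq L2_inner_def)
  moreover have "integrable (lebesgue_on U) (\<lambda>x. u x * u x)"
    using L2_inner_integrable[OF H01_L2 H01_L2, OF assms(1) assms(1)] by simp
  ultimately show ?thesis
    by (subst (asm) integral_nonneg_eq_0_iff_AE) auto
qed

lemma energy_finite_bounded:
  assumes "w \<in> borel_measurable (lebesgue_on U)" "\<And>x. \<bar>w x\<bar> \<le> C" "p > 1"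
  shows "energy_finite p U w"
  unfolding energy_finite_def
proof
  have C: "0 \<le> C" using assms(2)[of undefined] by linarith
  show "integrable (lebesgue_on U) (\<lambda>x. \<bar>w x\<bar> powr (1 + p))"
    by (rule bounded_integrable[of _ "C powr (1 + p)"]) (use assms in \<open>auto intro!: powr_mono2\<close>)
  have "\<bar>\<bar>w x\<bar> powr (1 + p) * ln \<bar>w x\<bar>\<bar> \<le> 2 * log_const p * growth p C * C * C" for x
  proof -
    have "\<bar>\<bar>w x\<bar> powr (1 + p) * ln \<bar>w x\<bar>\<bar> = \<bar>log_source p (w x)\<bar> * \<bar>w x\<bar>"
      by (simp flip: log_source_mult add: abs_mult)
    also have "\<dots> \<le> (2 * log_const p * growth p \<bar>w x\<bar> * \<bar>w x\<bar>) * \<bar>w x\<bar>"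
      by (intro mult_right_mono log_source_bound assms) auto
    also have "\<dots> \<le> (2 * log_const p * growth p C * C) * C"
      using assms(2)[of x] C log_const_ge_1[OF assms(3)] growth_ge_1[OF assms(3)]
      by (intro mult_mono growth_mono assms(3) mult_nonneg_nonneg order_trans[OF zero_le_one growth_ge_1[OF assms(3)]]) auto
    finally show ?thesis .
  qed
  then show "integrable (lebesgue_on U) (\<lambda>x. \<bar>w x\<bar> powr (1 + p) * ln \<bar>w x\<bar>)"
    by (intro bounded_integrable) (use assms(1) in auto)
qed

lemma test_energy_finite:
  assumes "p > 1" "\<phi> \<in> test_functions U"
  shows "energy_finite p U \<phi>"
proof -
  obtain C where "C > 0" "\<And>x. \<bar>\<phi> x\<bar> \<le> C" using test_bounded[OF assms(2)] by blast
  then show ?thesis using energy_finite_bounded[OF test_measurable_on[OF assms(2)] _ assms(1)] by blast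
qed

section \<open>Scaling onto the Nehari manifold\<close>

text \<open>Taking out \<open>t\<^sup>2\<close> leaves a bracket that is continuous for
  \<open>t > 0\<close> and, since \<open>p > 1\<close>, tends to \<open>(gnorm U u)\<^sup>2\<close>
  as \<open>t\<close> tends to 0. Its zeros are the points sought on the ray through
  \<open>u\<close>.\<close>

lemma nehari_I_scale:
  assumes "t > 0" "energy_finite p U u" "u \<in> H01 U"
  shows "nehari_I p U (\<lambda>x. t * u x) =
    t\<^sup>2 * ((gnorm U u)\<^sup>2 - t powr (p - 1) * (log_energy p U u + ln t * power_energy p U u))"
proof -
  have "t powr (1 + p) = t powr (p - 1) * t\<^sup>2" using powr_plus_one[of t p] assms(1) by simp
  then show ?thesis
    unfolding nehari_I_eq energy_finite_scale(3)[OF assms(1,2)] gnorm_scale[OF assms(3)]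
    using assms(1) by (simp add: power_mult_distrib right_diff_distrib mult_ac)
qed

lemma nehari_scaleI:
  assumes "t > 0" "energy_finite p U u" "u \<in> H01 U" "gnorm U u \<noteq> 0"
    and "(gnorm U u)\<^sup>2 - t powr (p - 1) * (log_energy p U u + ln t * power_energy p U u) = 0"
  shows "(\<lambda>x. t * u x) \<in> nehari p U"
  unfolding nehari_def mem_Collect_eq gnorm_def[symmetric]
  using nehari_I_scale[OF assms(1-3)] assms gnorm_scale[OF assms(3)] by (simp add: H01_scale)

text \<open>The bracket is negative at 1 and positive near 0, because \<open>t powr (p - 1)\<close>
  beats \<open>ln t\<close> and the gradient cannot vanish; the intermediate value theorem does the
  rest.\<close>

lemma nehari_scale_down:
  assumes p: "p > 1" and u: "u \<in> H01 U" "energy_finite p U u" and I: "nehari_I p U u < 0"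
  obtains t where "0 < t" "t < 1" "(\<lambda>x. t * u x) \<in> nehari p U" "gnorm U (\<lambda>x. t * u x) \<le> gnorm U u"
proof -
  define h where "h t = (gnorm U u)\<^sup>2 - t powr (p - 1) * (log_energy p U u + ln t * power_energy p U u)" for t
  have g: "gnorm U u \<noteq> 0"
  proof
    assume g: "gnorm U u = 0"
    have "log_energy p U u = 0"
      unfolding log_energy_def
      by (rule integral_eq_zero_AE) (use gnorm_0_AE[OF u(1) g] in \<open>auto elim!: eventually_mono\<close>)
    with I g show False by (simp add: nehari_I_eq)
  qed
  have "(h \<longlongrightarrow> (gnorm U u)\<^sup>2 - (0 * log_energy p U u + 0 * power_energy p U u)) (at_right 0)"
  proof -
    have 1: "((\<lambda>t::real. t powr (p - 1)) \<longlongrightarrow> 0) (at_right 0)" using p by real_asymp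
    have 2: "((\<lambda>t::real. t powr (p - 1) * ln t) \<longlongrightarrow> 0) (at_right 0)" using p by real_asymp
    have "h = (\<lambda>t. (gnorm U u)\<^sup>2 - (t powr (p - 1) * log_energy p U u + (t powr (p - 1) * ln t) * power_energy p U u))"
      by (simp add: h_def fun_eq_iff algebra_simps)
    then show ?thesis by (simp only:) (intro tendsto_intros 1 2)
  qed
  then have "(h \<longlongrightarrow> (gnorm U u)\<^sup>2) (at_right 0)" by simp
  moreover have "0 < (gnorm U u)\<^sup>2" using g by simp
  ultimately have "\<forall>\<^sub>F t in at_right 0. 0 < h t"
    by (rule order_tendstoD)
  moreover have "\<forall>\<^sub>F t in at_right (0::real). t < 1 \<and> 0 < t"
    by (auto simp: eventually_at_right_field intro!: exI[of _ 1])
  ultimately have "\<forall>\<^sub>F t in at_right 0. 0 < h t \<and> t < 1 \<and> 0 < t"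
    by (rule eventually_conj)
  then obtain t0 where t0: "0 < h t0" "t0 < 1" "0 < t0"
    using eventually_happens'[OF trivial_limit_at_right_real] by blast
  have h1: "h 1 < 0" using I by (simp add: h_def nehari_I_eq)
  have "continuous_on {t0..1} h"
    unfolding h_def using t0 by (intro continuous_intros) auto
  then obtain t where t: "t0 \<le> t" "t \<le> 1" "h t = 0"
    using IVT2'[of h 1 0 t0] t0 h1 by auto
  show ?thesis
  proof (rule that[of t])
    show "0 < t" using t t0 by simp
    show "t < 1" using t h1 by (cases "t = 1") auto
    show "(\<lambda>x. t * u x) \<in> nehari p U"
      by (rule nehari_scaleI) (use t t0 u g in \<open>auto simp: h_def\<close>)
    show "gnorm U (\<lambda>x. t * u x) \<le> gnorm U u"
      unfolding gnorm_scale[OF u(1)] using t t0 gnorm_nonneg[of U u] by (intro mult_left_le_one_le) auto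
  qed
qed

lemma nehari_scale_up:
  assumes p: "p > 1" and u: "u \<in> H01 U" "energy_finite p U u" and I: "0 \<le> nehari_I p U u" and g: "gnorm U u \<noteq> 0"
  obtains t where "1 \<le> t" "(\<lambda>x. t * u x) \<in> nehari p U"
    "(gnorm U u)\<^sup>2 = t powr (p - 1) * (log_energy p U u + ln t * power_energy p U u)"
proof -
  define h where "h t = (gnorm U u)\<^sup>2 - t powr (p - 1) * (log_energy p U u + ln t * power_energy p U u)" for t
  let ?a = "(gnorm U u)\<^sup>2"
  have a: "?a > 0" using g by simp
  have C: "power_energy p U u > 0"
  proof (rule ccontr)
    assume "\<not> power_energy p U u > 0"
    then have "power_energy p U u = 0" using power_energy_nonneg[of p U u] by linarith
    then have "(LINT x|lebesgue_on U. \<bar>u x\<bar> powr (1 + p)) = 0" by (simp add: power_energy_def)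
    then have "AE x in lebesgue_on U. \<bar>u x\<bar> powr (1 + p) = 0"
      using u(2) by (subst (asm) integral_nonneg_eq_0_iff_AE) (auto simp: energy_finite_def)
    then have "AE x in lebesgue_on U. u x = 0" by simp
    from gnorm_AE_0[OF H01_H1[OF u(1)] this] g show False by simp
  qed
  \<comment> \<open>The exponent makes \<open>log_energy p U u + ln T * power_energy p U u\<close>
    at least the squared gradient norm; the maximum with 0 gives \<open>T \<ge> 1\<close>, so the
    factor \<open>T powr (p - 1)\<close> only helps.\<close>
  define T where "T = exp (max 0 ((?a - log_energy p U u) / power_energy p U u))"
  have T1: "1 \<le> T" by (simp add: T_def)
  have "(?a - log_energy p U u) / power_energy p U u \<le> ln T" by (simp add: T_def)
  then have "?a \<le> log_energy p U u + ln T * power_energy p U u"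
    using C by (simp add: field_simps)
  then have "1 * ?a \<le> T powr (p - 1) * (log_energy p U u + ln T * power_energy p U u)"
    using T1 p a by (intro mult_mono ge_one_powr_ge_zero) auto
  then have hT: "h T \<le> 0" by (simp add: h_def)
  have h1: "0 \<le> h 1" using I by (simp add: h_def nehari_I_eq)
  have "continuous_on {1..T} h"
    unfolding h_def by (intro continuous_intros) auto
  then obtain t where t: "1 \<le> t" "t \<le> T" "h t = 0"
    using IVT2'[of h T 0 1] T1 h1 hT by auto
  show ?thesis
  proof (rule that[of t])
    show "(\<lambda>x. t * u x) \<in> nehari p U"
      by (rule nehari_scaleI) (use t u g in \<open>auto simp: h_def\<close>)
  qed (use t in \<open>auto simp: h_def\<close>)
qed

lemma power_energy_split:
  assumes "p > 1" "K > 1" "u \<in> L2 U" "energy_finite p U u"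
  shows "power_energy p U u \<le> K powr (p - 1) * (Lnorm U 2 u)\<^sup>2 + (log_energy p U u + measure (lebesgue_on U) U) / ln K"
proof -
  have i: "integrable (lebesgue_on U) (\<lambda>x. (u x)\<^sup>2)" using assms(3) by (simp add: L2_def)
  have n: "(LINT x|lebesgue_on U. (u x)\<^sup>2) = (Lnorm U 2 u)\<^sup>2"
    unfolding Lnorm_2_sq L2_inner_def by (simp add: power2_eq_square)
  have m: "(LINT x|lebesgue_on U. 1) = measure (lebesgue_on U) U" by simp
  note e = assms(4)[unfolded energy_finite_def]
  have "power_energy p U u \<le>
    (LINT x|lebesgue_on U. K powr (p - 1) * (u x)\<^sup>2 + (\<bar>u x\<bar> powr (1 + p) * ln \<bar>u x\<bar> + 1) / ln K)"
    unfolding power_energy_def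
    by (rule integral_mono) (use e i power_le_split[OF assms(1,2)] in auto)
  also have "\<dots> = K powr (p - 1) * (Lnorm U 2 u)\<^sup>2 + (log_energy p U u + measure (lebesgue_on U) U) / ln K"
    using e i m by (simp add: n log_energy_def)
  finally show ?thesis .
qed

end

text \<open>A positive lower bound \<open>d\<close> of the energy on the Nehari manifold takes the place of a
  Sobolev embedding and of an upper bound on \<open>p\<close>.\<close>

locale positive_well = bounded_open_set U for U :: "'a::euclidean_space set" +
  fixes p d :: real
  assumes p: "p > 1" and d: "d > 0" and well: "\<And>w. w \<in> nehari p U \<Longrightarrow> d \<le> energy_J p U w"
begin

section \<open>Consequences of a positive depth\<close>

text \<open>At the scaled-down point \<open>g\<close> the identity \<open>I g = 0\<close> equates
  the logarithmic integral with the squared gradient norm. Then \<open>J g\<close> consists of a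
  small gradient term and the power energy, which \<open>power_energy_split\<close> controls; the
  sum stays below \<open>d\<close>.\<close>

lemma nehari_I_small:
  obtains \<delta> where "0 < \<delta>"
    "\<And>u. u \<in> H01 U \<Longrightarrow> energy_finite p U u \<Longrightarrow> gnorm U u \<le> \<delta> \<Longrightarrow> 0 \<le> nehari_I p U u"
proof -
  obtain P where P: "P > 0" "\<And>u. u \<in> H01 U \<Longrightarrow> Lnorm U 2 u \<le> P * gnorm U u" using Poincare by blast
  define m where "m = measure (lebesgue_on U) U"
  have m: "0 \<le> m" by (simp add: m_def)
  \<comment> \<open>Makes \<open>(1 + m) / ln K\<close> equal to \<open>d / 4\<close>.\<close>
  define K where "K = exp (4 * (1 + m) / d)"
  have K: "K > 1" using d m by (simp add: K_def)
  have lK: "ln K = 4 * (1 + m) / d" by (simp add: K_def)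
  \<comment> \<open>The coefficient of \<open>\<delta>\<^sup>2\<close>: one half from the gradient
    term, the rest from the square in \<open>power_energy_split\<close> by way of Poincare's
    inequality.\<close>
  define Q where "Q = 1 / 2 + K powr (p - 1) * P\<^sup>2"
  have Q: "Q > 0" by (simp add: Q_def add_pos_nonneg)
  \<comment> \<open>Makes \<open>\<delta>\<^sup>2 * Q \<le> d / 4\<close>, so that
    \<open>J g \<le> d / 2\<close>; the bound by 1 keeps the logarithmic integral of
    \<open>g\<close> below 1.\<close>
  define \<delta> where "\<delta> = min 1 (sqrt (d / (4 * Q)))"
  have \<delta>: "0 < \<delta>" "\<delta> \<le> 1" using d Q by (auto simp: \<delta>_def)
  have "\<delta>\<^sup>2 \<le> (sqrt (d / (4 * Q)))\<^sup>2" using \<delta> by (intro power_mono) (auto simp: \<delta>_def)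
  then have \<delta>Q: "\<delta>\<^sup>2 * Q \<le> d / 4" using d Q by (simp add: field_simps)
  have "0 \<le> nehari_I p U u" if u: "u \<in> H01 U" "energy_finite p U u" "gnorm U u \<le> \<delta>" for u
  proof (rule ccontr)
    assume "\<not> 0 \<le> nehari_I p U u"
    then obtain t where t: "0 < t" "t < 1" "(\<lambda>x. t * u x) \<in> nehari p U" "gnorm U (\<lambda>x. t * u x) \<le> gnorm U u"
      using nehari_scale_down[OF p u(1,2)] by (metis linorder_not_le)
    define g where "g = (\<lambda>x. t * u x)"
    have gN: "g \<in> nehari p U" using t by (simp add: g_def)
    have gH: "g \<in> H01 U" unfolding g_def by (rule H01_scale[OF u(1)])
    have gF: "energy_finite p U g" unfolding g_def by (rule energy_finite_scale(1)[OF t(1) u(2)])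
    have I0: "nehari_I p U g = 0" using gN by (simp add: nehari_def)
    have g\<delta>: "(gnorm U g)\<^sup>2 \<le> \<delta>\<^sup>2"
      using t(4) u(3) by (intro power_mono) (auto simp: g_def gnorm_nonneg)
    have \<delta>1: "\<delta>\<^sup>2 \<le> 1" using \<delta> by (simp add: power_le_one)
    have "(Lnorm U 2 g)\<^sup>2 \<le> (P * gnorm U g)\<^sup>2"
      using P(2)[OF gH] by (intro power_mono) (simp_all add: Lnorm_2 L2_inner_self_nonneg)
    also have "\<dots> \<le> P\<^sup>2 * \<delta>\<^sup>2" unfolding power_mult_distrib using g\<delta> by (intro mult_left_mono) auto
    finally have L: "(Lnorm U 2 g)\<^sup>2 \<le> P\<^sup>2 * \<delta>\<^sup>2" .
    have "power_energy p U g \<le> K powr (p - 1) * (Lnorm U 2 g)\<^sup>2 + (log_energy p U g + m) / ln K"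
      unfolding m_def by (rule power_energy_split[OF p K H01_L2[OF gH] gF])
    also have "\<dots> \<le> K powr (p - 1) * (P\<^sup>2 * \<delta>\<^sup>2) + (1 + m) / ln K"
      using L K I0 g\<delta> \<delta>1 by (intro add_mono mult_left_mono divide_right_mono) (auto simp: nehari_I_eq)
    also have "(1 + m) / ln K = d / 4" unfolding lK using m d by (simp add: field_simps)
    finally have C: "power_energy p U g \<le> K powr (p - 1) * (P\<^sup>2 * \<delta>\<^sup>2) + d / 4" .
    have "(p - 1) / (2 * (1 + p)) * (gnorm U g)\<^sup>2 \<le> 1 / 2 * \<delta>\<^sup>2"
      using p g\<delta> by (intro mult_mono) (auto simp: field_simps)
    moreover have "power_energy p U g / (1 + p)\<^sup>2 \<le> power_energy p U g / 1"
      using p power_energy_nonneg[of p U g] by (intro divide_left_mono) auto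
    ultimately have "energy_J p U g \<le> 1 / 2 * \<delta>\<^sup>2 + power_energy p U g"
      unfolding energy_J_via_I[OF p] I0 div_0 add_0_left div_by_1 by linarith
    also have "\<dots> \<le> \<delta>\<^sup>2 * Q + d / 4" using C by (simp add: Q_def algebra_simps)
    also have "\<dots> < d" using \<delta>Q d by simp
    finally show False using well[OF gN] by simp
  qed
  with \<delta>(1) show ?thesis by (rule that)
qed

text \<open>Scaling up by \<open>t \<ge> 1\<close> multiplies the part of the energy besides
  \<open>I\<close> by at most \<open>t powr (1 + p)\<close> and must lift it from \<open>e\<close>
  to at least \<open>d\<close>; hence \<open>t \<ge> L > 1\<close>. The equation that determines
  \<open>t\<close> then bounds the logarithmic integral by a fixed fraction of the squared gradient
  norm.\<close>

lemma nehari_I_coercive: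
  assumes "d1 < d"
  obtains \<kappa> where "0 < \<kappa>"
    "\<And>u. u \<in> H01 U \<Longrightarrow> energy_finite p U u \<Longrightarrow> 0 \<le> nehari_I p U u \<Longrightarrow> energy_J p U u \<le> d1
      \<Longrightarrow> \<kappa> * (gnorm U u)\<^sup>2 \<le> nehari_I p U u"
proof -
  \<comment> \<open>A positive replacement for \<open>d1\<close>, which may be negative, so that
    \<open>d / e\<close> is meaningful and exceeds 1.\<close>
  define e where "e = max d1 (d / 2)"
  have e: "0 < e" "e < d" "d1 \<le> e" using d assms by (auto simp: e_def)
  define L where "L = (d / e) powr (1 / (1 + p))"
  have "(d / e) powr 0 < L" unfolding L_def using e p by (intro powr_less_mono) auto
  then have L: "1 < L" using e d by simp
  \<comment> \<open>What remains of the squared gradient norm once the logarithmic integral has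
    taken at most the fraction \<open>L powr (1 - p)\<close>.\<close>
  define \<kappa> where "\<kappa> = 1 - L powr (1 - p)"
  have "L powr (1 - p) < L powr 0" using L p by (intro powr_less_mono) auto
  then have \<kappa>: "0 < \<kappa>" using L by (simp add: \<kappa>_def)
  have "\<kappa> * (gnorm U u)\<^sup>2 \<le> nehari_I p U u"
    if u: "u \<in> H01 U" "energy_finite p U u" "0 \<le> nehari_I p U u" "energy_J p U u \<le> d1" for u
  proof (cases "gnorm U u = 0")
    case True
    then show ?thesis using u by simp
  next
    case False
    let ?a = "(gnorm U u)\<^sup>2"
    obtain t where t: "1 \<le> t" "(\<lambda>x. t * u x) \<in> nehari p U"
      "?a = t powr (p - 1) * (log_energy p U u + ln t * power_energy p U u)"
      using nehari_scale_up[OF p u(1-3) False] by blast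
    have "d \<le> energy_J p U (\<lambda>x. t * u x)" by (rule well[OF t(2)])
    also have "\<dots> = (p - 1) / (2 * (1 + p)) * (t\<^sup>2 * ?a) + t powr (1 + p) * power_energy p U u / (1 + p)\<^sup>2"
      using t(1,2) unfolding energy_J_via_I[OF p] nehari_def
      by (simp add: gnorm_scale[OF u(1)] energy_finite_scale(2)[OF _ u(2)] power_mult_distrib)
    also have "\<dots> \<le> (p - 1) / (2 * (1 + p)) * (t powr (1 + p) * ?a) + t powr (1 + p) * power_energy p U u / (1 + p)\<^sup>2"
    proof -
      have "t powr 2 \<le> t powr (1 + p)" using t(1) p by (intro powr_mono) auto
      then have "t\<^sup>2 \<le> t powr (1 + p)" using t(1) by (simp add: powr_numeral)
      then show ?thesis using p by (intro add_right_mono mult_left_mono mult_right_mono) auto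
    qed
    also have "\<dots> = t powr (1 + p) * (energy_J p U u - nehari_I p U u / (1 + p))"
      unfolding energy_J_via_I[OF p] by (simp add: algebra_simps)
    also have "\<dots> \<le> t powr (1 + p) * e"
    proof -
      have "0 \<le> nehari_I p U u / (1 + p)" using p u(3) by simp
      then show ?thesis using u(4) e(3) by (intro mult_left_mono) auto
    qed
    finally have "d / e \<le> t powr (1 + p)" using e by (simp add: field_simps)
    then have "L \<le> (t powr (1 + p)) powr (1 / (1 + p))"
      unfolding L_def using d e p by (intro powr_mono2) auto
    then have Lt: "L \<le> t" using p t(1) by (simp add: powr_powr)
    have "t powr (1 - p) * ?a = (t powr (1 - p) * t powr (p - 1)) * (log_energy p U u + ln t * power_energy p U u)"
      using t(3) by simp
    also have "\<dots> = log_energy p U u + ln t * power_energy p U u"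
      using t(1) by (simp flip: powr_add)
    also have "\<dots> \<ge> log_energy p U u"
      using t(1) power_energy_nonneg[of p U u] by simp
    finally have "log_energy p U u \<le> t powr (1 - p) * ?a" .
    also have "\<dots> \<le> L powr (1 - p) * ?a"
      using Lt L p by (intro mult_right_mono powr_mono2') auto
    finally show ?thesis by (simp add: nehari_I_eq \<kappa>_def algebra_simps)
  qed
  with \<kappa> show ?thesis by (rule that)
qed

end

section \<open>The equation as a gradient flow\<close>

text \<open>\<open>flow_form p U u\<close> is minus the differential of \<open>energy_J p U\<close> at \<open>u\<close>; the equation says that the
  \<open>H1_inner\<close> product of the time derivative of \<open>v\<close> with \<open>w\<close> is \<open>flow_form p U (v t) w\<close>.\<close>

definition flow_form :: "real \<Rightarrow> 'a::euclidean_space set \<Rightarrow> ('a \<Rightarrow> real) \<Rightarrow> ('a \<Rightarrow> real) \<Rightarrow> real" where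
  "flow_form p U u z = L2_inner U (\<lambda>x. log_source p (u x)) z - dirichlet U u z"

text \<open>Every argument may be replaced by the largest of the three, since \<open>growth\<close>
  is monotone; the resulting term is one of the summands on the right.\<close>

lemma growth_three:
  assumes "p > 1" "0 \<le> x" "0 \<le> y" "0 \<le> z"
  shows "growth p x * y * z \<le> growth p x * x\<^sup>2 + growth p y * y\<^sup>2 + growth p z * z\<^sup>2"
proof -
  define m where "m = max x (max y z)"
  have g: "0 \<le> growth p s" if "0 \<le> s" for s using growth_ge_1[OF assms(1) that] by simp
  have nn: "0 \<le> growth p x * x\<^sup>2" "0 \<le> growth p y * y\<^sup>2" "0 \<le> growth p z * z\<^sup>2"
    using g assms by auto
  have "growth p x * y * z \<le> growth p m * m * m"
    using assms g by (intro mult_mono growth_mono) (auto simp: m_def)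
  also have "\<dots> = growth p m * m\<^sup>2" by (simp add: power2_eq_square)
  also have "\<dots> \<le> growth p x * x\<^sup>2 + growth p y * y\<^sup>2 + growth p z * z\<^sup>2"
    using nn unfolding m_def by (auto simp: max_def)
  finally show ?thesis .
qed

context positive_well
begin

text \<open>For test functions \<open>I \<ge> 0\<close> bounds the logarithmic integral by the
  squared gradient norm. Fatou's lemma along an almost everywhere convergent subsequence transfers
  the bound to \<open>H01\<close>. The radius is halved so that the approximants eventually stay in
  the ball where \<open>I \<ge> 0\<close>.\<close>

lemma growth_integrable_small:
  obtains \<delta> M where "0 < \<delta>" "0 < M"
    "\<And>u. u \<in> H01 U \<Longrightarrow> gnorm U u \<le> \<delta> \<Longrightarrow> integrable (lebesgue_on U) (\<lambda>x. growth p \<bar>u x\<bar> * (u x)\<^sup>2)"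
    "\<And>u. u \<in> H01 U \<Longrightarrow> gnorm U u \<le> \<delta> \<Longrightarrow> (LINT x|lebesgue_on U. growth p \<bar>u x\<bar> * (u x)\<^sup>2) \<le> M"
proof -
  obtain \<delta>' where \<delta>': "0 < \<delta>'"
    "\<And>u. u \<in> H01 U \<Longrightarrow> energy_finite p U u \<Longrightarrow> gnorm U u \<le> \<delta>' \<Longrightarrow> 0 \<le> nehari_I p U u"
    using nehari_I_small by blast
  obtain A where A: "A > 0" "\<And>s. growth p \<bar>s\<bar> * s\<^sup>2 \<le> A * (\<bar>s\<bar> powr (1 + p) * ln \<bar>s\<bar> + 2)"
    using growth_le_log_energy[OF p] by blast
  define m where "m = measure (lebesgue_on U) U"
  define M where "M = A * (\<delta>'\<^sup>2 + 2 * m)"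
  have M: "0 < M" using A \<delta>'(1) by (auto simp: M_def m_def intro!: mult_pos_pos add_pos_nonneg)
  define g where "g s = growth p \<bar>s\<bar> * s\<^sup>2" for s
  have g0: "0 \<le> g s" for s using growth_ge_1[OF p, of "\<bar>s\<bar>"] by (simp add: g_def)
  have gm[measurable]: "g \<in> borel_measurable borel" unfolding g_def[abs_def] by measurable
  have gc: "isCont g s" for s
    unfolding g_def growth_def by (intro continuous_intros) auto
  have smooth_case: "integral\<^sup>N (lebesgue_on U) (\<lambda>x. ennreal (g (\<phi> x))) \<le> ennreal M"
    if \<phi>: "\<phi> \<in> test_functions U" "gnorm U \<phi> \<le> \<delta>'" for \<phi>
  proof -
    note f = test_energy_finite[OF p \<phi>(1)]
    have "0 \<le> nehari_I p U \<phi>" by (rule \<delta>'(2)[OF test_H01[OF \<phi>(1)] f \<phi>(2)])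
    then have "log_energy p U \<phi> \<le> (gnorm U \<phi>)\<^sup>2" by (simp add: nehari_I_eq)
    also have "\<dots> \<le> \<delta>'\<^sup>2" using \<phi>(2) gnorm_nonneg by (intro power_mono) auto
    finally have l: "log_energy p U \<phi> \<le> \<delta>'\<^sup>2" .
    let ?h = "\<lambda>x. A * (\<bar>\<phi> x\<bar> powr (1 + p) * ln \<bar>\<phi> x\<bar> + 2)"
    have h: "integrable (lebesgue_on U) ?h" using f by (auto simp: energy_finite_def)
    have "integral\<^sup>N (lebesgue_on U) (\<lambda>x. ennreal (g (\<phi> x))) \<le> integral\<^sup>N (lebesgue_on U) (\<lambda>x. ennreal (?h x))"
      by (intro nn_integral_mono ennreal_leI) (use A(2) in \<open>simp add: g_def\<close>)
    also have "\<dots> = ennreal (integral\<^sup>L (lebesgue_on U) ?h)"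
      using h g0 A(2) by (intro nn_integral_eq_integral AE_I2) (auto simp: g_def intro: order_trans)
    also have "integral\<^sup>L (lebesgue_on U) ?h = A * (log_energy p U \<phi> + 2 * m)"
      using f by (simp add: energy_finite_def log_energy_def m_def)
    also have "ennreal \<dots> \<le> ennreal M"
      unfolding M_def using l A(1) by (intro ennreal_leI mult_left_mono) auto
    finally show ?thesis .
  qed
  have main: "integral\<^sup>N (lebesgue_on U) (\<lambda>x. ennreal (g (u x))) \<le> ennreal M"
    if u: "u \<in> H01 U" "gnorm U u \<le> \<delta>' / 2" for u
  proof -
    obtain \<phi> where \<phi>: "\<And>k::nat. \<phi> k \<in> test_functions U" "(\<lambda>k. H1_norm U (\<lambda>x. \<phi> k x - u x)) \<longlonglongrightarrow> 0"
      using H01_dense[OF u(1)] by blast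
    note l = H01_dense_norms[OF u(1) \<phi>]
    have "gnorm U u < \<delta>'" using u(2) \<delta>'(1) by simp
    from order_tendstoD(2)[OF l(3) this] obtain N where N: "\<And>k. N \<le> k \<Longrightarrow> gnorm U (\<phi> k) < \<delta>'"
      by (auto simp: eventually_sequentially)
    have um: "u \<in> borel_measurable (lebesgue_on U)" using H01_L2[OF u(1)] by (rule L2_measurable)
    have dL: "(\<lambda>x. \<phi> k x - u x) \<in> L2 U" for k
      by (rule L2_space.diff[OF test_L2[OF \<phi>(1)] H01_L2[OF u(1)]])
    \<comment> \<open>L2 convergence means that the squared differences tend to 0 in L1, which
      provides the subsequence.\<close>
    have "\<exists>r::nat\<Rightarrow>nat. strict_mono r \<and> (AE x in lebesgue_on U. (\<lambda>n. (\<phi> (r n + N) x - u x)\<^sup>2) \<longlonglongrightarrow> 0)"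
    proof (rule tendsto_L1_AE_subseq)
      show "integrable (lebesgue_on U) (\<lambda>x. (\<phi> (n + N) x - u x)\<^sup>2)" for n
        using dL[of "n + N"] by (simp add: L2_def)
      have "(LINT x|lebesgue_on U. norm ((\<phi> (n + N) x - u x)\<^sup>2)) = (Lnorm U 2 (\<lambda>x. \<phi> (n + N) x - u x))\<^sup>2" for n
        unfolding Lnorm_2_sq L2_inner_def by (simp add: power2_eq_square)
      moreover have "(\<lambda>n. (Lnorm U 2 (\<lambda>x. \<phi> (n + N) x - u x))\<^sup>2) \<longlonglongrightarrow> 0\<^sup>2"
        by (intro tendsto_power LIMSEQ_ignore_initial_segment[OF l(2)])
      ultimately show "(\<lambda>n. LINT x|lebesgue_on U. norm ((\<phi> (n + N) x - u x)\<^sup>2)) \<longlonglongrightarrow> 0" by simp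
    qed
    then obtain r :: "nat \<Rightarrow> nat" where r: "AE x in lebesgue_on U. (\<lambda>n. (\<phi> (r n + N) x - u x)\<^sup>2) \<longlonglongrightarrow> 0"
      by blast
    define \<psi> where "\<psi> n = \<phi> (r n + N)" for n
    have lim: "AE x in lebesgue_on U. (\<lambda>n. g (\<psi> n x)) \<longlonglongrightarrow> g (u x)"
      using r
    proof eventually_elim
      case (elim x)
      have "(\<lambda>n. \<bar>\<psi> n x - u x\<bar>) \<longlonglongrightarrow> 0"
        using tendsto_real_sqrt[OF elim] by (simp add: \<psi>_def)
      then have "(\<lambda>n. \<psi> n x) \<longlonglongrightarrow> u x"
        using LIM_zero_cancel tendsto_rabs_zero_iff by blast
      then show ?case by (rule isCont_tendsto_compose[OF gc])
    qed
    have "integral\<^sup>N (lebesgue_on U) (\<lambda>x. ennreal (g (u x))) = integral\<^sup>N (lebesgue_on U) (\<lambda>x. liminf (\<lambda>n. ennreal (g (\<psi> n x))))"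
    proof (rule nn_integral_cong_AE)
      show "AE x in lebesgue_on U. ennreal (g (u x)) = liminf (\<lambda>n. ennreal (g (\<psi> n x)))"
        using lim
      proof eventually_elim
        case (elim x)
        have "(\<lambda>n. ennreal (g (\<psi> n x))) \<longlonglongrightarrow> ennreal (g (u x))" using elim by (rule tendsto_ennrealI)
        from lim_imp_Liminf[OF sequentially_bot this] show ?case ..
      qed
    qed
    also have "\<dots> \<le> liminf (\<lambda>n. integral\<^sup>N (lebesgue_on U) (\<lambda>x. ennreal (g (\<psi> n x))))"
    proof (rule nn_integral_liminf)
      show "(\<lambda>x. ennreal (g (\<psi> n x))) \<in> borel_measurable (lebesgue_on U)" for n
        using test_measurable_on[OF \<phi>(1)] unfolding \<psi>_def by measurable
    qed
    also have "\<dots> \<le> limsup (\<lambda>n. integral\<^sup>N (lebesgue_on U) (\<lambda>x. ennreal (g (\<psi> n x))))"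
      by (rule Liminf_le_Limsup) simp
    also have "\<dots> \<le> ennreal M"
    proof (rule Limsup_bounded[OF always_eventually], rule allI)
      fix n
      show "integral\<^sup>N (lebesgue_on U) (\<lambda>x. ennreal (g (\<psi> n x))) \<le> ennreal M"
        unfolding \<psi>_def using N[of "r n + N"] by (intro smooth_case \<phi>(1)) auto
    qed
    finally show ?thesis .
  qed
  show ?thesis
  proof (rule that[of "\<delta>' / 2" M])
    fix u assume u: "u \<in> H01 U" "gnorm U u \<le> \<delta>' / 2"
    have um: "u \<in> borel_measurable (lebesgue_on U)" using H01_L2[OF u(1)] by (rule L2_measurable)
    have m: "(\<lambda>x. g (u x)) \<in> borel_measurable (lebesgue_on U)" using um by measurable
    have fin: "integral\<^sup>N (lebesgue_on U) (\<lambda>x. ennreal (g (u x))) < \<infinity>"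
      using main[OF u] by (simp add: order_le_less_trans)
    show "integrable (lebesgue_on U) (\<lambda>x. growth p \<bar>u x\<bar> * (u x)\<^sup>2)"
      using integrableI_nonneg[OF m _ fin] g0 by (simp add: g_def)
    have "integral\<^sup>L (lebesgue_on U) (\<lambda>x. g (u x)) \<le> M"
      using main[OF u] M by (subst integral_eq_nn_integral[OF m]) (auto simp: g0 intro: enn2real_leI)
    then show "(LINT x|lebesgue_on U. growth p \<bar>u x\<bar> * (u x)\<^sup>2) \<le> M" by (simp add: g_def)
  qed (use \<delta>' M in auto)
qed

text \<open>For arguments with small gradients, the product is dominated pointwise by the three integrands
  of \<open>growth_integrable_small\<close>; the general case follows by scaling each argument.\<close>

lemma growth_trilinear:
  obtains C where "0 < C"
    "\<And>u a b. u \<in> H01 U \<Longrightarrow> a \<in> H01 U \<Longrightarrow> b \<in> H01 U \<Longrightarrow> gnorm U u \<le> R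
      \<Longrightarrow> integrable (lebesgue_on U) (\<lambda>x. growth p \<bar>u x\<bar> * \<bar>a x\<bar> * \<bar>b x\<bar>)"
    "\<And>u a b. u \<in> H01 U \<Longrightarrow> a \<in> H01 U \<Longrightarrow> b \<in> H01 U \<Longrightarrow> gnorm U u \<le> R
      \<Longrightarrow> (LINT x|lebesgue_on U. growth p \<bar>u x\<bar> * \<bar>a x\<bar> * \<bar>b x\<bar>) \<le> C * gnorm U a * gnorm U b"
proof -
  obtain \<delta> M where \<delta>: "0 < \<delta>" "0 < M"
    "\<And>u. u \<in> H01 U \<Longrightarrow> gnorm U u \<le> \<delta> \<Longrightarrow> integrable (lebesgue_on U) (\<lambda>x. growth p \<bar>u x\<bar> * (u x)\<^sup>2)"
    "\<And>u. u \<in> H01 U \<Longrightarrow> gnorm U u \<le> \<delta> \<Longrightarrow> (LINT x|lebesgue_on U. growth p \<bar>u x\<bar> * (u x)\<^sup>2) \<le> M"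
    using growth_integrable_small by blast
  \<comment> \<open>Brings the gradient of \<open>u / K\<close> below \<open>\<delta>\<close> for
    any \<open>R\<close>; \<open>K \<ge> 1\<close> is required by
    \<open>growth_scale\<close>.\<close>
  define K where "K = max 1 (R / \<delta>)"
  have K: "1 \<le> K" "R \<le> K * \<delta>" using \<delta>(1) by (auto simp: K_def max_def field_simps)
  define k where "k = K powr (p - 1) * (1 + ln K)"
  have k: "0 < k" using K by (auto simp: k_def intro!: mult_pos_pos add_pos_nonneg)
  \<comment> \<open>\<open>k\<close> undoes the scaling of \<open>u\<close>, the division by
    \<open>\<delta>\<^sup>2\<close> that of the other two arguments, and \<open>3 * M\<close> bounds
    the three integrals of \<open>growth_three\<close>.\<close>
  define C where "C = k * (3 * M) / \<delta>\<^sup>2"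
  have C: "0 < C" using k \<delta> by (simp add: C_def)
  have main: "integrable (lebesgue_on U) (\<lambda>x. growth p \<bar>u x\<bar> * \<bar>a x\<bar> * \<bar>b x\<bar>) \<and>
      (LINT x|lebesgue_on U. growth p \<bar>u x\<bar> * \<bar>a x\<bar> * \<bar>b x\<bar>) \<le> C * gnorm U a * gnorm U b"
    if u: "u \<in> H01 U" and a: "a \<in> H01 U" and b: "b \<in> H01 U" and R: "gnorm U u \<le> R" for u a b
  proof -
    let ?f = "\<lambda>x. growth p \<bar>u x\<bar> * \<bar>a x\<bar> * \<bar>b x\<bar>"
    have [measurable]: "u \<in> borel_measurable (lebesgue_on U)" "a \<in> borel_measurable (lebesgue_on U)"
      "b \<in> borel_measurable (lebesgue_on U)"
      using u a b by (auto intro: L2_measurable H01_L2)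
    have fm: "?f \<in> borel_measurable (lebesgue_on U)" by measurable
    show ?thesis
    proof (cases "gnorm U a = 0 \<or> gnorm U b = 0")
      \<comment> \<open>An argument with zero gradient cannot be normalised, but it vanishes almost
        everywhere, and so does the integrand.\<close>
      case True
      then have "AE x in lebesgue_on U. a x = 0 \<or> b x = 0"
        using gnorm_0_AE[OF a] gnorm_0_AE[OF b] by (auto elim!: eventually_mono)
      then have z: "AE x in lebesgue_on U. ?f x = 0" by eventually_elim auto
      have "integrable (lebesgue_on U) ?f"
        using fm z by (subst integrable_cong_AE[of _ _ "\<lambda>_. 0"]) auto
      moreover have "integral\<^sup>L (lebesgue_on U) ?f = 0" using z by (rule integral_eq_zero_AE)
      ultimately show ?thesis using True by auto
    next
      case False
      define \<alpha> \<beta> where "\<alpha> = gnorm U a" and "\<beta> = gnorm U b"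
      have \<alpha>: "\<alpha> > 0" "\<beta> > 0"
        using False gnorm_nonneg[of U a] gnorm_nonneg[of U b] by (auto simp: \<alpha>_def \<beta>_def)
      define u' a' b' where "u' = (\<lambda>x. (1 / K) * u x)" and "a' = (\<lambda>x. (\<delta> / \<alpha>) * a x)" and "b' = (\<lambda>x. (\<delta> / \<beta>) * b x)"
      have H: "u' \<in> H01 U" "a' \<in> H01 U" "b' \<in> H01 U"
        unfolding u'_def a'_def b'_def by (intro H01_scale u a b)+
      have gu: "gnorm U u' \<le> \<delta>"
        unfolding u'_def gnorm_scale[OF u] using K R by (simp add: field_simps)
      have ga: "gnorm U a' \<le> \<delta>" "gnorm U b' \<le> \<delta>"
        unfolding a'_def b'_def gnorm_scale[OF a] gnorm_scale[OF b]
        using \<alpha> \<delta>(1) by (auto simp: \<alpha>_def \<beta>_def)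
      let ?S = "\<lambda>x. growth p \<bar>u' x\<bar> * (u' x)\<^sup>2 + growth p \<bar>a' x\<bar> * (a' x)\<^sup>2 + growth p \<bar>b' x\<bar> * (b' x)\<^sup>2"
      let ?h = "\<lambda>x. k * (\<alpha> * \<beta> / \<delta>\<^sup>2) * ?S x"
      have S: "integrable (lebesgue_on U) ?S" "integral\<^sup>L (lebesgue_on U) ?S \<le> 3 * M"
        using \<delta>(3)[OF H(1) gu] \<delta>(3)[OF H(2) ga(1)] \<delta>(3)[OF H(3) ga(2)]
          \<delta>(4)[OF H(1) gu] \<delta>(4)[OF H(2) ga(1)] \<delta>(4)[OF H(3) ga(2)] by auto
      have le: "\<bar>?f x\<bar> \<le> ?h x" for x
      proof -
        have "growth p \<bar>u x\<bar> = growth p (K * \<bar>u' x\<bar>)" using K by (simp add: u'_def abs_mult)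
        also have "\<dots> \<le> k * growth p \<bar>u' x\<bar>" unfolding k_def by (rule growth_scale[OF p K(1)]) simp
        finally have g: "growth p \<bar>u x\<bar> \<le> k * growth p \<bar>u' x\<bar>" .
        have ab: "\<bar>a x\<bar> = \<alpha> / \<delta> * \<bar>a' x\<bar>" "\<bar>b x\<bar> = \<beta> / \<delta> * \<bar>b' x\<bar>"
          using \<alpha> \<delta>(1) by (auto simp: a'_def b'_def abs_mult)
        have "?f x \<le> (k * growth p \<bar>u' x\<bar>) * \<bar>a x\<bar> * \<bar>b x\<bar>"
          by (intro mult_right_mono g) auto
        also have "\<dots> = k * (\<alpha> * \<beta> / \<delta>\<^sup>2) * (growth p \<bar>u' x\<bar> * \<bar>a' x\<bar> * \<bar>b' x\<bar>)"
          unfolding ab by (simp add: power2_eq_square)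
        also have "\<dots> \<le> ?h x"
          using growth_three[OF p, of "\<bar>u' x\<bar>" "\<bar>a' x\<bar>" "\<bar>b' x\<bar>"] k \<alpha> by (intro mult_left_mono) auto
        finally show ?thesis using growth_ge_1[OF p, of "\<bar>u x\<bar>"] by simp
      qed
      have h: "integrable (lebesgue_on U) ?h" using S(1) by (rule integrable_mult_right)
      note dom = dominated_integrable[OF h fm AE_I2[OF le]]
      have "integral\<^sup>L (lebesgue_on U) ?f \<le> integral\<^sup>L (lebesgue_on U) ?h" using dom(2) by linarith
      also have "\<dots> = k * (\<alpha> * \<beta> / \<delta>\<^sup>2) * integral\<^sup>L (lebesgue_on U) ?S" by (rule integral_mult_right_zero)
      also have "\<dots> \<le> k * (\<alpha> * \<beta> / \<delta>\<^sup>2) * (3 * M)" using S(2) k \<alpha> by (intro mult_left_mono) auto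
      also have "\<dots> = C * \<alpha> * \<beta>" by (simp add: C_def)
      finally show ?thesis using dom(1) by (simp add: \<alpha>_def \<beta>_def)
    qed
  qed
  show ?thesis by (rule that[OF C]) (use main in blast)+
qed

lemma source_integrable:
  assumes "u \<in> H01 U" "z \<in> H01 U"
  shows "integrable (lebesgue_on U) (\<lambda>x. log_source p (u x) * z x)"
proof -
  have C: "integrable (lebesgue_on U) (\<lambda>x. growth p \<bar>u x\<bar> * \<bar>u x\<bar> * \<bar>z x\<bar>)"
    by (rule growth_trilinear[of "gnorm U u"]) (use assms in simp)
  have [measurable]: "u \<in> borel_measurable (lebesgue_on U)" "z \<in> borel_measurable (lebesgue_on U)"
    using assms by (auto intro: L2_measurable H01_L2)
  show ?thesis
  proof (rule dominated_integrable(1))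
    show "integrable (lebesgue_on U) (\<lambda>x. (2 * log_const p) * (growth p \<bar>u x\<bar> * \<bar>u x\<bar> * \<bar>z x\<bar>))"
      using C by (rule integrable_mult_right)
    have "\<bar>log_source p (u x) * z x\<bar> \<le> (2 * log_const p) * (growth p \<bar>u x\<bar> * \<bar>u x\<bar> * \<bar>z x\<bar>)" for x
      using mult_right_mono[OF log_source_bound[OF p, of "u x"] abs_ge_zero[of "z x"]]
      by (simp add: abs_mult mult.assoc)
    then show "AE x in lebesgue_on U. \<bar>log_source p (u x) * z x\<bar> \<le> (2 * log_const p) * (growth p \<bar>u x\<bar> * \<bar>u x\<bar> * \<bar>z x\<bar>)"
      by simp
  qed measurable
qed

text \<open>From here on the side condition of the scaling lemmas holds automatically on
  \<open>H01\<close>.\<close>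

lemma H01_energy_finite:
  assumes "u \<in> H01 U"
  shows "energy_finite p U u"
  unfolding energy_finite_def
proof
  show "integrable (lebesgue_on U) (\<lambda>x. \<bar>u x\<bar> powr (1 + p) * ln \<bar>u x\<bar>)"
    using source_integrable[OF assms assms] by (simp add: log_source_mult)
  have C: "integrable (lebesgue_on U) (\<lambda>x. growth p \<bar>u x\<bar> * \<bar>u x\<bar> * \<bar>u x\<bar>)"
    by (rule growth_trilinear[of "gnorm U u"]) (use assms in simp)
  have [measurable]: "u \<in> borel_measurable (lebesgue_on U)"
    using assms by (auto intro: L2_measurable H01_L2)
  show "integrable (lebesgue_on U) (\<lambda>x. \<bar>u x\<bar> powr (1 + p))"
  proof (rule dominated_integrable(1)[OF C])
    have "\<bar>\<bar>u x\<bar> powr (1 + p)\<bar> \<le> growth p \<bar>u x\<bar> * \<bar>u x\<bar> * \<bar>u x\<bar>" for x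
      using mult_right_mono[OF power_le_growth[OF p, of "u x"] zero_le_power2[of "u x"]]
      by (simp add: powr_plus_one power2_eq_square mult.assoc)
    then show "AE x in lebesgue_on U. \<bar>\<bar>u x\<bar> powr (1 + p)\<bar> \<le> growth p \<bar>u x\<bar> * \<bar>u x\<bar> * \<bar>u x\<bar>" by simp
  qed measurable
qed

lemma potential_integrable:
  assumes "u \<in> H01 U"
  shows "integrable (lebesgue_on U) (\<lambda>x. log_potential p (u x))"
  using H01_energy_finite[OF assms] by (simp add: energy_finite_def log_potential_def)

lemma energy_J_potential:
  assumes "u \<in> H01 U"
  shows "energy_J p U u = dirichlet U u u / 2 - (LINT x|lebesgue_on U. log_potential p (u x))"
  using H01_energy_finite[OF assms]
  by (simp add: energy_J_eq[OF p] gnorm_sq energy_finite_def log_potential_def log_energy_def power_energy_def)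

text \<open>\<open>I\<close> is the derivative of the energy in the direction of its own argument;
  testing the equation with \<open>v t\<close> therefore governs the norm of
  \<open>v t\<close>.\<close>

lemma nehari_I_flow:
  shows "nehari_I p U u = - flow_form p U u u"
  by (simp add: flow_form_def nehari_I_eq gnorm_sq log_energy_def L2_inner_def log_source_mult)

lemma flow_form_add_right:
  assumes "u \<in> H01 U" "z \<in> H01 U" "w \<in> H01 U"
  shows "flow_form p U u (\<lambda>x. z x + c * w x) = flow_form p U u z + c * flow_form p U u w"
  using source_integrable[OF assms(1,2)] source_integrable[OF assms(1,3)] H1s.add_right[OF H01_H1 H01_H1 H01_H1, OF assms(2,3,1), of c]
  by (simp add: flow_form_def L2_inner_def algebra_simps)

lemma flow_form_diff_right:
  assumes "u \<in> H01 U" "z \<in> H01 U" "w \<in> H01 U"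
  shows "flow_form p U u (\<lambda>x. z x - w x) = flow_form p U u z - flow_form p U u w"
  using flow_form_add_right[OF assms, of "- 1"] by simp

lemma dirichlet_bound: "u \<in> H01 U \<Longrightarrow> z \<in> H01 U \<Longrightarrow> \<bar>dirichlet U u z\<bar> \<le> gnorm U u * gnorm U z"
  using H1s.Cauchy_Schwarz[OF H01_H1 H01_H1] by (simp add: H1s_nrm)

text \<open>On gradient balls the energy behaves like a function with Lipschitz differential:
  boundedness, Lipschitz continuity and a quadratic Taylor remainder, with one common constant. Each
  nonlinear integrand is dominated by \<open>growth\<close> times two factors and falls under
  \<open>growth_trilinear\<close>.\<close>

lemma flow_form_estimates:
  assumes R: "0 < R"
  obtains C where "0 < C"
    "\<And>u z. u \<in> H01 U \<Longrightarrow> z \<in> H01 U \<Longrightarrow> gnorm U u \<le> R \<Longrightarrow> \<bar>flow_form p U u z\<bar> \<le> C * gnorm U z"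
    "\<And>u w z. u \<in> H01 U \<Longrightarrow> w \<in> H01 U \<Longrightarrow> z \<in> H01 U \<Longrightarrow> gnorm U u \<le> R \<Longrightarrow> gnorm U w \<le> R
      \<Longrightarrow> \<bar>flow_form p U u z - flow_form p U w z\<bar> \<le> C * gnorm U (\<lambda>x. u x - w x) * gnorm U z"
    "\<And>u w. u \<in> H01 U \<Longrightarrow> w \<in> H01 U \<Longrightarrow> gnorm U u \<le> R \<Longrightarrow> gnorm U w \<le> R
      \<Longrightarrow> \<bar>energy_J p U w - energy_J p U u + flow_form p U u (\<lambda>x. w x - u x)\<bar> \<le> C * (gnorm U (\<lambda>x. w x - u x))\<^sup>2"
proof -
  obtain T where T: "0 < T"
    "\<And>u a b. u \<in> H01 U \<Longrightarrow> a \<in> H01 U \<Longrightarrow> b \<in> H01 U \<Longrightarrow> gnorm U u \<le> R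
      \<Longrightarrow> integrable (lebesgue_on U) (\<lambda>x. growth p \<bar>u x\<bar> * \<bar>a x\<bar> * \<bar>b x\<bar>)"
    "\<And>u a b. u \<in> H01 U \<Longrightarrow> a \<in> H01 U \<Longrightarrow> b \<in> H01 U \<Longrightarrow> gnorm U u \<le> R
      \<Longrightarrow> (LINT x|lebesgue_on U. growth p \<bar>u x\<bar> * \<bar>a x\<bar> * \<bar>b x\<bar>) \<le> T * gnorm U a * gnorm U b"
    using growth_trilinear[of R] by blast
  define c where "c = log_const p"
  have c: "1 \<le> c" unfolding c_def by (rule log_const_ge_1[OF p])
  have m: "u \<in> borel_measurable (lebesgue_on U)" if "u \<in> H01 U" for u
    using that by (auto intro: L2_measurable H01_L2)
  have two: "\<bar>integral\<^sup>L (lebesgue_on U) f\<bar> \<le> K * (2 * T) * gnorm U a * gnorm U b"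
    if H: "u \<in> H01 U" "w \<in> H01 U" "a \<in> H01 U" "b \<in> H01 U" "gnorm U u \<le> R" "gnorm U w \<le> R" "0 \<le> K"
      and f: "f \<in> borel_measurable (lebesgue_on U)"
      and le: "\<And>x. \<bar>f x\<bar> \<le> K * (growth p \<bar>u x\<bar> + growth p \<bar>w x\<bar>) * \<bar>a x\<bar> * \<bar>b x\<bar>" for f u w a b K
  proof -
    let ?h = "\<lambda>x. K * (growth p \<bar>u x\<bar> * \<bar>a x\<bar> * \<bar>b x\<bar> + growth p \<bar>w x\<bar> * \<bar>a x\<bar> * \<bar>b x\<bar>)"
    note i = T(2)[OF H(1,3,4,5)] T(2)[OF H(2,3,4,6)]
    have h: "integrable (lebesgue_on U) ?h" using i by auto
    have "\<bar>integral\<^sup>L (lebesgue_on U) f\<bar> \<le> integral\<^sup>L (lebesgue_on U) ?h"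
      by (rule dominated_integrable(2)[OF h f AE_I2]) (use le in \<open>simp add: algebra_simps\<close>)
    also have "\<dots> = K * ((LINT x|lebesgue_on U. growth p \<bar>u x\<bar> * \<bar>a x\<bar> * \<bar>b x\<bar>) + (LINT x|lebesgue_on U. growth p \<bar>w x\<bar> * \<bar>a x\<bar> * \<bar>b x\<bar>))"
      using i by simp
    also have "\<dots> \<le> K * (T * gnorm U a * gnorm U b + T * gnorm U a * gnorm U b)"
      using T(3)[OF H(1,3,4,5)] T(3)[OF H(2,3,4,6)] H(7) by (intro mult_left_mono add_mono) auto
    finally show ?thesis by (simp add: algebra_simps)
  qed
  \<comment> \<open>The first entry serves the bound of \<open>flow_form\<close> itself and
    therefore involves \<open>R\<close>; the second serves the two difference estimates, its
    \<open>+ 1\<close> covering the Dirichlet parts.\<close>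
  define C where "C = max (c * 4 * T * R + R) (c * 4 * T + 1)"
  have C0: "0 < C" using c T(1) by (auto simp: C_def less_max_iff_disj intro!: disjI2 add_pos_pos mult_pos_pos)
  have Ca: "c * 4 * T * R + R \<le> C" and Cb: "c * 4 * T + 1 \<le> C" by (auto simp: C_def)
  show ?thesis
  proof (rule that[OF C0])
    fix u z assume H: "u \<in> H01 U" "z \<in> H01 U" "gnorm U u \<le> R"
    have "\<bar>LINT x|lebesgue_on U. log_source p (u x) * z x\<bar> \<le> c * (2 * T) * gnorm U u * gnorm U z"
    proof (rule two[OF H(1) H(1) H(1) H(2) H(3) H(3)])
      show "(\<lambda>x. log_source p (u x) * z x) \<in> borel_measurable (lebesgue_on U)"
        using m[OF H(1)] m[OF H(2)] by measurable
      show "\<bar>log_source p (u x) * z x\<bar> \<le> c * (growth p \<bar>u x\<bar> + growth p \<bar>u x\<bar>) * \<bar>u x\<bar> * \<bar>z x\<bar>" for x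
        using mult_right_mono[OF log_source_bound[OF p, of "u x"] abs_ge_zero[of "z x"]]
        by (simp add: abs_mult c_def)
    qed (use c in auto)
    also have "\<dots> \<le> c * (2 * T) * R * gnorm U z"
      using H(3) c T(1) gnorm_nonneg by (intro mult_right_mono mult_left_mono) auto
    finally have 1: "\<bar>L2_inner U (\<lambda>x. log_source p (u x)) z\<bar> \<le> c * (2 * T) * R * gnorm U z"
      by (simp add: L2_inner_def)
    have 2: "\<bar>dirichlet U u z\<bar> \<le> R * gnorm U z"
      using dirichlet_bound[OF H(1,2)] mult_right_mono[OF H(3) gnorm_nonneg[of U z]] by linarith
    have "0 \<le> c * (2 * T) * R * gnorm U z" using c T(1) R gnorm_nonneg[of U z] by simp
    then have "\<bar>flow_form p U u z\<bar> \<le> (c * 4 * T * R + R) * gnorm U z"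
      using 1 2 unfolding flow_form_def by (simp add: algebra_simps)
    also have "\<dots> \<le> C * gnorm U z" by (rule mult_right_mono[OF Ca gnorm_nonneg])
    finally show "\<bar>flow_form p U u z\<bar> \<le> C * gnorm U z" .
  next
    fix u w z assume H: "u \<in> H01 U" "w \<in> H01 U" "z \<in> H01 U" "gnorm U u \<le> R" "gnorm U w \<le> R"
    let ?d = "\<lambda>x. u x - w x"
    have d: "?d \<in> H01 U" by (rule H01_diff[OF H(1,2)])
    have "\<bar>LINT x|lebesgue_on U. log_source p (u x) * z x - log_source p (w x) * z x\<bar> \<le> c * (2 * T) * gnorm U ?d * gnorm U z"
    proof (rule two[OF H(1,2) d H(3-5)])
      show "(\<lambda>x. log_source p (u x) * z x - log_source p (w x) * z x) \<in> borel_measurable (lebesgue_on U)"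
        using m[OF H(1)] m[OF H(2)] m[OF H(3)] by measurable
      show "\<bar>log_source p (u x) * z x - log_source p (w x) * z x\<bar> \<le> c * (growth p \<bar>u x\<bar> + growth p \<bar>w x\<bar>) * \<bar>u x - w x\<bar> * \<bar>z x\<bar>" for x
        using mult_right_mono[OF log_source_Lipschitz[OF p, of "u x" "w x"] abs_ge_zero[of "z x"]]
        by (simp add: c_def abs_mult flip: left_diff_distrib)
    qed (use c in auto)
    then have 1: "\<bar>L2_inner U (\<lambda>x. log_source p (u x)) z - L2_inner U (\<lambda>x. log_source p (w x)) z\<bar> \<le> c * (2 * T) * gnorm U ?d * gnorm U z"
      using source_integrable[OF H(1,3)] source_integrable[OF H(2,3)] by (simp add: L2_inner_def)
    have 2: "\<bar>dirichlet U u z - dirichlet U w z\<bar> \<le> gnorm U ?d * gnorm U z"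
      using dirichlet_bound[OF d H(3)] H1s.diff_left[OF H01_H1 H01_H1 H01_H1, OF H(1-3)] by simp
    have n: "0 \<le> gnorm U ?d * gnorm U z" by (simp add: gnorm_nonneg)
    have n': "0 \<le> c * T * (gnorm U ?d * gnorm U z)" using n c T(1) by simp
    have "\<bar>flow_form p U u z - flow_form p U w z\<bar> \<le> (c * 4 * T + 1) * (gnorm U ?d * gnorm U z)"
      using 1 2 n' unfolding flow_form_def by (simp add: algebra_simps)
    also have "\<dots> \<le> C * (gnorm U ?d * gnorm U z)" by (rule mult_right_mono[OF Cb n])
    finally show "\<bar>flow_form p U u z - flow_form p U w z\<bar> \<le> C * gnorm U ?d * gnorm U z" by (simp add: mult.assoc)
  next
    fix u w assume H: "u \<in> H01 U" "w \<in> H01 U" "gnorm U u \<le> R" "gnorm U w \<le> R"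
    let ?d = "\<lambda>x. w x - u x"
    have d: "?d \<in> H01 U" by (rule H01_diff[OF H(2,1)])
    let ?f = "\<lambda>x. log_potential p (w x) - log_potential p (u x) - log_source p (u x) * (w x - u x)"
    have "\<bar>integral\<^sup>L (lebesgue_on U) ?f\<bar> \<le> (2 * c) * (2 * T) * gnorm U ?d * gnorm U ?d"
    proof (rule two[OF H(1,2) d d H(3,4)])
      show "?f \<in> borel_measurable (lebesgue_on U)"
        using m[OF H(1)] m[OF H(2)] by measurable
      show "\<bar>?f x\<bar> \<le> 2 * c * (growth p \<bar>u x\<bar> + growth p \<bar>w x\<bar>) * \<bar>w x - u x\<bar> * \<bar>w x - u x\<bar>" for x
        using log_potential_Taylor[OF p, of "w x" "u x"] by (simp add: c_def power2_eq_square mult.assoc)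
    qed (use c in auto)
    also have "integral\<^sup>L (lebesgue_on U) ?f = (LINT x|lebesgue_on U. log_potential p (w x)) - (LINT x|lebesgue_on U. log_potential p (u x))
        - L2_inner U (\<lambda>x. log_source p (u x)) ?d"
      using potential_integrable[OF H(1)] potential_integrable[OF H(2)] source_integrable[OF H(1) d]
      by (simp add: L2_inner_def)
    finally have 1: "\<bar>(LINT x|lebesgue_on U. log_potential p (w x)) - (LINT x|lebesgue_on U. log_potential p (u x))
        - L2_inner U (\<lambda>x. log_source p (u x)) ?d\<bar> \<le> c * 4 * T * (gnorm U ?d)\<^sup>2"
      by (simp add: power2_eq_square mult_ac)
    note h = H01_H1[OF H(1)] H01_H1[OF H(2)]
    have "dirichlet U w w = dirichlet U (\<lambda>x. u x + 1 * ?d x) (\<lambda>x. u x + 1 * ?d x)" by simp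
    also have "\<dots> = dirichlet U u u + 2 * dirichlet U u ?d + dirichlet U ?d ?d"
      using H1s.expand[OF h(1) H01_H1[OF d], of 1] by simp
    finally have "dirichlet U w w = dirichlet U u u + 2 * dirichlet U u ?d + dirichlet U ?d ?d" .
    then have 2: "dirichlet U w w / 2 - dirichlet U u u / 2 - dirichlet U u ?d = (gnorm U ?d)\<^sup>2 / 2"
      unfolding gnorm_sq by linarith
    have n: "0 \<le> (gnorm U ?d)\<^sup>2" by simp
    have "\<bar>energy_J p U w - energy_J p U u + flow_form p U u ?d\<bar> \<le> (c * 4 * T + 1) * (gnorm U ?d)\<^sup>2"
      using 1 2 n unfolding energy_J_potential[OF H(1)] energy_J_potential[OF H(2)] flow_form_def distrib_right
      by linarith
    also have "\<dots> \<le> C * (gnorm U ?d)\<^sup>2" by (rule mult_right_mono[OF Cb n])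
    finally show "\<bar>energy_J p U w - energy_J p U u + flow_form p U u ?d\<bar> \<le> C * (gnorm U ?d)\<^sup>2" .
  qed
qed

end

section \<open>Weak derivatives in time\<close>

text \<open>Away from \<open>a\<close> the weights are uniformly small, near \<open>a\<close>
  continuity of \<open>g\<close> takes over, and the mass tends to 1. The point \<open>a\<close> may
  be an end of the interval, as in the application.\<close>

lemma approximate_identity:
  fixes W :: "nat \<Rightarrow> real \<Rightarrow> real" and g :: "real \<Rightarrow> real"
  assumes a: "a \<in> {s..t}"
    and Wc: "\<And>k. continuous_on {s..t} (W k)" and gc: "continuous_on {s..t} g"
    and W0: "\<And>k x. x \<in> {s..t} \<Longrightarrow> 0 \<le> W k x"
    and Wle: "\<And>k x. x \<in> {s..t} \<Longrightarrow> x \<noteq> a \<Longrightarrow> W k x \<le> c k / (x - a)\<^sup>2"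
    and c: "c \<longlonglongrightarrow> 0" "\<And>k. 0 \<le> c k"
    and I: "(\<lambda>k. integral {s..t} (W k)) \<longlonglongrightarrow> 1"
  shows "(\<lambda>k. integral {s..t} (\<lambda>x. W k x * g x)) \<longlonglongrightarrow> g a"
proof -
  have int: "(\<lambda>x. W k x * h x) integrable_on {s..t}" if "continuous_on {s..t} h" for h k
    by (intro integrable_continuous_real continuous_intros Wc that)
  have Wi: "W k integrable_on {s..t}" for k by (intro integrable_continuous_real Wc)
  have "bounded (g ` {s..t})" by (intro compact_imp_bounded compact_continuous_image gc) auto
  then obtain G where G: "G > 0" "\<And>x. x \<in> {s..t} \<Longrightarrow> \<bar>g x\<bar> \<le> G" by (auto simp: bounded_pos)
  define D where "D k = integral {s..t} (\<lambda>x. W k x * (g x - g a))" for k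
  have "D \<longlonglongrightarrow> 0"
  proof (rule LIMSEQ_I)
    fix e :: real assume e: "0 < e"
    have "\<exists>\<delta>>0. \<forall>x\<in>{s..t}. dist x a < \<delta> \<longrightarrow> dist (g x) (g a) < e / 4"
      using gc[unfolded continuous_on_iff, rule_format, OF a, of "e / 4"] e by auto
    then obtain \<delta> where \<delta>: "\<delta> > 0" "\<And>x. x \<in> {s..t} \<Longrightarrow> \<bar>x - a\<bar> < \<delta> \<Longrightarrow> \<bar>g x - g a\<bar> < e / 4"
      by (auto simp: dist_real_def)
    have "(\<lambda>k. c k * (2 * G * (t - s) / \<delta>\<^sup>2)) \<longlonglongrightarrow> 0 * (2 * G * (t - s) / \<delta>\<^sup>2)"
      by (intro tendsto_mult c tendsto_const)
    then have "\<forall>\<^sub>F k in sequentially. c k * (2 * G * (t - s) / \<delta>\<^sup>2) < e / 2"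
      by (rule order_tendstoD(2)) (use e in auto)
    \<comment> \<open>With mass below 2 the part near \<open>a\<close> contributes at most
      \<open>2 * (e / 4)\<close>; the part away from \<open>a\<close> contributes less than
      \<open>e / 2\<close>.\<close>
    moreover have "\<forall>\<^sub>F k in sequentially. integral {s..t} (W k) < 2"
      by (rule order_tendstoD(2)[OF I]) auto
    ultimately have "\<forall>\<^sub>F k in sequentially. norm (D k - 0) < e"
    proof eventually_elim
      case (elim k)
      have "norm (D k) \<le> integral {s..t} (\<lambda>x. W k x * (e / 4) + 2 * G * c k / \<delta>\<^sup>2)"
        unfolding D_def
      proof (rule Henstock_Kurzweil_Integration.integral_norm_bound_integral)
        show "(\<lambda>x. W k x * (g x - g a)) integrable_on {s..t}" by (intro int continuous_intros gc)
        show "(\<lambda>x. W k x * (e / 4) + 2 * G * c k / \<delta>\<^sup>2) integrable_on {s..t}"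
          by (intro integrable_continuous_real continuous_intros Wc)
        fix x assume x: "x \<in> {s..t}"
        show "norm (W k x * (g x - g a)) \<le> W k x * (e / 4) + 2 * G * c k / \<delta>\<^sup>2"
        proof (cases "\<bar>x - a\<bar> < \<delta>")
          case True
          have "norm (W k x * (g x - g a)) \<le> W k x * (e / 4)"
            using \<delta>(2)[OF x True] W0[OF x, of k] unfolding real_norm_def abs_mult by (intro mult_mono) auto
          moreover have "0 \<le> 2 * G * c k / \<delta>\<^sup>2" using G c(2)[of k] by simp
          ultimately show ?thesis by linarith
        next
          case False
          have "\<delta>\<^sup>2 \<le> (x - a)\<^sup>2"
            using power_mono[of \<delta> "\<bar>x - a\<bar>" 2] False \<delta>(1) by simp
          then have "c k / (x - a)\<^sup>2 \<le> c k / \<delta>\<^sup>2"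
            using c(2)[of k] \<delta>(1) by (intro divide_left_mono mult_pos_pos) (auto intro: order_less_le_trans[of 0 "\<delta>\<^sup>2"])
          moreover have "x \<noteq> a" using False \<delta>(1) by auto
          ultimately have "W k x \<le> c k / \<delta>\<^sup>2" using Wle[OF x, of k] by simp
          moreover have "\<bar>g x - g a\<bar> \<le> 2 * G" using G(2)[OF x] G(2)[OF a] by linarith
          ultimately have "norm (W k x * (g x - g a)) \<le> c k / \<delta>\<^sup>2 * (2 * G)"
            unfolding real_norm_def abs_mult using W0[OF x, of k] c(2)[of k] by (intro mult_mono) auto
          moreover have "0 \<le> W k x * (e / 4)" using W0[OF x, of k] e by simp
          ultimately show ?thesis by (simp add: mult_ac)
        qed
      qed
      also have "\<dots> = integral {s..t} (W k) * (e / 4) + (t - s) * (2 * G * c k / \<delta>\<^sup>2)"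
        using int[OF continuous_on_const, of k "e / 4"] a by (subst Henstock_Kurzweil_Integration.integral_add) auto
      also have "\<dots> < 2 * (e / 4) + e / 2"
        using elim e by (intro add_le_less_mono mult_right_mono) (auto simp: mult_ac)
      finally show ?case by simp
    qed
    then show "\<exists>N. \<forall>k\<ge>N. norm (D k - 0) < e" by (simp add: eventually_sequentially)
  qed
  moreover have "integral {s..t} (\<lambda>x. W k x * g x) = D k + integral {s..t} (W k) * g a" for k
  proof -
    have "D k + integral {s..t} (W k) * g a = integral {s..t} (\<lambda>x. W k x * (g x - g a)) + integral {s..t} (\<lambda>x. W k x * g a)"
      by (simp add: D_def)
    also have "\<dots> = integral {s..t} (\<lambda>x. W k x * (g x - g a) + W k x * g a)"
      by (rule Henstock_Kurzweil_Integration.integral_add[symmetric]) (intro int continuous_intros gc)+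
    also have "\<dots> = integral {s..t} (\<lambda>x. W k x * g x)" by (simp add: algebra_simps)
    finally show ?thesis ..
  qed
  ultimately have "(\<lambda>k. integral {s..t} (\<lambda>x. W k x * g x)) \<longlonglongrightarrow> 0 + 1 * g a"
    by (simp only:) (intro tendsto_add tendsto_mult I tendsto_const)
  then show ?thesis by simp
qed

section \<open>Smooth cutoffs of a time interval\<close>

text \<open>The derivative of \<open>exp (- c / y)\<close>, continued by 0. As \<open>c\<close>
  tends to 0 its mass concentrates at 0 from the right, while elsewhere it is at most
  \<open>c / y\<^sup>2\<close>.\<close>

definition bump_dot :: "real \<Rightarrow> real \<Rightarrow> real" where
  "bump_dot c = bump_fun c (bump_deriv c 1)"

lemma bump_dot_deriv: "c > 0 \<Longrightarrow> (bump_fun c 1 has_real_derivative bump_dot c y) (at y)"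
  unfolding bump_dot_def by (rule bump_fun_deriv)

lemma bump_dot_eq: "bump_dot c y = (if y > 0 then c / y\<^sup>2 * exp (- c / y) else 0)"
  by (simp add: bump_dot_def bump_fun_def bump_deriv_def power2_eq_square)

lemma bump_dot_nonneg: "c > 0 \<Longrightarrow> 0 \<le> bump_dot c y"
  by (simp add: bump_dot_eq)

lemma bump_dot_le: "c > 0 \<Longrightarrow> y \<noteq> 0 \<Longrightarrow> bump_dot c y \<le> c / y\<^sup>2"
  by (auto simp: bump_dot_eq intro!: mult_left_le divide_right_mono)

lemma bump_cont: "c > 0 \<Longrightarrow> continuous_on S (bump_fun c P)"
  using bump_fun_deriv by (meson DERIV_continuous_on has_field_derivative_at_within)

lemma bump_mono: "c > 0 \<Longrightarrow> x \<le> y \<Longrightarrow> bump_fun c 1 x \<le> bump_fun c 1 y"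
  by (auto simp: bump_fun_1 divide_left_mono mult_pos_pos)

text \<open>The cutoff is a product of a rising bump at \<open>s\<close> and a falling one at
  \<open>t\<close>. Its derivative is \<open>P - Q\<close>, where \<open>P\<close> and
  \<open>Q\<close> are approximate identities at \<open>s\<close> and \<open>t\<close>; hence the
  limit \<open>g s - g t\<close>. The strict inequalities keep the support compact inside
  \<open>{0<..<T}\<close>.\<close>

lemma interval_cutoff:
  assumes st: "0 < s" "s < t" "t < T"
  obtains \<phi> :: "nat \<Rightarrow> real \<Rightarrow> real" where
    "\<And>k. \<phi> k \<in> test_functions {0<..<T}" "\<And>k x. 0 \<le> \<phi> k x \<and> \<phi> k x \<le> 1"
    "\<And>k x. x \<notin> {s<..<t} \<Longrightarrow> \<phi> k x = 0"
    "\<And>g. continuous_on {s..t} g \<Longrightarrow>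
       (\<lambda>k. LINT r|lebesgue_on {0<..<T}. deriv (\<phi> k) r * g r) \<longlonglongrightarrow> g s - g t"
    "(\<lambda>k. LINT r|lebesgue_on {0<..<T}. \<phi> k r) \<longlonglongrightarrow> t - s"
proof -
  define c where "c k = 1 / real (Suc k)" for k
  have c: "0 < c k" for k by (simp add: c_def)
  have clim: "c \<longlonglongrightarrow> 0" unfolding c_def by (rule LIMSEQ_Suc[OF lim_1_over_n])
  define E where "E k = bump_fun (c k) 1" for k
  define E' where "E' k = bump_dot (c k)" for k
  have Ed: "(E k has_real_derivative E' k y) (at y)" for k y
    unfolding E_def E'_def by (rule bump_dot_deriv[OF c])
  have Edc: "((\<lambda>x. E k (f x)) has_real_derivative E' k (f x) * f') (at x)"
    if "(f has_real_derivative f') (at x)" for f f' x k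
    by (rule DERIV_chain2[where f="E k" and g=f]) (use Ed that in auto)
  have sh: "((\<lambda>x. x - s) has_real_derivative 1) (at x)" "((\<lambda>x. t - x) has_real_derivative - 1) (at x)" for x
    by (auto intro!: derivative_eq_intros)
  have E01: "0 \<le> E k y" "E k y \<le> 1" for k y
    unfolding E_def using bump_fun_1_bounds[OF c] by auto
  have E0: "E k y = 0" if "y \<le> 0" for k y using that by (simp add: E_def bump_fun_1)
  have E'0: "0 \<le> E' k y" for k y unfolding E'_def by (rule bump_dot_nonneg[OF c])
  have Ec: "continuous_on S (E k)" "continuous_on S (E' k)" for S k
    unfolding E_def E'_def bump_dot_def by (rule bump_cont[OF c])+
  have Ecc: "continuous_on S (\<lambda>x. E k (f x))" "continuous_on S (\<lambda>x. E' k (f x))" if "continuous_on S f" for S k and f :: "real \<Rightarrow> real"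
    using that by (auto intro: continuous_on_compose2[OF Ec(1)[of UNIV]] continuous_on_compose2[OF Ec(2)[of UNIV]])
  define \<phi> where "\<phi> k x = E k (x - s) * E k (t - x)" for k x
  define P where "P k x = E' k (x - s) * E k (t - x)" for k x
  define Q where "Q k x = E k (x - s) * E' k (t - x)" for k x
  have \<phi>d: "(\<phi> k has_real_derivative P k x - Q k x) (at x)" for k x
  proof -
    have 1: "((\<lambda>x. E k (x - s)) has_real_derivative E' k (x - s)) (at x)"
      using Edc[OF sh(1)] by simp
    have 2: "((\<lambda>x. E k (t - x)) has_real_derivative - E' k (t - x)) (at x)"
      using Edc[OF sh(2)] by simp
    from DERIV_mult[OF 1 2] show ?thesis unfolding \<phi>_def P_def Q_def by (simp add: algebra_simps)
  qed
  have PQc: "continuous_on S (P k)" "continuous_on S (Q k)" "continuous_on S (\<phi> k)" for S k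
    unfolding P_def Q_def \<phi>_def by (intro continuous_intros Ecc)+
  have PQ0: "0 \<le> P k x" "0 \<le> Q k x" for k x using E01 E'0 by (auto simp: P_def Q_def)
  have Ple: "P k x \<le> c k / (x - s)\<^sup>2" if "x \<noteq> s" for k x
  proof -
    have "P k x \<le> E' k (x - s)" unfolding P_def by (intro mult_left_le E01 E'0)
    also have "\<dots> \<le> c k / (x - s)\<^sup>2" unfolding E'_def by (rule bump_dot_le[OF c]) (use that in auto)
    finally show ?thesis .
  qed
  have Qle: "Q k x \<le> c k / (x - t)\<^sup>2" if "x \<noteq> t" for k x
  proof -
    have "Q k x \<le> E' k (t - x)" unfolding Q_def by (intro mult_left_le_one_le E01 E'0)
    also have "\<dots> \<le> c k / (t - x)\<^sup>2" unfolding E'_def by (rule bump_dot_le[OF c]) (use that in auto)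
    finally show ?thesis by (simp add: power2_commute)
  qed
  have \<phi>0: "\<phi> k x = 0" if "x \<notin> {s<..<t}" for k x
    using that E0 by (auto simp: \<phi>_def not_less)
  have \<phi>test: "\<phi> k \<in> test_functions {0<..<T}" for k
  proof (rule test_functionsI[of _ "{s..t}"])
    have "Ck_on j UNIV (\<lambda>x::real. x \<bullet> 1 + (- s))" "Ck_on j UNIV (\<lambda>x::real. x \<bullet> (- 1) + t)" for j
      by (intro Ck_on_add Ck_on_inner Ck_on_const; simp)+
    then have "Ck_on j UNIV (\<lambda>x::real. E k (x \<bullet> 1 + (- s)) * E k (x \<bullet> (- 1) + t))" for j
      unfolding E_def by (intro Ck_on_mult Ck_on_bump c open_UNIV)
    then show "smooth_on UNIV (\<phi> k)" by (simp add: smooth_on_def \<phi>_def[abs_def] add.commute)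
  qed (use st \<phi>0 in auto)
  have m1: "(\<lambda>k. integral {s..t} (P k)) \<longlonglongrightarrow> 1"
  proof -
    \<comment> \<open>On the left half of the interval the falling factor is at least
      \<open>E k h\<close>, which tends to 1; this bounds the mass of \<open>P\<close> from
      below.\<close>
    define h where "h = (t - s) / 2"
    have h: "h > 0" using st by (simp add: h_def)
    have fe: "((\<lambda>x. E' k (x - s)) has_integral E k (b - s) - E k (s - s)) {s..b}" if "s \<le> b" for k b
    proof (rule fundamental_theorem_of_calculus[OF that])
      fix x
      have "((\<lambda>x. E k (x - s)) has_real_derivative E' k (x - s)) (at x)"
        using Edc[OF sh(1)] by simp
      then show "((\<lambda>x. E k (x - s)) has_vector_derivative E' k (x - s)) (at x within {s..b})"
        by (simp add: has_real_derivative_iff_has_vector_derivative has_vector_derivative_at_within)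
    qed
    have fi: "integral {s..b} (\<lambda>x. E' k (x - s)) = E k (b - s)" if "s \<le> b" for k b
      using integral_unique[OF fe[OF that]] E0[of 0] by simp
    have up: "integral {s..t} (P k) \<le> 1" for k
    proof -
      have "integral {s..t} (P k) \<le> integral {s..t} (\<lambda>x. E' k (x - s))"
        by (intro Henstock_Kurzweil_Integration.integral_le integrable_continuous_real PQc Ecc continuous_intros)
           (auto simp: P_def intro!: mult_left_le E01 E'0)
      then show ?thesis using fi[of t k] st E01(2)[of k "t - s"] by simp
    qed
    have lo: "E k h * E k h \<le> integral {s..t} (P k)" for k
    proof -
      have "E k h * E k h = integral {s..s + h} (\<lambda>x. E' k (x - s) * E k h)"
        using fi[of "s + h" k] h by simp
      also have "\<dots> \<le> integral {s..s + h} (P k)"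
      proof (intro Henstock_Kurzweil_Integration.integral_le integrable_continuous_real PQc Ecc continuous_intros)
        fix x assume "x \<in> {s..s + h}"
        then have "E k h \<le> E k (t - x)" unfolding E_def by (intro bump_mono c) (auto simp: h_def field_simps)
        then show "E' k (x - s) * E k h \<le> P k x" unfolding P_def by (intro mult_left_mono E'0)
      qed
      also have "\<dots> \<le> integral {s..t} (P k)"
        by (intro integral_subset_le integrable_continuous_real PQc) (use st PQ0 in \<open>auto simp: h_def field_simps\<close>)
      finally show ?thesis .
    qed
    have "(\<lambda>k. E k h) \<longlonglongrightarrow> 1" unfolding E_def c_def by (rule bump_fun_1_tendsto[OF h])
    from tendsto_mult[OF this this] have l: "(\<lambda>k. E k h * E k h) \<longlonglongrightarrow> 1" by simp
    show ?thesis
      by (rule tendsto_sandwich[OF _ _ l tendsto_const[of 1]]) (use lo up in auto)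
  qed
  have ftc: "((\<lambda>x. f' x * \<phi> k x + f x * (P k x - Q k x)) has_integral 0) {s..t}"
    if "\<And>x. (f has_real_derivative f' x) (at x)" for f f' k
  proof -
    have "((\<lambda>x. f' x * \<phi> k x + f x * (P k x - Q k x)) has_integral (f t * \<phi> k t - f s * \<phi> k s)) {s..t}"
    proof (rule fundamental_theorem_of_calculus)
      fix x
      have "((\<lambda>x. f x * \<phi> k x) has_real_derivative f' x * \<phi> k x + f x * (P k x - Q k x)) (at x)"
        using DERIV_mult[OF that[of x] \<phi>d[of k x]] by (simp add: algebra_simps)
      then show "((\<lambda>x. f x * \<phi> k x) has_vector_derivative f' x * \<phi> k x + f x * (P k x - Q k x)) (at x within {s..t})"
        by (simp add: has_real_derivative_iff_has_vector_derivative has_vector_derivative_at_within)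
    qed (use st in auto)
    then show ?thesis using \<phi>0[of s k] \<phi>0[of t k] by simp
  qed
  have split: "integral {s..t} (\<lambda>x. (P k x - Q k x) * g x) = integral {s..t} (\<lambda>x. P k x * g x) - integral {s..t} (\<lambda>x. Q k x * g x)"
    if "continuous_on {s..t} g" for g k
    unfolding left_diff_distrib
    by (intro Henstock_Kurzweil_Integration.integral_diff integrable_continuous_real continuous_intros PQc that)
  \<comment> \<open>The cutoff vanishes at both ends, so its derivative \<open>P k - Q k\<close> has
    integral 0 and the masses agree.\<close>
  have "integral {s..t} (P k) = integral {s..t} (Q k)" for k
  proof -
    have "((\<lambda>x. 0 * \<phi> k x + 1 * (P k x - Q k x)) has_integral 0) {s..t}"
      by (rule ftc) auto
    from integral_unique[OF this] split[of "\<lambda>_. 1" k] show ?thesis by simp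
  qed
  with m1 have m2: "(\<lambda>k. integral {s..t} (Q k)) \<longlonglongrightarrow> 1" by simp
  have lim: "(\<lambda>k. integral {s..t} (\<lambda>x. (P k x - Q k x) * g x)) \<longlonglongrightarrow> g s - g t" if g: "continuous_on {s..t} g" for g
    unfolding split[OF g]
  proof (intro tendsto_diff)
    show "(\<lambda>k. integral {s..t} (\<lambda>x. P k x * g x)) \<longlonglongrightarrow> g s"
      by (rule approximate_identity[where c=c]) (use st g PQc PQ0 Ple clim m1 c in \<open>auto intro: less_imp_le\<close>)
    show "(\<lambda>k. integral {s..t} (\<lambda>x. Q k x * g x)) \<longlonglongrightarrow> g t"
      by (rule approximate_identity[where c=c]) (use st g PQc PQ0 Qle clim m2 c in \<open>auto intro: less_imp_le\<close>)
  qed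
  have conv: "(LINT r|lebesgue_on {0<..<T}. f r) = integral {s..t} f"
    if "continuous_on {s..t} f" "\<And>x. x \<notin> {s..t} \<Longrightarrow> f x = 0" for f :: "real \<Rightarrow> real"
  proof -
    have "f = (\<lambda>x. if x \<in> {s..t} then f x else 0)" using that(2) by auto
    then have "(LINT r|lebesgue_on {0<..<T}. f r) = (LINT r|lebesgue_on {0<..<T}. (if r \<in> {s..t} then f r else 0))" by metis
    also have "\<dots> = (LINT r|lebesgue_on {s..t}. f r)"
      by (rule Lebesgue_Measure.integral_restrict) (use st in auto)
    also have "\<dots> = integral {s..t} f"
      by (rule lebesgue_integral_eq_integral[OF continuous_imp_integrable_real[OF that(1)]]) auto
    finally show ?thesis .
  qed
  have PQz: "P k x - Q k x = 0" if "x \<notin> {s..t}" for k x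
    using that E0 by (auto simp: P_def Q_def E'_def bump_dot_eq not_le)
  show ?thesis
  proof (rule that[of \<phi>])
    show "\<phi> k \<in> test_functions {0<..<T}" for k by (rule \<phi>test)
    show "0 \<le> \<phi> k x \<and> \<phi> k x \<le> 1" for k x
      unfolding \<phi>_def using E01 by (auto intro: mult_le_one)
    show "\<phi> k x = 0" if "x \<notin> {s<..<t}" for k x using \<phi>0[OF that] .
    have dv: "deriv (\<phi> k) r = P k r - Q k r" for k r by (rule DERIV_imp_deriv[OF \<phi>d])
    show "(\<lambda>k. LINT r|lebesgue_on {0<..<T}. deriv (\<phi> k) r * g r) \<longlonglongrightarrow> g s - g t" if g: "continuous_on {s..t} g" for g
    proof -
      have "(LINT r|lebesgue_on {0<..<T}. deriv (\<phi> k) r * g r) = integral {s..t} (\<lambda>x. (P k x - Q k x) * g x)" for k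
        unfolding dv by (rule conv) (use PQz in \<open>auto intro!: continuous_intros PQc g\<close>)
      then show ?thesis using lim[OF g] by simp
    qed
    show "(\<lambda>k. LINT r|lebesgue_on {0<..<T}. \<phi> k r) \<longlonglongrightarrow> t - s"
    proof -
      \<comment> \<open>Integration by parts against the identity function reduces the mass of the
        cutoff to the limit already known, with \<open>g x = x\<close>.\<close>
      have "(LINT r|lebesgue_on {0<..<T}. \<phi> k r) = - integral {s..t} (\<lambda>x. (P k x - Q k x) * x)" for k
      proof -
        have "(LINT r|lebesgue_on {0<..<T}. \<phi> k r) = integral {s..t} (\<phi> k)"
          by (rule conv) (use \<phi>0 PQc in auto)
        moreover have "((\<lambda>x. 1 * \<phi> k x + x * (P k x - Q k x)) has_integral 0) {s..t}"
          by (rule ftc) auto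
        from integral_unique[OF this] have "integral {s..t} (\<lambda>x. \<phi> k x + (P k x - Q k x) * x) = 0"
          by (simp add: mult.commute)
        moreover have "integral {s..t} (\<lambda>x. \<phi> k x + (P k x - Q k x) * x) = integral {s..t} (\<phi> k) + integral {s..t} (\<lambda>x. (P k x - Q k x) * x)"
          by (intro Henstock_Kurzweil_Integration.integral_add integrable_continuous_real continuous_intros PQc)
        ultimately show ?thesis by simp
      qed
      moreover have "(\<lambda>k. - integral {s..t} (\<lambda>x. (P k x - Q k x) * x)) \<longlonglongrightarrow> - (s - t)"
        by (intro tendsto_minus lim continuous_intros)
      ultimately show ?thesis by simp
    qed
  qed
qed

text \<open>The hypothesis expresses that the distributional derivative of \<open>g\<close> differs
  from \<open>c\<close> by at most \<open>B\<close> on \<open>{s<..<t}\<close>; the cutoffs of the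
  interval turn this into an increment of \<open>g\<close>.\<close>

lemma weak_mean_value:
  fixes g :: "real \<Rightarrow> real"
  assumes st: "0 \<le> s" "s \<le> t" "t < T" and g: "continuous_on {0..<T} g"
    and weak: "\<And>\<phi>. \<phi> \<in> test_functions {0<..<T} \<Longrightarrow> (\<And>x. 0 \<le> \<phi> x) \<Longrightarrow> (\<And>x. x \<notin> {s<..<t} \<Longrightarrow> \<phi> x = 0) \<Longrightarrow>
      \<bar>(LINT r|lebesgue_on {0<..<T}. deriv \<phi> r * g r) + c * (LINT r|lebesgue_on {0<..<T}. \<phi> r)\<bar>
        \<le> B * (LINT r|lebesgue_on {0<..<T}. \<phi> r)"
  shows "\<bar>g t - g s - c * (t - s)\<bar> \<le> B * (t - s)"
proof (cases "s = t")
  case False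
  then have "s < t" using st by simp
  \<comment> \<open>Cutoffs exist only for intervals starting after 0; continuity from the right
    then admits \<open>s = 0\<close>.\<close>
  have main: "\<bar>g t - g s' - c * (t - s')\<bar> \<le> B * (t - s')" if s': "s < s'" "s' < t" for s'
  proof -
    have "0 < s'" using s' st by simp
    from interval_cutoff[OF this s'(2) st(3)] obtain \<phi> where \<phi>:
      "\<And>k. \<phi> k \<in> test_functions {0<..<T}" "\<And>k x. 0 \<le> \<phi> k x \<and> \<phi> k x \<le> 1"
      "\<And>k x. x \<notin> {s'<..<t} \<Longrightarrow> \<phi> k x = 0"
      "\<And>g. continuous_on {s'..t} g \<Longrightarrow>
         (\<lambda>k::nat. LINT r|lebesgue_on {0<..<T}. deriv (\<phi> k) r * g r) \<longlonglongrightarrow> g s' - g t"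
      "(\<lambda>k. LINT r|lebesgue_on {0<..<T}. \<phi> k r) \<longlonglongrightarrow> t - s'" by blast
    have gc: "continuous_on {s'..t} g" by (rule continuous_on_subset[OF g]) (use st s' in auto)
    have "(\<lambda>k. \<bar>(LINT r|lebesgue_on {0<..<T}. deriv (\<phi> k) r * g r) + c * (LINT r|lebesgue_on {0<..<T}. \<phi> k r)\<bar>)
      \<longlonglongrightarrow> \<bar>g s' - g t + c * (t - s')\<bar>"
      by (intro tendsto_intros \<phi>(4)[OF gc] \<phi>(5))
    moreover have "(\<lambda>k. B * (LINT r|lebesgue_on {0<..<T}. \<phi> k r)) \<longlonglongrightarrow> B * (t - s')"
      by (intro tendsto_intros \<phi>(5))
    moreover have "\<bar>(LINT r|lebesgue_on {0<..<T}. deriv (\<phi> k) r * g r) + c * (LINT r|lebesgue_on {0<..<T}. \<phi> k r)\<bar>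
        \<le> B * (LINT r|lebesgue_on {0<..<T}. \<phi> k r)" for k
      by (rule weak) (use \<phi>(1,2,3) s' in auto)
    ultimately have "\<bar>g s' - g t + c * (t - s')\<bar> \<le> B * (t - s')"
      by (intro LIMSEQ_le) auto
    then show ?thesis by linarith
  qed
  have gs: "(g \<longlongrightarrow> g s) (at_right s)"
  proof -
    have "(g \<longlongrightarrow> g s) (at s within {0..<T})" using g st by (auto simp: continuous_on_def)
    then show ?thesis
    proof (rule filterlim_mono[OF _ order_refl])
      have "at_right s = at s within {s<..<T}" using st by (intro at_within_nhd[of _ "{..<T}"]) auto
      also have "\<dots> \<le> at s within {0..<T}" by (rule at_le) (use st in auto)
      finally show "at_right s \<le> at s within {0..<T}" .
    qed
  qed
  have ev: "\<forall>\<^sub>F s' in at_right s. s < s' \<and> s' < t"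
    using \<open>s < t\<close> by (auto simp: eventually_at_right_field)
  show ?thesis
  proof (rule tendsto_le[OF trivial_limit_at_right_real])
    show "((\<lambda>s'. B * (t - s')) \<longlongrightarrow> B * (t - s)) (at_right s)" by (intro tendsto_intros)
    show "((\<lambda>s'. \<bar>g t - g s' - c * (t - s')\<bar>) \<longlongrightarrow> \<bar>g t - g s - c * (t - s)\<bar>) (at_right s)"
      by (intro tendsto_intros gs)
    show "\<forall>\<^sub>F s' in at_right s. \<bar>g t - g s' - c * (t - s')\<bar> \<le> B * (t - s')"
      using ev by eventually_elim (use main in auto)
  qed
qed simp

text \<open>If \<open>f\<close> is not integrable its integral is 0 by convention, and the bound
  persists. This allows an integrand containing \<open>g'\<close> before its measurability is
  known.\<close>

lemma abs_integral_le:
  fixes f h :: "'a \<Rightarrow> real"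
  assumes "integrable M h" "AE x in M. \<bar>f x\<bar> \<le> h x"
  shows "\<bar>integral\<^sup>L M f\<bar> \<le> integral\<^sup>L M h"
proof (cases "integrable M f")
  case True
  then show ?thesis using dominated_integrable(2)[OF assms(1) _ assms(2)] by auto
next
  case False
  have "0 \<le> integral\<^sup>L M h" by (rule integral_nonneg_AE) (use assms(2) in \<open>auto elim!: eventually_mono\<close>)
  then show ?thesis using False by (simp add: not_integrable_integral_eq)
qed

text \<open>Rests on the completeness of Lebesgue measure.\<close>

lemma lebesgue_on_measurable_AE:
  fixes f g :: "'a::euclidean_space \<Rightarrow> real"
  assumes "S \<in> sets lebesgue" "f \<in> borel_measurable (lebesgue_on S)" "AE x in lebesgue_on S. f x = g x"
  shows "g \<in> borel_measurable (lebesgue_on S)"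
proof (rule borel_measurable_if_D[OF borel_measurable_AE])
  show "(\<lambda>x. if x \<in> S then f x else 0) \<in> borel_measurable lebesgue"
    by (rule borel_measurable_if_I[OF assms(2,1)])
  show "AE x in lebesgue. (if x \<in> S then f x else 0) = (if x \<in> S then g x else 0)"
    using assms(3,1) by (subst (asm) AE_restrict_space_iff) (auto elim!: eventually_mono)
qed

section \<open>The evolution in H1\<close>

context positive_well
begin

lemma H1_inner_test:
  assumes "w \<in> test_functions U" "u \<in> H1 U"
  shows "H1_inner U u w = L2_inner U u (\<lambda>x. w x - laplacian w x)"
  using L2_space.diff_right[OF test_L2[OF assms(1)] laplacian_L2[OF assms(1)] H1_L2[OF assms(2)]]
    dirichlet_test[OF assms] by (simp add: H1_inner_def)

text \<open>The weak derivative is tested with \<open>w - laplacian w\<close> in L2, so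
  \<open>g'\<close> needs no gradient of \<open>v' t\<close>. For almost every \<open>t\<close> the
  gradient exists, and undoing the integration by parts recovers the equation. Continuity comes from
  that of \<open>v\<close> into L2.\<close>

lemma weak_solution_pairing:
  assumes sol: "weak_solution p U T v0 v" and w: "w \<in> test_functions U"
  obtains g' where "continuous_on {0..<T} (\<lambda>t. H1_inner U (v t) w)"
    "\<And>\<phi>. \<phi> \<in> test_functions {0<..<T} \<Longrightarrow>
      (LINT t|lebesgue_on {0<..<T}. deriv \<phi> t * H1_inner U (v t) w) = - (LINT t|lebesgue_on {0<..<T}. \<phi> t * g' t)"
    "AE t in lebesgue_on {0<..<T}. g' t = flow_form p U (v t) w"
proof -
  define \<zeta> where "\<zeta> = (\<lambda>x. w x - laplacian w x)"
  have \<zeta>: "\<zeta> \<in> L2 U" unfolding \<zeta>_def by (intro L2_space.diff test_L2 laplacian_L2 w)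
  have H: "v t \<in> H01 U" if "t \<in> {0..<T}" for t using sol that by (auto simp: weak_solution_def)
  have g: "H1_inner U (v t) w = L2_inner U (v t) \<zeta>" if "t \<in> {0..<T}" for t
    unfolding \<zeta>_def by (rule H1_inner_test[OF w H01_H1[OF H[OF that]]])
  from sol obtain v' where v': "has_weak_time_derivative U T v v'"
    and eq: "AE t in lebesgue_on {0<..<T}. v' t \<in> H1 U \<and>
           (\<forall>w\<in>H01 U.
              integrable (lebesgue_on U) (\<lambda>x. log_source p (v t x) * w x) \<and>
              L2_inner U (v' t) w + L2_inner U (wgrad U (v' t)) (wgrad U w)
                + L2_inner U (wgrad U (v t)) (wgrad U w)
              = L2_inner U (\<lambda>x. log_source p (v t x)) w)"
    unfolding weak_solution_def by blast
  show ?thesis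
  proof (rule that[of "\<lambda>t. L2_inner U (v' t) \<zeta>"])
    show "continuous_on {0..<T} (\<lambda>t. H1_inner U (v t) w)"
      unfolding continuous_on_def
    proof
      fix t assume t: "t \<in> {0..<T}"
      have lim: "((\<lambda>s. Lnorm U 2 (v s - v t) * Lnorm U 2 \<zeta>) \<longlongrightarrow> 0 * Lnorm U 2 \<zeta>) (at t within {0..<T})"
        using sol t by (intro tendsto_mult tendsto_const) (auto simp: weak_solution_def)
      have le: "norm (H1_inner U (v s) w - H1_inner U (v t) w) \<le> Lnorm U 2 (v s - v t) * Lnorm U 2 \<zeta>"
        if s: "s \<in> {0..<T}" for s
      proof -
        note L = H01_L2[OF H[OF s]] H01_L2[OF H[OF t]]
        have "H1_inner U (v s) w - H1_inner U (v t) w = L2_inner U (\<lambda>x. v s x - v t x) \<zeta>"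
          using L2_space.diff_left[OF L \<zeta>] by (simp add: g[OF s] g[OF t])
        then show ?thesis
          using L2_space.Cauchy_Schwarz[OF L2_space.diff[OF L] \<zeta>] by (simp add: L2_nrm fun_diff_def)
      qed
      have "((\<lambda>s. H1_inner U (v s) w - H1_inner U (v t) w) \<longlongrightarrow> 0) (at t within {0..<T})"
        by (rule Lim_null_comparison[of _ "\<lambda>s. Lnorm U 2 (v s - v t) * Lnorm U 2 \<zeta>"])
           (use lim le in \<open>auto simp: eventually_at_filter\<close>)
      then show "((\<lambda>t. H1_inner U (v t) w) \<longlongrightarrow> H1_inner U (v t) w) (at t within {0..<T})"
        by (rule LIM_zero_cancel)
    qed
    fix \<phi> :: "real \<Rightarrow> real" assume \<phi>: "\<phi> \<in> test_functions {0<..<T}"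
    have "(LINT t|lebesgue_on {0<..<T}. deriv \<phi> t * H1_inner U (v t) w) = (LINT t|lebesgue_on {0<..<T}. deriv \<phi> t * L2_inner U (v t) \<zeta>)"
      by (intro Bochner_Integration.integral_cong) (auto simp: g)
    also have "\<dots> = - (LINT t|lebesgue_on {0<..<T}. \<phi> t * L2_inner U (v' t) \<zeta>)"
      using v' \<phi> \<zeta> unfolding has_weak_time_derivative_def by blast
    finally show "(LINT t|lebesgue_on {0<..<T}. deriv \<phi> t * H1_inner U (v t) w) = - (LINT t|lebesgue_on {0<..<T}. \<phi> t * L2_inner U (v' t) \<zeta>)" .
  next
    show "AE t in lebesgue_on {0<..<T}. L2_inner U (v' t) \<zeta> = flow_form p U (v t) w"
      using eq
    proof eventually_elim
      case (elim t)
      have "L2_inner U (v' t) \<zeta> = H1_inner U (v' t) w"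
        unfolding \<zeta>_def using elim by (intro H1_inner_test[symmetric] w) auto
      also have "\<dots> = flow_form p U (v t) w"
        using elim test_H01[OF w] unfolding H1_inner_def flow_form_def dirichlet_def by (simp add: algebra_simps)
      finally show ?case .
    qed
  qed
qed

text \<open>All terms are continuous in \<open>w\<close> with respect to the H1 norm, so density
  suffices. The purpose is to insert the increment of \<open>v\<close> for \<open>w\<close>;
  \<open>c = 0\<close> serves the Lipschitz estimate and \<open>c = t - s\<close> the differential
  one.\<close>

lemma H01_closed_estimate:
  assumes u: "u \<in> H01 U" "s \<in> H01 U" and "0 \<le> K"
    and test: "\<And>w. w \<in> test_functions U \<Longrightarrow> \<bar>H1_inner U u w - c * flow_form p U s w\<bar> \<le> K * gnorm U w"
    and w: "w \<in> H01 U"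
  shows "\<bar>H1_inner U u w - c * flow_form p U s w\<bar> \<le> K * gnorm U w"
proof -
  obtain \<phi> where \<phi>: "\<And>k::nat. \<phi> k \<in> test_functions U" "(\<lambda>k. H1_norm U (\<lambda>x. \<phi> k x - w x)) \<longlonglongrightarrow> 0"
    using H01_dense[OF w] by blast
  note l = H01_dense_norms[OF w \<phi>]
  have d: "(\<lambda>x. \<phi> k x - w x) \<in> H01 U" for k by (rule H01_diff[OF test_H01[OF \<phi>(1)] w])
  \<comment> \<open>\<open>flow_form_estimates\<close> requires a positive radius, also when the
    gradient of \<open>s\<close> vanishes.\<close>
  have "0 < gnorm U s + 1" using gnorm_nonneg[of U s] by simp
  then obtain C where C: "\<And>z. z \<in> H01 U \<Longrightarrow> \<bar>flow_form p U s z\<bar> \<le> C * gnorm U z"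
    using flow_form_estimates[of "gnorm U s + 1"] u(2) by (metis less_add_one order_less_imp_le)
  have "(\<lambda>k. H1_inner U u (\<phi> k) - H1_inner U u w) \<longlonglongrightarrow> 0"
  proof (rule Lim_null_comparison[OF always_eventually])
    show "(\<lambda>k. H1_norm U u * H1_norm U (\<lambda>x. \<phi> k x - w x)) \<longlonglongrightarrow> 0"
      using tendsto_mult[OF tendsto_const[of "H1_norm U u"] \<phi>(2)] by simp
    show "\<forall>k. norm (H1_inner U u (\<phi> k) - H1_inner U u w) \<le> H1_norm U u * H1_norm U (\<lambda>x. \<phi> k x - w x)"
      using H1.Cauchy_Schwarz[OF H01_H1[OF u(1)] H01_H1[OF d]]
        H1.diff_right[OF test_H1[OF \<phi>(1)] H01_H1[OF w] H01_H1[OF u(1)]]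
      by (simp add: H1_nrm)
  qed
  then have 1: "(\<lambda>k. H1_inner U u (\<phi> k)) \<longlonglongrightarrow> H1_inner U u w" by (rule LIM_zero_cancel)
  have "(\<lambda>k. flow_form p U s (\<phi> k) - flow_form p U s w) \<longlonglongrightarrow> 0"
  proof (rule Lim_null_comparison[OF always_eventually])
    show "(\<lambda>k. C * gnorm U (\<lambda>x. \<phi> k x - w x)) \<longlonglongrightarrow> 0"
      using tendsto_mult[OF tendsto_const[of C] l(1)] by simp
    show "\<forall>k. norm (flow_form p U s (\<phi> k) - flow_form p U s w) \<le> C * gnorm U (\<lambda>x. \<phi> k x - w x)"
      using C[OF d] flow_form_diff_right[OF u(2) test_H01[OF \<phi>(1)] w] by simp
  qed
  then have 2: "(\<lambda>k. flow_form p U s (\<phi> k)) \<longlonglongrightarrow> flow_form p U s w" by (rule LIM_zero_cancel)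
  show ?thesis
  proof (rule LIMSEQ_le)
    show "(\<lambda>k. \<bar>H1_inner U u (\<phi> k) - c * flow_form p U s (\<phi> k)\<bar>) \<longlonglongrightarrow> \<bar>H1_inner U u w - c * flow_form p U s w\<bar>"
      by (intro tendsto_intros 1 2)
    show "(\<lambda>k. K * gnorm U (\<phi> k)) \<longlonglongrightarrow> K * gnorm U w"
      by (intro tendsto_intros l)
  qed (use test \<phi>(1) in auto)
qed

text \<open>Only the bound of the source term for almost every \<open>t\<close> enters the first, Lipschitz estimate; it
  then makes \<open>flow_form p U (v t) w\<close> continuous in \<open>t\<close> and yields the second, differential estimate.\<close>

lemma evolution:
  assumes sol: "weak_solution p U T v0 v" and "0 < T"
  obtains R L D where "0 < R" "0 < L" "0 < D"
    "\<And>t. 0 \<le> t \<Longrightarrow> t < T \<Longrightarrow> H1_norm U (v t) \<le> R"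
    "\<And>s t. 0 \<le> s \<Longrightarrow> s \<le> t \<Longrightarrow> t < T \<Longrightarrow> H1_norm U (\<lambda>x. v t x - v s x) \<le> L * (t - s)"
    "\<And>s t w. 0 \<le> s \<Longrightarrow> s \<le> t \<Longrightarrow> t < T \<Longrightarrow> w \<in> H01 U \<Longrightarrow>
      \<bar>H1_inner U (\<lambda>x. v t x - v s x) w - (t - s) * flow_form p U (v s) w\<bar> \<le> D * (t - s)\<^sup>2 * H1_norm U w"
proof -
  let ?M = "lebesgue_on {0<..<T}"
  have H: "v t \<in> H01 U" if "0 \<le> t" "t < T" for t using sol that by (auto simp: weak_solution_def)
  have Hd: "(\<lambda>x. v t x - v s x) \<in> H01 U" if "0 \<le> s" "s < T" "0 \<le> t" "t < T" for s t
    by (intro H01_diff H that)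
  have sp: "AE t in ?M. t \<in> {0<..<T}" using AE_space[of ?M] by simp
  have \<phi>i: "integrable ?M \<phi>" if "\<phi> \<in> test_functions {0<..<T}" for \<phi>
  proof -
    interpret time: bounded_open_set "{0<..<T}" by unfold_locales auto
    show ?thesis by (rule time.L2_integrable[OF time.test_L2[OF that]])
  qed
  obtain K where K: "AE t in ?M. H1_norm U (v t) \<le> K"
    using sol by (auto simp: weak_solution_def bochner_Linf_def)
  define K' where "K' = max K 1"
  have "0 < K'" by (simp add: K'_def)
  then have "\<exists>C>0. \<forall>u\<in>H01 U. \<forall>z\<in>H01 U. gnorm U u \<le> K' \<longrightarrow> \<bar>flow_form p U u z\<bar> \<le> C * gnorm U z"
    by (rule flow_form_estimates) (rule exI, auto)
  then obtain C where C: "0 < C"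
    "\<And>u z. u \<in> H01 U \<Longrightarrow> z \<in> H01 U \<Longrightarrow> gnorm U u \<le> K' \<Longrightarrow> \<bar>flow_form p U u z\<bar> \<le> C * gnorm U z"
    by blast
  have diffw: "H1_inner U (\<lambda>x. v t x - v s x) w = H1_inner U (v t) w - H1_inner U (v s) w"
    if "0 \<le> s" "s < T" "0 \<le> t" "t < T" "w \<in> test_functions U" for s t w
    by (intro H1.diff_left H01_H1 H test_H01 that)
  have lip: "H1_norm U (\<lambda>x. v t x - v s x) \<le> C * (t - s)" if st: "0 \<le> s" "s \<le> t" "t < T" for s t
  proof -
    let ?d = "\<lambda>x. v t x - v s x"
    have d: "?d \<in> H01 U" by (intro Hd) (use st in auto)
    have test: "\<bar>H1_inner U ?d w - 0 * flow_form p U (v s) w\<bar> \<le> C * (t - s) * gnorm U w" if w: "w \<in> test_functions U" for w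
    proof -
      obtain g' where g': "continuous_on {0..<T} (\<lambda>t. H1_inner U (v t) w)"
        "\<And>\<phi>. \<phi> \<in> test_functions {0<..<T} \<Longrightarrow>
          (LINT t|?M. deriv \<phi> t * H1_inner U (v t) w) = - (LINT t|?M. \<phi> t * g' t)"
        "AE t in ?M. g' t = flow_form p U (v t) w"
        using weak_solution_pairing[OF sol w] by blast
      have bd: "AE r in ?M. \<bar>g' r\<bar> \<le> C * gnorm U w"
        using g'(3) K sp
      proof eventually_elim
        case (elim r)
        have "gnorm U (v r) \<le> K'" using elim(2) gnorm_le_H1_norm[of U "v r"] by (simp add: K'_def)
        then show ?case unfolding elim(1) using elim(3) by (intro C(2) H test_H01 w) auto
      qed
      have "\<bar>H1_inner U (v t) w - H1_inner U (v s) w - 0 * (t - s)\<bar> \<le> C * gnorm U w * (t - s)"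
      proof (rule weak_mean_value[OF st g'(1)])
        fix \<phi> :: "real \<Rightarrow> real"
        assume \<phi>: "\<phi> \<in> test_functions {0<..<T}" "\<And>x. 0 \<le> \<phi> x"
        have "\<bar>LINT r|?M. \<phi> r * g' r\<bar> \<le> (LINT r|?M. C * gnorm U w * \<phi> r)"
        proof (rule abs_integral_le)
          show "integrable ?M (\<lambda>r. C * gnorm U w * \<phi> r)" using \<phi>i[OF \<phi>(1)] by simp
          show "AE r in ?M. \<bar>\<phi> r * g' r\<bar> \<le> C * gnorm U w * \<phi> r"
            using bd
          proof eventually_elim
            case (elim r)
            from mult_left_mono[OF this \<phi>(2)[of r]] show ?case
              using \<phi>(2)[of r] by (simp add: abs_mult mult_ac)
          qed
        qed
        then show "\<bar>(LINT r|?M. deriv \<phi> r * H1_inner U (v r) w) + 0 * (LINT r|?M. \<phi> r)\<bar> \<le> C * gnorm U w * (LINT r|?M. \<phi> r)"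
          using g'(2)[OF \<phi>(1)] by simp
      qed
      then show ?thesis using diffw[of s t w] st w by (simp add: mult_ac)
    qed
    have Cts: "0 \<le> C * (t - s)" using C(1) st by simp
    \<comment> \<open>With the increment as its own test element the left side is its squared norm,
      and one factor cancels.\<close>
    have "\<bar>H1_inner U ?d ?d - 0 * flow_form p U (v s) ?d\<bar> \<le> C * (t - s) * gnorm U ?d"
      by (rule H01_closed_estimate[OF d H Cts test d]) (use st in auto)
    then have "(H1_norm U ?d)\<^sup>2 \<le> C * (t - s) * gnorm U ?d"
      using H1.nrm_sq[OF H01_H1[OF d]] by (simp add: H1_nrm)
    also have "\<dots> \<le> C * (t - s) * H1_norm U ?d" by (intro mult_left_mono gnorm_le_H1_norm Cts)
    finally have "H1_norm U ?d * H1_norm U ?d \<le> C * (t - s) * H1_norm U ?d" by (simp add: power2_eq_square)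
    then show ?thesis
      using Cts H1_norm_nonneg[of U ?d] by (cases "H1_norm U ?d = 0") (auto simp: mult_le_cancel_right)
  qed
  \<comment> \<open>The Lipschitz estimate gives a bound at every time, whereas \<open>K\<close>
    bounds the norm only almost everywhere.\<close>
  define R where "R = H1_norm U (v 0) + C * T + 1"
  have R: "0 < R" using C(1) \<open>0 < T\<close> H1_norm_nonneg[of U "v 0"] by (auto simp: R_def intro!: add_nonneg_pos add_nonneg_nonneg)
  have vR: "H1_norm U (v t) \<le> R" if t: "0 \<le> t" "t < T" for t
  proof -
    have "\<bar>H1_norm U (v t) - H1_norm U (v 0)\<bar> \<le> H1_norm U (\<lambda>x. v t x - v 0 x)"
      using H1.nrm_diff_bound[OF H01_H1 H01_H1, OF H[OF t] H[of 0]] \<open>0 < T\<close> by (simp add: H1_nrm)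
    also have "\<dots> \<le> C * (t - 0)" by (rule lip) (use t in auto)
    also have "\<dots> \<le> C * T" using t C(1) by simp
    finally show ?thesis by (simp add: R_def)
  qed
  have gR: "gnorm U (v t) \<le> R" if "0 \<le> t" "t < T" for t
    using gnorm_le_H1_norm[of U "v t"] vR[OF that] by simp
  have "\<exists>B>0. \<forall>u\<in>H01 U. \<forall>w\<in>H01 U. \<forall>z\<in>H01 U. gnorm U u \<le> R \<longrightarrow> gnorm U w \<le> R
      \<longrightarrow> \<bar>flow_form p U u z - flow_form p U w z\<bar> \<le> B * gnorm U (\<lambda>x. u x - w x) * gnorm U z"
    by (rule flow_form_estimates[OF R]) (rule exI, auto)
  then obtain B where B: "0 < B"
    "\<And>u w z. u \<in> H01 U \<Longrightarrow> w \<in> H01 U \<Longrightarrow> z \<in> H01 U \<Longrightarrow> gnorm U u \<le> R \<Longrightarrow> gnorm U w \<le> R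
      \<Longrightarrow> \<bar>flow_form p U u z - flow_form p U w z\<bar> \<le> B * gnorm U (\<lambda>x. u x - w x) * gnorm U z"
    by blast
  define D where "D = B * C"
  have D: "0 < D" using B(1) C(1) by (simp add: D_def)
  have flip: "\<bar>flow_form p U (v r) z - flow_form p U (v s) z\<bar> \<le> D * (r - s) * gnorm U z"
    if "0 \<le> s" "s \<le> r" "r < T" "z \<in> H01 U" for r s z
  proof -
    have "\<bar>flow_form p U (v r) z - flow_form p U (v s) z\<bar> \<le> B * gnorm U (\<lambda>x. v r x - v s x) * gnorm U z"
      by (intro B(2) H gR) (use that in auto)
    also have "\<dots> \<le> B * (C * (r - s)) * gnorm U z"
      using lip[OF that(1-3)] gnorm_le_H1_norm[of U "\<lambda>x. v r x - v s x"] B(1)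
      by (intro mult_right_mono mult_left_mono gnorm_nonneg) auto
    finally show ?thesis by (simp add: D_def mult.assoc)
  qed
  have second: "\<bar>H1_inner U (\<lambda>x. v t x - v s x) w - (t - s) * flow_form p U (v s) w\<bar> \<le> D * (t - s)\<^sup>2 * gnorm U w"
    if st: "0 \<le> s" "s \<le> t" "t < T" and wH: "w \<in> H01 U" for s t w
  proof (rule H01_closed_estimate[OF _ _ _ _ wH])
    show "(\<lambda>x. v t x - v s x) \<in> H01 U" "v s \<in> H01 U" by (intro Hd H; use st in simp)+
    show "0 \<le> D * (t - s)\<^sup>2" using D by simp
    fix w assume w: "w \<in> test_functions U"
    obtain g' where g': "continuous_on {0..<T} (\<lambda>t. H1_inner U (v t) w)"
      "\<And>\<phi>. \<phi> \<in> test_functions {0<..<T} \<Longrightarrow>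
        (LINT t|?M. deriv \<phi> t * H1_inner U (v t) w) = - (LINT t|?M. \<phi> t * g' t)"
      "AE t in ?M. g' t = flow_form p U (v t) w"
      using weak_solution_pairing[OF sol w] by blast
    define h where "h r = flow_form p U (v r) w" for r
    have hlip: "\<bar>h r - h s\<bar> \<le> D * gnorm U w * \<bar>r - s\<bar>" if "0 \<le> s" "s < T" "0 \<le> r" "r < T" for r s
      using flip[of s r w] flip[of r s w] that test_H01[OF w]
      by (cases "s \<le> r") (auto simp: h_def mult_ac abs_minus_commute)
    have hc: "continuous_on {0<..<T} h"
    proof -
      have "(D * gnorm U w)-lipschitz_on {0<..<T} h"
        using hlip D by (intro lipschitz_onI) (auto simp: dist_real_def gnorm_nonneg)
      then show ?thesis by (rule lipschitz_on_continuous_on)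
    qed
    have hm: "h \<in> borel_measurable ?M"
      by (rule continuous_imp_measurable_on_sets_lebesgue[OF hc]) auto
    have g'h: "AE r in ?M. h r = g' r" using g'(3) by (auto simp: h_def elim!: eventually_mono)
    \<comment> \<open>Exchanging \<open>g'\<close> for \<open>h\<close> under the integral needs
      both to be measurable; \<open>h\<close> is continuous by the Lipschitz estimate, and
      \<open>g'\<close> agrees with it almost everywhere.\<close>
    have g'm: "g' \<in> borel_measurable ?M"
      by (rule lebesgue_on_measurable_AE[OF _ hm g'h]) auto
    let ?c = "flow_form p U (v s) w"
    let ?B = "D * (t - s) * gnorm U w"
    have "\<bar>H1_inner U (v t) w - H1_inner U (v s) w - ?c * (t - s)\<bar> \<le> ?B * (t - s)"
    proof (rule weak_mean_value[OF st g'(1)])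
      fix \<phi> :: "real \<Rightarrow> real"
      assume \<phi>: "\<phi> \<in> test_functions {0<..<T}" "\<And>x. 0 \<le> \<phi> x" "\<And>x. x \<notin> {s<..<t} \<Longrightarrow> \<phi> x = 0"
      have \<phi>m: "\<phi> \<in> borel_measurable ?M" by (rule test_measurable_on[OF \<phi>(1)])
      have le: "\<bar>\<phi> r * h r - ?c * \<phi> r\<bar> \<le> ?B * \<phi> r" for r
      proof (cases "r \<in> {s<..<t}")
        case True
        have "\<bar>h r - ?c\<bar> \<le> D * (r - s) * gnorm U w"
          unfolding h_def by (rule flip) (use True st test_H01[OF w] in auto)
        also have "\<dots> \<le> ?B" using True D by (intro mult_right_mono mult_left_mono gnorm_nonneg) auto
        finally have "\<phi> r * \<bar>h r - ?c\<bar> \<le> \<phi> r * ?B" by (rule mult_left_mono[OF _ \<phi>(2)])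
        moreover have "\<bar>\<phi> r * h r - ?c * \<phi> r\<bar> = \<phi> r * \<bar>h r - ?c\<bar>"
          using \<phi>(2)[of r] abs_mult[of "\<phi> r" "h r - ?c"] by (simp add: right_diff_distrib mult.commute)
        ultimately show ?thesis by (simp add: mult.commute)
      next
        case False
        then show ?thesis using \<phi>(3) by simp
      qed
      have Bi: "integrable ?M (\<lambda>r. ?B * \<phi> r)" using \<phi>i[OF \<phi>(1)] by simp
      have dom: "integrable ?M (\<lambda>r. \<phi> r * h r - ?c * \<phi> r)"
        "\<bar>LINT r|?M. \<phi> r * h r - ?c * \<phi> r\<bar> \<le> (LINT r|?M. ?B * \<phi> r)"
        using dominated_integrable[OF Bi _ AE_I2[OF le]] \<phi>m hm by auto
      have hi: "integrable ?M (\<lambda>r. \<phi> r * h r)"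
        using Bochner_Integration.integrable_add[OF dom(1) integrable_mult_right[OF \<phi>i[OF \<phi>(1)], of ?c]] by simp
      have "(LINT r|?M. \<phi> r * g' r) = (LINT r|?M. \<phi> r * h r)"
        using \<phi>m hm g'm g'h by (intro integral_cong_AE) (auto elim!: eventually_mono)
      also have "\<dots> = (LINT r|?M. \<phi> r * h r - ?c * \<phi> r) + ?c * (LINT r|?M. \<phi> r)"
        using hi \<phi>i[OF \<phi>(1)] by simp
      finally have "(LINT r|?M. deriv \<phi> r * H1_inner U (v r) w) + ?c * (LINT r|?M. \<phi> r)
        = - (LINT r|?M. \<phi> r * h r - ?c * \<phi> r)"
        using g'(2)[OF \<phi>(1)] by linarith
      then show "\<bar>(LINT r|?M. deriv \<phi> r * H1_inner U (v r) w) + ?c * (LINT r|?M. \<phi> r)\<bar> \<le> ?B * (LINT r|?M. \<phi> r)"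
        using dom(2) by simp
    qed
    then show "\<bar>H1_inner U (\<lambda>x. v t x - v s x) w - (t - s) * flow_form p U (v s) w\<bar> \<le> D * (t - s)\<^sup>2 * gnorm U w"
      using diffw[of s t w] st w by (simp add: power2_eq_square mult_ac)
  qed
  show ?thesis
  proof (rule that[OF R C(1) D vR lip])
    fix s t w assume st: "0 \<le> s" "s \<le> t" "t < T" "w \<in> H01 U"
    have "D * (t - s)\<^sup>2 * gnorm U w \<le> D * (t - s)\<^sup>2 * H1_norm U w"
      using D by (intro mult_left_mono gnorm_le_H1_norm) auto
    with second[OF st] show "\<bar>H1_inner U (\<lambda>x. v t x - v s x) w - (t - s) * flow_form p U (v s) w\<bar> \<le> D * (t - s)\<^sup>2 * H1_norm U w"
      by linarith
  qed
qed

end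

section \<open>Exponential decay\<close>

text \<open>Cutting \<open>{a..b}\<close> into \<open>n\<close> equal steps bounds the total
  increase by \<open>C * (b - a)\<^sup>2 / n\<close>, which tends to 0.\<close>

lemma nonincreasing_if_quadratic_increments:
  fixes e :: "real \<Rightarrow> real"
  assumes "a \<le> b" and q: "\<And>s t. a \<le> s \<Longrightarrow> s \<le> t \<Longrightarrow> t \<le> b \<Longrightarrow> e t - e s \<le> C * (t - s)\<^sup>2"
  shows "e b \<le> e a"
proof -
  have le: "e b - e a \<le> C * (b - a)\<^sup>2 * (1 / real (Suc n))" for n
  proof -
    define h where "h = (b - a) / real (Suc n)"
    have h: "0 \<le> h" "real (Suc n) * h = b - a" using assms(1) by (auto simp: h_def)
    have "e (a + real i * h) - e a \<le> real i * (C * h\<^sup>2)" if "i \<le> Suc n" for i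
      using that
    proof (induction i)
      case (Suc i)
      have "real (Suc i) * h \<le> real (Suc n) * h" using Suc.prems h(1) by (intro mult_right_mono) auto
      then have "a + real (Suc i) * h \<le> b" using h(2) by simp
      moreover have "a + real i * h \<le> a + real (Suc i) * h" using h(1) by (simp add: distrib_right)
      ultimately have "e (a + real (Suc i) * h) - e (a + real i * h) \<le> C * (a + real (Suc i) * h - (a + real i * h))\<^sup>2"
        using h(1) by (intro q) auto
      also have "a + real (Suc i) * h - (a + real i * h) = h" by (simp add: algebra_simps)
      finally show ?case using Suc by (simp add: algebra_simps)
    qed simp
    from this[of "Suc n"] have "e b - e a \<le> real (Suc n) * (C * h\<^sup>2)" using h(2) by simp
    also have "\<dots> = C * ((real (Suc n) * h) * h)" by (simp add: power2_eq_square mult_ac)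
    also have "\<dots> = C * (b - a)\<^sup>2 * (1 / real (Suc n))" unfolding h(2) by (simp add: h_def power2_eq_square)
    finally show ?thesis .
  qed
  have "(\<lambda>n. C * (b - a)\<^sup>2 * (1 / real (Suc n))) \<longlonglongrightarrow> C * (b - a)\<^sup>2 * 0"
    by (intro tendsto_mult tendsto_const LIMSEQ_Suc[OF lim_1_over_n])
  then have "e b - e a \<le> C * (b - a)\<^sup>2 * 0"
    by (rule LIMSEQ_le_const) (use le in blast)
  then show ?thesis by simp
qed

context bounded_open_set
begin

text \<open>The initial condition identifies \<open>v 0\<close> and \<open>v0\<close> only almost
  everywhere. Both have the same weak gradients, so even the choice made by \<open>wgrad\<close> is
  the same.\<close>

lemma functionals_AE:
  assumes u: "u \<in> L2 U" "w \<in> L2 U" and AE: "AE x in lebesgue_on U. u x = w x"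
  shows "nehari_I p U u = nehari_I p U w" "energy_J p U u = energy_J p U w"
proof -
  note m = L2_measurable[OF u(1)] L2_measurable[OF u(2)]
  have "(LINT x|lebesgue_on U. u x * frechet_derivative \<phi> (at x) b) = (LINT x|lebesgue_on U. w x * frechet_derivative \<phi> (at x) b)"
    if "\<phi> \<in> test_functions U" "b \<in> Basis" for \<phi> b
    using m test_measurable_on[OF test_deriv[OF that]] AE
    by (intro integral_cong_AE) (auto elim!: eventually_mono)
  then have "has_weak_gradient U u = has_weak_gradient U w"
    unfolding has_weak_gradient_def fun_eq_iff by (metis (mono_tags, lifting))
  then have g: "wgrad U u = wgrad U w" by (simp add: wgrad_def)
  have 1: "(LINT x|lebesgue_on U. \<bar>u x\<bar> powr (1 + p) * ln \<bar>u x\<bar>) = (LINT x|lebesgue_on U. \<bar>w x\<bar> powr (1 + p) * ln \<bar>w x\<bar>)"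
    using m AE by (intro integral_cong_AE) (auto elim!: eventually_mono)
  have 2: "Lnorm U (1 + p) u = Lnorm U (1 + p) w"
  proof -
    have "(LINT x|lebesgue_on U. norm (u x) powr (1 + p)) = (LINT x|lebesgue_on U. norm (w x) powr (1 + p))"
      using m AE by (intro integral_cong_AE) (auto elim!: eventually_mono)
    then show ?thesis by (simp add: Lnorm_def)
  qed
  show "nehari_I p U u = nehari_I p U w" "energy_J p U u = energy_J p U w"
    unfolding nehari_I_def energy_J_def g 1 2 by simp_all
qed

end

context positive_well
begin

text \<open>Incremental forms of: the energy decreases at the rate of the squared H1 speed; the
  squared H1 norm has derivative \<open>- 2 * I\<close>; \<open>I\<close> and \<open>v\<close> are
  Lipschitz in time; and \<open>I\<close> is at most speed times norm. The first is multiplied by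
  \<open>t - s\<close>, since the equation is tested with the increment and not with a
  quotient.\<close>

lemma evolution_estimates:
  assumes sol: "weak_solution p U T v0 v" and "0 < T"
  obtains A where "0 < A"
    "\<And>s t. 0 \<le> s \<Longrightarrow> s \<le> t \<Longrightarrow> t < T \<Longrightarrow>
      (t - s) * (energy_J p U (v t) - energy_J p U (v s)) \<le> - (H1_norm U (\<lambda>x. v t x - v s x))\<^sup>2 + A * (t - s) ^ 3"
    "\<And>s t. 0 \<le> s \<Longrightarrow> s \<le> t \<Longrightarrow> t < T \<Longrightarrow>
      (H1_norm U (v t))\<^sup>2 - (H1_norm U (v s))\<^sup>2 \<le> - 2 * (t - s) * nehari_I p U (v s) + A * (t - s)\<^sup>2"
    "\<And>s t. 0 \<le> s \<Longrightarrow> s \<le> t \<Longrightarrow> t < T \<Longrightarrow> \<bar>nehari_I p U (v t) - nehari_I p U (v s)\<bar> \<le> A * (t - s)"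
    "\<And>s t. 0 \<le> s \<Longrightarrow> s \<le> t \<Longrightarrow> t < T \<Longrightarrow> H1_norm U (\<lambda>x. v t x - v s x) \<le> A * (t - s)"
    "\<And>s t. 0 \<le> s \<Longrightarrow> s \<le> t \<Longrightarrow> t < T \<Longrightarrow>
      (t - s) * nehari_I p U (v s) \<le> H1_norm U (\<lambda>x. v t x - v s x) * H1_norm U (v s) + A * (t - s)\<^sup>2"
proof -
  obtain R L D where R: "0 < R" "0 < L" "0 < D"
    and vR: "\<And>t. 0 \<le> t \<Longrightarrow> t < T \<Longrightarrow> H1_norm U (v t) \<le> R"
    and vL: "\<And>s t. 0 \<le> s \<Longrightarrow> s \<le> t \<Longrightarrow> t < T \<Longrightarrow> H1_norm U (\<lambda>x. v t x - v s x) \<le> L * (t - s)"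
    and vD: "\<And>s t w. 0 \<le> s \<Longrightarrow> s \<le> t \<Longrightarrow> t < T \<Longrightarrow> w \<in> H01 U \<Longrightarrow>
      \<bar>H1_inner U (\<lambda>x. v t x - v s x) w - (t - s) * flow_form p U (v s) w\<bar> \<le> D * (t - s)\<^sup>2 * H1_norm U w"
    using evolution[OF assms] by blast
  obtain C where C: "0 < C"
    "\<And>u z. u \<in> H01 U \<Longrightarrow> z \<in> H01 U \<Longrightarrow> gnorm U u \<le> R \<Longrightarrow> \<bar>flow_form p U u z\<bar> \<le> C * gnorm U z"
    "\<And>u w z. u \<in> H01 U \<Longrightarrow> w \<in> H01 U \<Longrightarrow> z \<in> H01 U \<Longrightarrow> gnorm U u \<le> R \<Longrightarrow> gnorm U w \<le> R
      \<Longrightarrow> \<bar>flow_form p U u z - flow_form p U w z\<bar> \<le> C * gnorm U (\<lambda>x. u x - w x) * gnorm U z"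
    "\<And>u w. u \<in> H01 U \<Longrightarrow> w \<in> H01 U \<Longrightarrow> gnorm U u \<le> R \<Longrightarrow> gnorm U w \<le> R
      \<Longrightarrow> \<bar>energy_J p U w - energy_J p U u + flow_form p U u (\<lambda>x. w x - u x)\<bar> \<le> C * (gnorm U (\<lambda>x. w x - u x))\<^sup>2"
    using flow_form_estimates[OF R(1)] by blast
  have H: "v t \<in> H01 U" if "0 \<le> t" "t < T" for t using sol that by (auto simp: weak_solution_def)
  have gR: "gnorm U (v t) \<le> R" if "0 \<le> t" "t < T" for t
    using gnorm_le_H1_norm[of U "v t"] vR[OF that] by simp
  \<comment> \<open>A sum of the constants of the individual estimates, so that one \<open>A\<close>
    serves them all.\<close>
  define A where "A = (C * L\<^sup>2 + D * L) + (2 * D * R + L\<^sup>2) + C * L * (1 + R) + L"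
  have nn: "0 \<le> C * L\<^sup>2 + D * L" "0 \<le> 2 * D * R + L\<^sup>2" "0 \<le> C * L * (1 + R)" "0 \<le> D * R"
    using R C(1) by (auto intro!: add_nonneg_nonneg mult_nonneg_nonneg)
  have A: "0 < A" "C * L\<^sup>2 + D * L \<le> A" "2 * D * R + L\<^sup>2 \<le> A" "C * L * (1 + R) \<le> A" "L \<le> A" "D * R \<le> A"
    using nn R(2) zero_le_power2[of L] unfolding A_def by linarith+
  show ?thesis
  proof (rule that[OF A(1)])
    fix s t assume st: "0 \<le> s" "s \<le> t" "t < T"
    then have s: "s < T" and t: "0 \<le> t" by auto
    let ?d = "\<lambda>x. v t x - v s x"
    let ?h = "t - s"
    have h: "0 \<le> ?h" using st by simp
    have d: "?d \<in> H01 U" by (rule H01_diff[OF H[OF t st(3)] H[OF st(1) s]])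
    note vs = H[OF st(1) s] and vt = H[OF t st(3)]
    note gs = gR[OF st(1) s] and gt = gR[OF t st(3)]
    have N: "H1_norm U ?d \<le> L * ?h" by (rule vL[OF st])
    have g: "gnorm U ?d \<le> L * ?h" using N gnorm_le_H1_norm[of U ?d] by linarith
    have N2: "(H1_norm U ?d)\<^sup>2 \<le> L\<^sup>2 * ?h\<^sup>2"
      using power_mono[OF N H1_norm_nonneg, of 2] by (simp add: power_mult_distrib)
    have g2: "(gnorm U ?d)\<^sup>2 \<le> L\<^sup>2 * ?h\<^sup>2"
      using power_mono[OF g gnorm_nonneg, of 2] by (simp add: power_mult_distrib)
    show "?h * (energy_J p U (v t) - energy_J p U (v s)) \<le> - (H1_norm U ?d)\<^sup>2 + A * ?h ^ 3"
    proof -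
      have "energy_J p U (v t) - energy_J p U (v s) \<le> - flow_form p U (v s) ?d + C * (gnorm U ?d)\<^sup>2"
        using C(4)[OF vs vt gs gt] by linarith
      also have "\<dots> \<le> - flow_form p U (v s) ?d + C * (L\<^sup>2 * ?h\<^sup>2)"
        using g2 C(1) by simp
      finally have "?h * (energy_J p U (v t) - energy_J p U (v s)) \<le> ?h * (- flow_form p U (v s) ?d + C * (L\<^sup>2 * ?h\<^sup>2))"
        by (rule mult_left_mono[OF _ h])
      also have "\<dots> = - (?h * flow_form p U (v s) ?d) + C * L\<^sup>2 * ?h ^ 3"
        by (simp add: power2_eq_square power3_eq_cube algebra_simps)
      finally have 1: "?h * (energy_J p U (v t) - energy_J p U (v s)) \<le> - (?h * flow_form p U (v s) ?d) + C * L\<^sup>2 * ?h ^ 3" .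
      have "D * ?h\<^sup>2 * H1_norm U ?d \<le> D * ?h\<^sup>2 * (L * ?h)"
        using N R(3) by (intro mult_left_mono) auto
      also have "\<dots> = D * L * ?h ^ 3" by (simp add: power2_eq_square power3_eq_cube mult_ac)
      finally have 2: "H1_inner U ?d ?d - ?h * flow_form p U (v s) ?d \<le> D * L * ?h ^ 3"
        using vD[OF st d] by linarith
      have 3: "H1_inner U ?d ?d = (H1_norm U ?d)\<^sup>2"
        using H1.nrm_sq[OF H01_H1[OF d]] by (simp add: H1_nrm)
      have "(C * L\<^sup>2 + D * L) * ?h ^ 3 \<le> A * ?h ^ 3" using A(2) h by (intro mult_right_mono) auto
      then show ?thesis using 1 2 unfolding 3 by (simp add: distrib_right)
    qed
    have inn: "\<bar>H1_inner U ?d (v s) + ?h * nehari_I p U (v s)\<bar> \<le> D * R * ?h\<^sup>2"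
    proof -
      have "D * ?h\<^sup>2 * H1_norm U (v s) \<le> D * ?h\<^sup>2 * R"
        using vR[OF st(1) s] R(3) by (intro mult_left_mono) auto
      then show ?thesis using vD[OF st vs] by (simp add: nehari_I_flow mult_ac)
    qed
    show "(H1_norm U (v t))\<^sup>2 - (H1_norm U (v s))\<^sup>2 \<le> - 2 * ?h * nehari_I p U (v s) + A * ?h\<^sup>2"
    proof -
      have "H1_inner U (v t) (v t) = H1_inner U (\<lambda>x. v s x + 1 * ?d x) (\<lambda>x. v s x + 1 * ?d x)" by simp
      also have "\<dots> = H1_inner U (v s) (v s) + 2 * H1_inner U (v s) ?d + H1_inner U ?d ?d"
        using H1.expand[OF H01_H1[OF vs] H01_H1[OF d], of 1] by simp
      finally have "(H1_norm U (v t))\<^sup>2 - (H1_norm U (v s))\<^sup>2 = 2 * H1_inner U ?d (v s) + (H1_norm U ?d)\<^sup>2"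
        using H1.nrm_sq[OF H01_H1[OF d]] H1.nrm_sq[OF H01_H1[OF vs]] H1.nrm_sq[OF H01_H1[OF vt]] H1.sym[of ?d "v s"]
        by (simp add: H1_nrm)
      also have "\<dots> \<le> 2 * (- (?h * nehari_I p U (v s)) + D * R * ?h\<^sup>2) + L\<^sup>2 * ?h\<^sup>2"
      proof -
        have "H1_inner U ?d (v s) \<le> - (?h * nehari_I p U (v s)) + D * R * ?h\<^sup>2"
          using abs_le_D1[OF inn] by simp
        with N2 show ?thesis by (intro add_mono mult_left_mono) auto
      qed
      also have "\<dots> = - 2 * ?h * nehari_I p U (v s) + (2 * D * R + L\<^sup>2) * ?h\<^sup>2" by (simp add: algebra_simps)
      also have "\<dots> \<le> - 2 * ?h * nehari_I p U (v s) + A * ?h\<^sup>2"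
        using A(3) by (intro add_left_mono mult_right_mono) auto
      finally show ?thesis .
    qed
    show "\<bar>nehari_I p U (v t) - nehari_I p U (v s)\<bar> \<le> A * ?h"
    proof -
      \<comment> \<open>Both arguments vary: the change in the second is bounded by boundedness of
        the form, that in the first by its Lipschitz continuity.\<close>
      have "flow_form p U (v t) (v t) - flow_form p U (v s) (v s) =
          flow_form p U (v t) ?d + (flow_form p U (v t) (v s) - flow_form p U (v s) (v s))"
        using flow_form_diff_right[OF vt vt vs] by simp
      moreover have "\<bar>flow_form p U (v t) ?d\<bar> \<le> C * (L * ?h)"
        using C(2)[OF vt d gt] mult_left_mono[OF g, of C] C(1) by linarith
      moreover have "\<bar>flow_form p U (v t) (v s) - flow_form p U (v s) (v s)\<bar> \<le> C * (L * ?h) * R"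
      proof -
        have "C * gnorm U ?d * gnorm U (v s) \<le> C * (L * ?h) * R"
          using g gs C(1) gnorm_nonneg R h by (intro mult_mono) auto
        then show ?thesis using C(3)[OF vt vs vs gt gs] by linarith
      qed
      ultimately have "\<bar>nehari_I p U (v t) - nehari_I p U (v s)\<bar> \<le> C * (L * ?h) + C * (L * ?h) * R"
        unfolding nehari_I_flow by linarith
      also have "\<dots> = C * L * (1 + R) * ?h" by (simp add: algebra_simps)
      also have "\<dots> \<le> A * ?h" using A(4) h by (rule mult_right_mono)
      finally show ?thesis .
    qed
    show "H1_norm U ?d \<le> A * ?h" using N mult_right_mono[OF A(5) h] by linarith
    show "?h * nehari_I p U (v s) \<le> H1_norm U ?d * H1_norm U (v s) + A * ?h\<^sup>2"
    proof -
      have "\<bar>H1_inner U ?d (v s)\<bar> \<le> H1_norm U ?d * H1_norm U (v s)"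
        using H1.Cauchy_Schwarz[OF H01_H1[OF d] H01_H1[OF vs]] by (simp add: H1_nrm)
      moreover have "D * R * ?h\<^sup>2 \<le> A * ?h\<^sup>2" using A(6) by (intro mult_right_mono) auto
      ultimately show ?thesis using inn by linarith
    qed
  qed
qed

section \<open>Invariance of the well and decay\<close>

context
  fixes v0 v
  assumes sol: "global_weak_solution p U v0 v"
    and I0: "0 < nehari_I p U (v 0)" and J0: "energy_J p U (v 0) = d"
begin

lemma sol_on: "0 < T \<Longrightarrow> weak_solution p U T v0 v"
  using sol by (simp add: global_weak_solution_def)

lemma sol_H01: "0 \<le> t \<Longrightarrow> v t \<in> H01 U"
  using sol_on[of "t + 1"] by (auto simp: weak_solution_def)

lemma energy_antimono:
  assumes "0 \<le> s" "s \<le> t"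
  shows "energy_J p U (v t) \<le> energy_J p U (v s)"
proof -
  have T: "0 < t + 1" using assms by simp
  obtain A where A: "0 < A"
    "\<And>s' t'. 0 \<le> s' \<Longrightarrow> s' \<le> t' \<Longrightarrow> t' < t + 1 \<Longrightarrow>
      (t' - s') * (energy_J p U (v t') - energy_J p U (v s')) \<le> - (H1_norm U (\<lambda>x. v t' x - v s' x))\<^sup>2 + A * (t' - s') ^ 3"
    by (rule evolution_estimates[OF sol_on[OF T] T]) blast
  show ?thesis
  proof (rule nonincreasing_if_quadratic_increments[OF assms(2)])
    fix s' t' assume st: "s \<le> s'" "s' \<le> t'" "t' \<le> t"
    show "energy_J p U (v t') - energy_J p U (v s') \<le> A * (t' - s')\<^sup>2"
    proof (cases "s' = t'")
      case False
      then have h: "0 < t' - s'" using st by simp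
      have "(t' - s') * (energy_J p U (v t') - energy_J p U (v s')) \<le> A * (t' - s') ^ 3"
        using A(2)[of s' t'] st assms zero_le_power2[of "H1_norm U (\<lambda>x. v t' x - v s' x)"] by linarith
      also have "\<dots> = (t' - s') * (A * (t' - s')\<^sup>2)" by (simp add: power2_eq_square power3_eq_cube mult_ac)
      finally show ?thesis using h by (simp only: mult_le_cancel_left_pos)
    qed simp
  qed
qed

text \<open>If the energy were constant on \<open>{0..t}\<close>, then \<open>v\<close> would move by only \<open>O(h powr (3 / 2))\<close> in
  time \<open>h\<close>, whereas \<open>I (v 0) > 0\<close> forces an initial speed.\<close>

lemma energy_strict:
  assumes "0 < t"
  shows "energy_J p U (v t) < d"
proof (rule ccontr)
  assume "\<not> energy_J p U (v t) < d"
  then have eq: "energy_J p U (v h) = d" if "0 \<le> h" "h \<le> t" for h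
    using energy_antimono[of 0 h] energy_antimono[of h t] that J0 by simp
  have T: "0 < t + 1" using assms by simp
  obtain A where A: "0 < A"
    "\<And>s' t'. 0 \<le> s' \<Longrightarrow> s' \<le> t' \<Longrightarrow> t' < t + 1 \<Longrightarrow>
      (t' - s') * (energy_J p U (v t') - energy_J p U (v s')) \<le> - (H1_norm U (\<lambda>x. v t' x - v s' x))\<^sup>2 + A * (t' - s') ^ 3"
    "\<And>s' t'. 0 \<le> s' \<Longrightarrow> s' \<le> t' \<Longrightarrow> t' < t + 1 \<Longrightarrow>
      (t' - s') * nehari_I p U (v s') \<le> H1_norm U (\<lambda>x. v t' x - v s' x) * H1_norm U (v s') + A * (t' - s')\<^sup>2"
    by (rule evolution_estimates[OF sol_on[OF T] T]) blast
  let ?N = "H1_norm U (v 0)"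
  have le: "nehari_I p U (v 0) \<le> sqrt (A * h) * ?N + A * h" if h: "0 < h" "h < t" for h
  proof -
    have "(H1_norm U (\<lambda>x. v h x - v 0 x))\<^sup>2 \<le> A * h ^ 3"
      using A(2)[of 0 h] eq[of 0] eq[of h] h by simp
    also have "\<dots> = (h * sqrt (A * h))\<^sup>2"
      using h A(1) by (simp add: power_mult_distrib power2_eq_square power3_eq_cube)
    finally have "H1_norm U (\<lambda>x. v h x - v 0 x) \<le> h * sqrt (A * h)"
      by (rule power2_le_imp_le) (use h A(1) in auto)
    then have "H1_norm U (\<lambda>x. v h x - v 0 x) * ?N \<le> h * sqrt (A * h) * ?N"
      by (rule mult_right_mono[OF _ H1_norm_nonneg])
    moreover have "h * nehari_I p U (v 0) \<le> H1_norm U (\<lambda>x. v h x - v 0 x) * ?N + A * h\<^sup>2"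
      using A(3)[of 0 h] h by simp
    ultimately have "h * nehari_I p U (v 0) \<le> h * (sqrt (A * h) * ?N + A * h)"
      by (simp add: distrib_left power2_eq_square mult_ac)
    then show ?thesis using h by (simp only: mult_le_cancel_left_pos)
  qed
  have "((\<lambda>h. sqrt (A * h) * ?N + A * h) \<longlongrightarrow> sqrt (A * 0) * ?N + A * 0) (at_right 0)"
    by (intro tendsto_intros)
  moreover have "\<forall>\<^sub>F h in at_right 0. nehari_I p U (v 0) \<le> sqrt (A * h) * ?N + A * h"
    using le assms by (auto simp: eventually_at_right_field)
  ultimately have "nehari_I p U (v 0) \<le> sqrt (A * 0) * ?N + A * 0"
    using tendsto_lowerbound trivial_limit_at_right_real by blast
  with I0 show False by simp
qed

text \<open>Examines the last time \<open>r\<close> before \<open>t\<close> at which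
  \<open>I\<close> is nonnegative. Both ways in which \<open>I\<close> may vanish there are
  contradictory: one by the strict energy bound, the other by the maximality of
  \<open>r\<close>.\<close>

lemma nehari_I_nonneg:
  assumes "0 \<le> t"
  shows "0 \<le> nehari_I p U (v t)"
proof (rule ccontr)
  assume neg: "\<not> 0 \<le> nehari_I p U (v t)"
  have T: "0 < t + 1" using assms by simp
  obtain A where A: "0 < A"
    "\<And>s' t'. 0 \<le> s' \<Longrightarrow> s' \<le> t' \<Longrightarrow> t' < t + 1 \<Longrightarrow> \<bar>nehari_I p U (v t') - nehari_I p U (v s')\<bar> \<le> A * (t' - s')"
    "\<And>s' t'. 0 \<le> s' \<Longrightarrow> s' \<le> t' \<Longrightarrow> t' < t + 1 \<Longrightarrow> H1_norm U (\<lambda>x. v t' x - v s' x) \<le> A * (t' - s')"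
    by (rule evolution_estimates[OF sol_on[OF T] T]) blast
  let ?I = "\<lambda>t. nehari_I p U (v t)"
  have "A-lipschitz_on {0..t} ?I"
  proof (rule lipschitz_onI)
    fix x y assume "x \<in> {0..t}" "y \<in> {0..t}"
    then show "dist (?I x) (?I y) \<le> A * dist x y"
      using A(2)[of x y] A(2)[of y x] by (cases "x \<le> y") (auto simp: dist_real_def abs_minus_commute)
  qed (use A in simp)
  then have Ic: "continuous_on {0..t} ?I" by (rule lipschitz_on_continuous_on)
  define S where "S = {r \<in> {0..t}. ?I r \<in> {0..}}"
  have "S = {0..t} \<inter> ?I -` {0..}" by (auto simp: S_def)
  then have "closed S" using continuous_closed_preimage[OF Ic] by simp
  moreover have "bounded S" by (rule bounded_subset[of "{0..t}"]) (auto simp: S_def)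
  ultimately have "compact S" by (simp add: compact_eq_bounded_closed)
  moreover have "0 \<in> S" using I0 assms by (simp add: S_def)
  ultimately obtain r where r: "r \<in> S" "\<And>q. q \<in> S \<Longrightarrow> q \<le> r"
    using compact_attains_sup[of S] by auto
  have rt: "0 \<le> r" "r < t" "0 \<le> ?I r" using r(1) neg by (auto simp: S_def less_le)
  have Ir: "?I r = 0"
  proof (rule ccontr)
    assume ne: "?I r \<noteq> 0"
    have "continuous_on {r..t} ?I" by (rule continuous_on_subset[OF Ic]) (use rt in auto)
    then obtain q where q: "r \<le> q" "q \<le> t" "?I q = 0"
      using IVT2'[of ?I t 0 r] rt neg by auto
    then have "q \<in> S" using rt by (simp add: S_def)
    then have "q = r" using r(2)[of q] q by simp
    with q(3) ne show False by simp
  qed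
  \<comment> \<open>The strict energy bound holds at positive times only; \<open>r = 0\<close> is
    excluded by the initial sign of \<open>I\<close>.\<close>
  with I0 rt have r0: "0 < r" by (cases "r = 0") auto
  have g0: "gnorm U (v r) = 0"
  proof (rule ccontr)
    assume "gnorm U (v r) \<noteq> 0"
    then have "v r \<in> nehari p U"
      unfolding nehari_def using Ir sol_H01[OF rt(1)] by (simp add: gnorm_def)
    from well[OF this] energy_strict[OF r0] show False by simp
  qed
  obtain \<delta> where \<delta>: "0 < \<delta>"
    "\<And>u. u \<in> H01 U \<Longrightarrow> energy_finite p U u \<Longrightarrow> gnorm U u \<le> \<delta> \<Longrightarrow> 0 \<le> nehari_I p U u"
    using nehari_I_small by blast
  \<comment> \<open>The gradient grows from 0 at speed at most \<open>A\<close>, so up to this time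
    it stays within \<open>\<delta>\<close>, where \<open>I\<close> cannot be negative.\<close>
  define q where "q = min t (r + \<delta> / A)"
  have q: "r < q" "q \<le> t" "q - r \<le> \<delta> / A" using rt A(1) \<delta>(1) by (auto simp: q_def)
  have q0: "0 \<le> q" using q rt by simp
  have "gnorm U (v q) \<le> gnorm U (v r) + gnorm U (\<lambda>x. v q x - v r x)"
    using H1s.nrm_diff_bound[OF H01_H1 H01_H1, OF sol_H01[OF q0] sol_H01[OF rt(1)]] by (simp add: H1s_nrm)
  also have "\<dots> \<le> A * (q - r)"
    using g0 A(3)[of r q] q rt gnorm_le_H1_norm[of U "\<lambda>x. v q x - v r x"] by simp
  also have "\<dots> \<le> A * (\<delta> / A)" using q(3) A(1) by (intro mult_left_mono) auto
  also have "\<dots> = \<delta>" using A(1) by simp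
  finally have "0 \<le> ?I q" by (intro \<delta>(2) H01_energy_finite sol_H01 q0)
  then have "q \<in> S" using q q0 by (simp add: S_def)
  with r(2)[of q] q show False by simp
qed

lemma exponential_decay:
  "\<exists>C>0. \<exists>\<mu>>0. \<forall>t\<ge>0. H1_norm U (v t) \<le> C * exp (- \<mu> * t)"
proof -
  obtain P where P: "P > 0" "\<And>u. u \<in> H01 U \<Longrightarrow> Lnorm U 2 u \<le> P * gnorm U u" using Poincare by blast
  obtain \<kappa> where \<kappa>: "0 < \<kappa>"
    "\<And>u. u \<in> H01 U \<Longrightarrow> energy_finite p U u \<Longrightarrow> 0 \<le> nehari_I p U u \<Longrightarrow> energy_J p U u \<le> energy_J p U (v 1)
      \<Longrightarrow> \<kappa> * (gnorm U u)\<^sup>2 \<le> nehari_I p U u"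
    using nehari_I_coercive[OF energy_strict[of 1]] by auto
  define y where "y t = (H1_norm U (v t))\<^sup>2" for t
  have y0: "0 \<le> y t" for t by (simp add: y_def)
  \<comment> \<open>Poincare's inequality bounds the squared H1 norm by \<open>P\<^sup>2 + 1\<close>
    times the squared gradient norm; the 2 comes from the derivative \<open>- 2 * I\<close>.\<close>
  define k where "k = 2 * \<kappa> / (P\<^sup>2 + 1)"
  have P1: "0 < P\<^sup>2 + 1" by (simp add: add_nonneg_pos)
  have k: "0 < k" using \<kappa>(1) P1 by (simp add: k_def)
  have coer: "k * y s \<le> 2 * nehari_I p U (v s)" if "1 \<le> s" for s
  proof -
    have s0: "0 \<le> s" using that by simp
    have "(Lnorm U 2 (v s))\<^sup>2 \<le> (P * gnorm U (v s))\<^sup>2"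
      using P(2)[OF sol_H01[OF s0]] by (intro power_mono) (simp_all add: Lnorm_2 L2_inner_self_nonneg)
    then have "y s \<le> (P\<^sup>2 + 1) * (gnorm U (v s))\<^sup>2"
      by (simp add: y_def H1_norm_sq power_mult_distrib algebra_simps)
    then have "k * y s \<le> k * ((P\<^sup>2 + 1) * (gnorm U (v s))\<^sup>2)" using k by (intro mult_left_mono) auto
    also have "\<dots> = 2 * (\<kappa> * (gnorm U (v s))\<^sup>2)" using P1 by (simp add: k_def)
    also have "\<dots> \<le> 2 * nehari_I p U (v s)"
      using \<kappa>(2)[OF sol_H01[OF s0] H01_energy_finite[OF sol_H01[OF s0]] nehari_I_nonneg[OF s0] energy_antimono[OF _ that]]
      by simp
    finally show ?thesis .
  qed
  have inc: "\<exists>A>0. \<forall>s t'. 0 \<le> s \<longrightarrow> s \<le> t' \<longrightarrow> t' \<le> t \<longrightarrow> y t' - y s \<le> - 2 * (t' - s) * nehari_I p U (v s) + A * (t' - s)\<^sup>2"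
    if "0 \<le> t" for t
  proof -
    have T: "0 < t + 1" using that by simp
    show ?thesis unfolding y_def
      by (rule evolution_estimates[OF sol_on[OF T] T]) (rule exI, auto)
  qed
  \<comment> \<open>Covers the interval before time 1, where only \<open>I \<ge> 0\<close> is at
    hand.\<close>
  have mono: "y t \<le> y 0" if t: "0 \<le> t" for t
  proof -
    obtain A where A: "A > 0" "\<And>s t'. 0 \<le> s \<Longrightarrow> s \<le> t' \<Longrightarrow> t' \<le> t \<Longrightarrow> y t' - y s \<le> - 2 * (t' - s) * nehari_I p U (v s) + A * (t' - s)\<^sup>2"
      using inc[OF t] by blast
    show ?thesis
    proof (rule nonincreasing_if_quadratic_increments[OF t, of y A])
      fix s t' assume st: "0 \<le> s" "s \<le> t'" "t' \<le> t"
      have "0 \<le> (t' - s) * nehari_I p U (v s)" using st nehari_I_nonneg[OF st(1)] by simp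
      moreover have "- 2 * (t' - s) * nehari_I p U (v s) = - (2 * ((t' - s) * nehari_I p U (v s)))"
        by (simp add: algebra_simps)
      ultimately show "y t' - y s \<le> A * (t' - s)\<^sup>2" using A(2)[OF st] by linarith
    qed
  qed
  have dec: "y t * exp (k * t) \<le> y 1 * exp (k * 1)" if t: "1 \<le> t" for t
  proof -
    obtain A where A: "A > 0" "\<And>s t'. 0 \<le> s \<Longrightarrow> s \<le> t' \<Longrightarrow> t' \<le> t \<Longrightarrow> y t' - y s \<le> - 2 * (t' - s) * nehari_I p U (v s) + A * (t' - s)\<^sup>2"
      using inc[of t] t by auto
    show ?thesis
    proof (rule nonincreasing_if_quadratic_increments[OF t, of "\<lambda>t. y t * exp (k * t)" "exp (k * t) * A"])
      fix s r assume st: "1 \<le> s" "s \<le> r" "r \<le> t"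
      have h: "0 \<le> r - s" using st by simp
      have "y r - y s \<le> - (r - s) * (2 * nehari_I p U (v s)) + A * (r - s)\<^sup>2"
        using A(2)[of s r] st by (simp add: algebra_simps)
      also have "\<dots> \<le> - (r - s) * (k * y s) + A * (r - s)\<^sup>2"
        unfolding mult_minus_left using mult_left_mono[OF coer[OF st(1)] h] by (intro add_right_mono le_imp_neg_le)
      finally have 1: "y r - y s \<le> - (k * (r - s)) * y s + A * (r - s)\<^sup>2" by (simp add: algebra_simps)
      \<comment> \<open>Passing from the linear factor to the exponential makes the weight
        \<open>exp (k * t)\<close> cancel exactly, leaving only the quadratic error.\<close>
      have "1 - k * (r - s) \<le> exp (- (k * (r - s)))"
        using exp_ge_add_one_self[of "- (k * (r - s))"] by simp
      from mult_right_mono[OF this y0[of s]]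
      have "y r \<le> exp (- (k * (r - s))) * y s + A * (r - s)\<^sup>2" using 1 by (simp add: left_diff_distrib)
      then have "y r * exp (k * r) \<le> (exp (- (k * (r - s))) * y s + A * (r - s)\<^sup>2) * exp (k * r)"
        by (intro mult_right_mono) auto
      also have "\<dots> = y s * exp (k * s) + exp (k * r) * (A * (r - s)\<^sup>2)"
        by (simp add: distrib_right exp_diff exp_minus right_diff_distrib field_simps)
      also have "\<dots> \<le> y s * exp (k * s) + exp (k * t) * (A * (r - s)\<^sup>2)"
        using st k A(1) by (intro add_left_mono mult_right_mono) auto
      finally show "y r * exp (k * r) - y s * exp (k * s) \<le> exp (k * t) * A * (r - s)\<^sup>2" by (simp add: mult_ac)
    qed
  qed
  have bound: "y t * exp (k * t) \<le> y 0 * exp k" if t: "0 \<le> t" for t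
  proof (cases "1 \<le> t")
    case True
    have "y t * exp (k * t) \<le> y 1 * exp (k * 1)" by (rule dec[OF True])
    also have "\<dots> \<le> y 0 * exp (k * 1)" using mono[of 1] by (intro mult_right_mono) auto
    finally show ?thesis by simp
  next
    case False
    then show ?thesis using mono[OF t] k y0 by (intro mult_mono) auto
  qed
  \<comment> \<open>The exponential compensates for the first unit of time, and the added 1 ensures
    positivity.\<close>
  define C where "C = H1_norm U (v 0) * exp (k / 2) + 1"
  have C: "0 < C" using H1_norm_nonneg[of U "v 0"] by (simp add: C_def add_nonneg_pos)
  have "H1_norm U (v t) \<le> C * exp (- (k / 2) * t)" if t: "0 \<le> t" for t
  proof -
    have e: "(exp (k / 2 * s))\<^sup>2 = exp (k * s)" for s
      by (simp add: power2_eq_square flip: exp_add)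
    have "(H1_norm U (v t) * exp (k / 2 * t))\<^sup>2 \<le> (H1_norm U (v 0) * exp (k / 2 * 1))\<^sup>2"
      using bound[OF t] unfolding power_mult_distrib e by (simp add: y_def)
    then have "H1_norm U (v t) * exp (k / 2 * t) \<le> H1_norm U (v 0) * exp (k / 2 * 1)"
      by (rule power2_le_imp_le) (simp add: H1_norm_nonneg)
    then have "H1_norm U (v t) * exp (k / 2 * t) \<le> C" by (simp add: C_def)
    then have "H1_norm U (v t) \<le> C / exp (k / 2 * t)" by (simp add: pos_le_divide_eq)
    also have "\<dots> = C * exp (- (k / 2) * t)" unfolding divide_inverse exp_minus[symmetric] by simp
    finally show ?thesis .
  qed
  with C k show ?thesis by (intro exI[of _ C] exI[of _ "k / 2"] conjI allI impI) auto
qed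

end

end

theorem theorem4p2:
  fixes U :: "(real ^ 'n) set" and p :: real
    and v0 :: "real ^ 'n \<Rightarrow> real" and v :: "real \<Rightarrow> real ^ 'n \<Rightarrow> real"
  assumes "p > 1"
    and "smooth_bounded_domain U"
    and "v0 \<in> H01 U"
    and "nehari_I p U v0 > 0"
    and "energy_J p U v0 = well_depth p U"
    and "global_weak_solution p U v0 v"
  shows "\<exists>C>0. \<exists>\<mu>>0. \<forall>t\<ge>0. H1_norm U (v t) \<le> C * exp (- \<mu> * t)"
proof -
  interpret bounded_open_set U
    by unfold_locales (use assms(2) in \<open>auto simp: smooth_bounded_domain_def\<close>)
  have "weak_solution p U 1 v0 v" using assms(6) by (simp add: global_weak_solution_def)
  then have v: "v 0 \<in> H01 U" "AE x in lebesgue_on U. v 0 x = v0 x"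
    by (auto simp: weak_solution_def)
  note eq = functionals_AE[OF H01_L2[OF v(1)] H01_L2[OF assms(3)] v(2), of p]
  \<comment> \<open>The energy is at least \<open>I / (1 + p)\<close>, and
    \<open>I v0 > 0\<close>.\<close>
  have d: "0 < well_depth p U"
  proof -
    have "0 < nehari_I p U v0 / (1 + p)" using assms by simp
    also have "\<dots> \<le> energy_J p U v0"
      unfolding energy_J_via_I[OF assms(1)] using assms(1) power_energy_nonneg[of p U v0] by simp
    finally show ?thesis using assms(5) by simp
  qed
  \<comment> \<open>A real infimum is a lower bound only of a set bounded below; on the Nehari
    manifold \<open>I = 0\<close> makes the energy nonnegative.\<close>
  have well: "well_depth p U \<le> energy_J p U w" if "w \<in> nehari p U" for w
    unfolding well_depth_def
  proof (rule cINF_lower[OF _ that])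
    show "bdd_below (energy_J p U ` nehari p U)"
      using energy_J_nonneg[OF assms(1), of U] by (intro bdd_belowI[of _ 0]) (auto simp: nehari_def)
  qed
  interpret positive_well U p "well_depth p U"
    by unfold_locales (use assms(1) d well in auto)
  show ?thesis
    by (rule exponential_decay[OF assms(6)]) (use eq assms in auto)
qed

end
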